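(* Let $A$ be a countable sub-$\mathbb{N}$-algebra (subsemiring containing $0$ and $1$) of $\mathbb{R}_+=\{x\in\mathbb{R}: x\ge0\}$. (1) If $A$ is not dense in $\mathbb{R}_+$, then $W(A)$ and $W^{\mathrm{Sch}}(A)$ are countable. (2) If $A$ is dense in $\mathbb{R}_+$ and of the form $B\cap\mathbb{R}_+$ for some subring $B\subseteq\mathbb{R}$, then $W(A)$ and $W^{\mathrm{Sch}}(A)$ are uncountable.
   Context: $\mathbb{N}=\{0,1,\dots\}$. Semirings are commutative with $0,1$; homomorphisms preserve $0,1$. Let $\Lambda_{\mathbb{Z}}$ be the ring of symmetric functions in $x_1,x_2,\dots$, with monomial basis $(m_\lambda)$ and Schur basis $(s_\lambda)$ indexed by partitions. Put $\Lambda_{\mathbb{N}}=\bigoplus_\lambda\mathbb{N}m_\lambda$ and $\Lambda^{\mathrm{Sch}}=\bigoplus_\lambda\mathbb{N}s_\lambda$, subsemirings of $\Lambda_{\mathbb{Z}}$. For a semiring $A$, $W(A)=\mathrm{Hom}_{\mathrm{semiring}}(\Lambda_{\mathbb{N}},A)$ and $W^{\mathrm{Sch}}(A)=\mathrm{Hom}_{\mathrm{semiring}}(\Lambda^{\mathrm{Sch}},A)$. *)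

theory Defs
  imports "HOL-Analysis.Analysis" "HOL-Library.Poly_Mapping" "HOL-Library.Multiset"
begin

section \<open>Formal power series over the integers in countably many variables\<close>

text \<open>
  A monomial in \<open>x\<^sub>0, x\<^sub>1, \<dots>\<close> is its finitely supported exponent vector
  \<open>\<alpha> :: nat \<Rightarrow>\<^sub>0 nat\<close>.
\<close>

typedef mpser = "UNIV :: ((nat \<Rightarrow>\<^sub>0 nat) \<Rightarrow> int) set"
  morphisms mpcoeff Abs_mpser ..

lemma mpcoeff_Abs [simp]: "mpcoeff (Abs_mpser f) = f"
  by (simp add: Abs_mpser_inverse)

lemma mpser_eqI: "(\<And>\<alpha>. mpcoeff f \<alpha> = mpcoeff g \<alpha>) \<Longrightarrow> f = g"
  by (metis ext mpcoeff_inject)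

lemma finite_add_decomp:
  fixes \<alpha> :: "nat \<Rightarrow>\<^sub>0 nat"
  shows "finite {(\<beta>, \<gamma>). \<beta> + \<gamma> = \<alpha>}"
proof -
  let ?P = "{(\<beta>, \<gamma>). \<beta> + \<gamma> = \<alpha>}"
  let ?K = "Poly_Mapping.keys \<alpha>"
  let ?r = "\<lambda>(\<beta> :: nat \<Rightarrow>\<^sub>0 nat, \<gamma> :: nat \<Rightarrow>\<^sub>0 nat).
    (\<lambda>k\<in>?K. Poly_Mapping.lookup \<beta> k, \<lambda>k\<in>?K. Poly_Mapping.lookup \<gamma> k)"
  let ?F = "PiE ?K (\<lambda>k. {..Poly_Mapping.lookup \<alpha> k})"
  have out: "Poly_Mapping.lookup \<beta> k = 0 \<and> Poly_Mapping.lookup \<gamma> k = 0"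
    if "\<beta> + \<gamma> = \<alpha>" "k \<notin> ?K" for \<beta> \<gamma> k
    using that by (metis add_is_0 in_keys_iff lookup_add)
  have "inj_on ?r ?P"
  proof (rule inj_onI, clarify)
    fix \<beta> \<gamma> \<beta>' \<gamma>' :: "nat \<Rightarrow>\<^sub>0 nat"
    assume a: "\<alpha> = \<beta> + \<gamma>" "\<beta>' + \<gamma>' = \<beta> + \<gamma>"
      and r: "(\<lambda>k\<in>Poly_Mapping.keys (\<beta> + \<gamma>). Poly_Mapping.lookup \<beta> k) =
          (\<lambda>k\<in>Poly_Mapping.keys (\<beta> + \<gamma>). Poly_Mapping.lookup \<beta>' k)"
        "(\<lambda>k\<in>Poly_Mapping.keys (\<beta> + \<gamma>). Poly_Mapping.lookup \<gamma> k) =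
          (\<lambda>k\<in>Poly_Mapping.keys (\<beta> + \<gamma>). Poly_Mapping.lookup \<gamma>' k)"
    have "Poly_Mapping.lookup \<beta> k = Poly_Mapping.lookup \<beta>' k" for k
      using fun_cong[OF r(1), of k] out[of \<beta> \<gamma> k] out[of \<beta>' \<gamma>' k] a
      by (cases "k \<in> ?K") auto
    moreover have "Poly_Mapping.lookup \<gamma> k = Poly_Mapping.lookup \<gamma>' k" for k
      using fun_cong[OF r(2), of k] out[of \<beta> \<gamma> k] out[of \<beta>' \<gamma>' k] a
      by (cases "k \<in> ?K") auto
    ultimately show "\<beta> = \<beta>' \<and> \<gamma> = \<gamma>'"
      by (simp add: poly_mapping_eqI)
  qed
  moreover have "?r ` ?P \<subseteq> ?F \<times> ?F"
    by (auto simp: lookup_add)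
  moreover have "finite (?F \<times> ?F)"
    by (intro finite_cartesian_product finite_PiE) auto
  ultimately show ?thesis
    by (meson finite_imageD finite_subset)
qed

lemma finite_add_decomp3:
  fixes \<alpha> :: "nat \<Rightarrow>\<^sub>0 nat"
  shows "finite {(\<beta>, \<gamma>, \<delta>). \<beta> + \<gamma> + \<delta> = \<alpha>}"
proof -
  have "{(\<beta>, \<gamma>, \<delta>). \<beta> + \<gamma> + \<delta> = \<alpha>} \<subseteq>
      (\<lambda>((\<sigma>, \<delta>), (\<beta>, \<gamma>)). (\<beta>, \<gamma>, \<delta>)) `
      (SIGMA p:{(\<sigma>, \<delta>). \<sigma> + \<delta> = \<alpha>}. {(\<beta>, \<gamma>). \<beta> + \<gamma> = fst p})"
    by (force simp: image_iff)
  moreover have "finite (SIGMA p:{(\<sigma>, \<delta>). \<sigma> + \<delta> = \<alpha>}. {(\<beta>, \<gamma>). \<beta> + \<gamma> = fst p})"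
    by (intro finite_SigmaI finite_add_decomp)
  ultimately show ?thesis
    by (meson finite_imageI finite_subset)
qed

instantiation mpser :: comm_ring_1
begin

definition zero_mpser_def: "0 = Abs_mpser (\<lambda>_. 0)"
definition one_mpser_def: "1 = Abs_mpser (\<lambda>\<alpha>. if \<alpha> = 0 then 1 else 0)"
definition plus_mpser_def: "f + g = Abs_mpser (\<lambda>\<alpha>. mpcoeff f \<alpha> + mpcoeff g \<alpha>)"
definition uminus_mpser_def: "- f = Abs_mpser (\<lambda>\<alpha>. - mpcoeff f \<alpha>)"
definition minus_mpser_def: "f - g = Abs_mpser (\<lambda>\<alpha>. mpcoeff f \<alpha> - mpcoeff g \<alpha>)"
definition times_mpser_def:
  "f * g = Abs_mpser (\<lambda>\<alpha>. \<Sum>(\<beta>, \<gamma>) | \<beta> + \<gamma> = \<alpha>. mpcoeff f \<beta> * mpcoeff g \<gamma>)"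

lemmas mpser_defs = zero_mpser_def one_mpser_def plus_mpser_def uminus_mpser_def
  minus_mpser_def times_mpser_def

instance
proof
  fix f g h :: mpser
  show "f + g + h = f + (g + h)" "f + g = g + f" "0 + f = f" "- f + f = 0" "f - g = f + - g"
    by (auto intro!: mpser_eqI simp: mpser_defs)
  show "(0 :: mpser) \<noteq> 1"
  proof
    assume "(0 :: mpser) = 1"
    then have "mpcoeff 0 0 = mpcoeff 1 0" by simp
    then show False by (simp add: mpser_defs)
  qed
  show "f * g = g * f"
  proof (rule mpser_eqI)
    fix \<alpha>
    have "(\<Sum>(\<beta>, \<gamma>) | \<beta> + \<gamma> = \<alpha>. mpcoeff f \<beta> * mpcoeff g \<gamma>) =
        (\<Sum>(\<beta>, \<gamma>) | \<beta> + \<gamma> = \<alpha>. mpcoeff g \<beta> * mpcoeff f \<gamma>)"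
      by (rule sum.reindex_bij_witness[of _ prod.swap prod.swap])
        (auto simp: add.commute mult.commute)
    then show "mpcoeff (f * g) \<alpha> = mpcoeff (g * f) \<alpha>"
      by (simp add: mpser_defs)
  qed
  show "(f + g) * h = f * h + g * h"
    by (auto intro!: mpser_eqI simp: mpser_defs distrib_right sum.distrib case_prod_unfold)
  show "1 * f = f"
  proof (rule mpser_eqI)
    fix \<alpha>
    have "mpcoeff (1 * f) \<alpha> =
        (\<Sum>(\<beta>, \<gamma>) | \<beta> + \<gamma> = \<alpha>. (if \<beta> = 0 then 1 else 0) * mpcoeff f \<gamma>)"
      by (simp add: mpser_defs)
    also have "\<dots> = (\<Sum>(\<beta>, \<gamma>) \<in> {(0 :: nat \<Rightarrow>\<^sub>0 nat, \<alpha>)}. (if \<beta> = 0 then 1 else 0) * mpcoeff f \<gamma>)"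
      by (rule sum.mono_neutral_right) (auto simp: finite_add_decomp split: if_splits)
    finally show "mpcoeff (1 * f) \<alpha> = mpcoeff f \<alpha>" by simp
  qed
  show "f * g * h = f * (g * h)"
  proof (rule mpser_eqI)
    fix \<alpha>
    let ?T = "\<lambda>(\<beta>, \<gamma>, \<delta>). mpcoeff f \<beta> * mpcoeff g \<gamma> * mpcoeff h \<delta>"
    have "mpcoeff (f * g * h) \<alpha> = (\<Sum>p | fst p + snd p = \<alpha>. \<Sum>q | fst q + snd q = fst p.
        mpcoeff f (fst q) * mpcoeff g (snd q) * mpcoeff h (snd p))"
      by (simp add: mpser_defs sum_distrib_right case_prod_unfold)
    also have "\<dots> = (\<Sum>(p, q) \<in> (SIGMA p:{p. fst p + snd p = \<alpha>}. {q. fst q + snd q = fst p}).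
        mpcoeff f (fst q) * mpcoeff g (snd q) * mpcoeff h (snd p))"
      using finite_add_decomp by (subst sum.Sigma) (auto simp: case_prod_unfold)
    also have "\<dots> = sum ?T {(\<beta>, \<gamma>, \<delta>). \<beta> + \<gamma> + \<delta> = \<alpha>}"
      by (rule sum.reindex_bij_witness[of _ "\<lambda>(\<beta>, \<gamma>, \<delta>). ((\<beta> + \<gamma>, \<delta>), (\<beta>, \<gamma>))"
            "\<lambda>((\<sigma>, \<delta>), (\<beta>, \<gamma>)). (\<beta>, \<gamma>, \<delta>)"]) auto
    also have "\<dots> = (\<Sum>(p, q) \<in> (SIGMA p:{p. fst p + snd p = \<alpha>}. {q. fst q + snd q = snd p}).
        mpcoeff f (fst p) * (mpcoeff g (fst q) * mpcoeff h (snd q)))"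
      by (rule sum.reindex_bij_witness[of _ "\<lambda>((\<beta>, \<sigma>), (\<gamma>, \<delta>)). (\<beta>, \<gamma>, \<delta>)"
            "\<lambda>(\<beta>, \<gamma>, \<delta>). ((\<beta>, \<gamma> + \<delta>), (\<gamma>, \<delta>))"]) (auto simp: add.assoc mult.assoc)
    also have "\<dots> = (\<Sum>p | fst p + snd p = \<alpha>. \<Sum>q | fst q + snd q = snd p.
        mpcoeff f (fst p) * (mpcoeff g (fst q) * mpcoeff h (snd q)))"
      using finite_add_decomp by (subst sum.Sigma) (auto simp: case_prod_unfold)
    also have "\<dots> = mpcoeff (f * (g * h)) \<alpha>"
      by (simp add: mpser_defs sum_distrib_left case_prod_unfold)
    finally show "mpcoeff (f * g * h) \<alpha> = mpcoeff (f * (g * h)) \<alpha>" .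
  qed
qed

end

section \<open>Symmetric functions\<close>

text \<open>
  The ring \<open>\<Lambda>\<^sub>\<int>\<close>: the power series of bounded degree invariant under all permutations
  of the variables.
\<close>

definition mdegree :: "(nat \<Rightarrow>\<^sub>0 nat) \<Rightarrow> nat" where
  "mdegree \<alpha> = (\<Sum>k\<in>Poly_Mapping.keys \<alpha>. Poly_Mapping.lookup \<alpha> k)"

definition Lambda_Z :: "mpser set" where
  "Lambda_Z = {f. (\<exists>d. \<forall>\<alpha>. mpcoeff f \<alpha> \<noteq> 0 \<longrightarrow> mdegree \<alpha> \<le> d) \<and>
    (\<forall>\<pi> \<alpha>. bij \<pi> \<longrightarrow> mpcoeff f (Poly_Mapping.map_key \<pi> \<alpha>) = mpcoeff f \<alpha>)}"

definition is_partition :: "nat list \<Rightarrow> bool" where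
  "is_partition \<mu> \<longleftrightarrow> sorted_wrt (\<ge>) \<mu> \<and> 0 \<notin> set \<mu>"

definition monomial_sym :: "nat list \<Rightarrow> mpser" where
  "monomial_sym \<mu> = Abs_mpser (\<lambda>\<alpha>.
    if image_mset (Poly_Mapping.lookup \<alpha>) (mset_set (Poly_Mapping.keys \<alpha>)) = mset \<mu>
    then 1 else 0)"

definition young_diagram :: "nat list \<Rightarrow> (nat \<times> nat) set" where
  "young_diagram \<mu> = {(i, j). i < length \<mu> \<and> j < \<mu> ! i}"

text \<open>
  Semistandard Young tableaux; the entry \<open>k\<close> stands for the variable \<open>x\<^sub>k\<close>, so entries
  start at \<open>0\<close>.
\<close>

definition ssyt :: "nat list \<Rightarrow> (nat \<times> nat \<Rightarrow> nat) set" where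
  "ssyt \<mu> = {T \<in> young_diagram \<mu> \<rightarrow>\<^sub>E UNIV.
    (\<forall>i j. (i, j) \<in> young_diagram \<mu> \<and> (i, Suc j) \<in> young_diagram \<mu> \<longrightarrow> T (i, j) \<le> T (i, Suc j)) \<and>
    (\<forall>i j. (i, j) \<in> young_diagram \<mu> \<and> (Suc i, j) \<in> young_diagram \<mu> \<longrightarrow> T (i, j) < T (Suc i, j))}"

definition schur :: "nat list \<Rightarrow> mpser" where
  "schur \<mu> = Abs_mpser (\<lambda>\<alpha>.
    int (card {T \<in> ssyt \<mu>. \<forall>k. card {c \<in> young_diagram \<mu>. T c = k} = Poly_Mapping.lookup \<alpha> k}))"

definition nat_span :: "mpser set \<Rightarrow> mpser set" where
  "nat_span X = {\<Sum>b\<in>F. of_nat (c b) * b | F c. finite F \<and> F \<subseteq> X}"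

definition Lambda_N :: "mpser set" where
  "Lambda_N = nat_span (monomial_sym ` {\<mu>. is_partition \<mu>})"

definition Lambda_Sch :: "mpser set" where
  "Lambda_Sch = nat_span (schur ` {\<mu>. is_partition \<mu>})"

section \<open>Semirings, rings and homomorphisms\<close>

definition is_subsemiring :: "'a::comm_semiring_1 set \<Rightarrow> bool" where
  "is_subsemiring A \<longleftrightarrow> 0 \<in> A \<and> 1 \<in> A \<and> (\<forall>x\<in>A. \<forall>y\<in>A. x + y \<in> A \<and> x * y \<in> A)"

definition is_subring :: "'a::comm_ring_1 set \<Rightarrow> bool" where
  "is_subring B \<longleftrightarrow> is_subsemiring B \<and> (\<forall>x\<in>B. - x \<in> B)"

text \<open>
  Homomorphisms are extensional, so that each one is represented by exactly one HOL function
  and cardinalities of sets of homomorphisms are the intended ones.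
\<close>

definition semiring_hom ::
  "'a::comm_semiring_1 set \<Rightarrow> 'b::comm_semiring_1 set \<Rightarrow> ('a \<Rightarrow> 'b) set" where
  "semiring_hom S A = {\<phi> \<in> S \<rightarrow>\<^sub>E A. \<phi> 0 = 0 \<and> \<phi> 1 = 1 \<and>
    (\<forall>f\<in>S. \<forall>g\<in>S. \<phi> (f + g) = \<phi> f + \<phi> g \<and> \<phi> (f * g) = \<phi> f * \<phi> g)}"

definition Witt :: "'a::comm_semiring_1 set \<Rightarrow> (mpser \<Rightarrow> 'a) set" where
  "Witt A = semiring_hom Lambda_N A"

definition Witt_Sch :: "'a::comm_semiring_1 set \<Rightarrow> (mpser \<Rightarrow> 'a) set" where
  "Witt_Sch A = semiring_hom Lambda_Sch A"

section \<open>Sanity checks\<close>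

lemma lookup_map_key_bij:
  "bij \<pi> \<Longrightarrow> Poly_Mapping.lookup (Poly_Mapping.map_key \<pi> \<alpha>) k = Poly_Mapping.lookup \<alpha> (\<pi> k)"
  by (simp add: bij_is_inj map_key.rep_eq)

lemma mdegree_add: "mdegree (\<alpha> + \<beta>) = mdegree \<alpha> + mdegree \<beta>"
proof -
  let ?K = "Poly_Mapping.keys \<alpha> \<union> Poly_Mapping.keys \<beta>"
  have *: "mdegree \<gamma> = (\<Sum>k\<in>?K. Poly_Mapping.lookup \<gamma> k)" if "Poly_Mapping.keys \<gamma> \<subseteq> ?K" for \<gamma>
    unfolding mdegree_def using that
    by (intro sum.mono_neutral_left) (auto simp: in_keys_iff)
  show ?thesis
    by (subst (1 2 3) *) (auto simp: lookup_add sum.distrib in_keys_iff)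
qed

lemma is_subring_Lambda_Z: "is_subring Lambda_Z"
proof -
  have "f * g \<in> Lambda_Z" if f: "f \<in> Lambda_Z" and g: "g \<in> Lambda_Z" for f g
  proof -
    obtain d e where d: "\<And>\<alpha>. mpcoeff f \<alpha> \<noteq> 0 \<Longrightarrow> mdegree \<alpha> \<le> d"
      and e: "\<And>\<alpha>. mpcoeff g \<alpha> \<noteq> 0 \<Longrightarrow> mdegree \<alpha> \<le> e"
      using f g unfolding Lambda_Z_def by blast
    have "mdegree \<alpha> \<le> d + e" if nz: "mpcoeff (f * g) \<alpha> \<noteq> 0" for \<alpha>
    proof -
      obtain p where "p \<in> {(\<beta>, \<gamma>). \<beta> + \<gamma> = \<alpha>}"
        "(case p of (\<beta>, \<gamma>) \<Rightarrow> mpcoeff f \<beta> * mpcoeff g \<gamma>) \<noteq> 0"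
        using nz unfolding times_mpser_def mpcoeff_Abs by (meson sum.neutral)
      then show ?thesis
        using d e by (auto simp: mdegree_add add_mono)
    qed
    moreover have "mpcoeff (f * g) (Poly_Mapping.map_key \<pi> \<alpha>) = mpcoeff (f * g) \<alpha>"
      if \<pi>: "bij \<pi>" for \<pi> \<alpha>
    proof -
      note [simp] = lookup_map_key_bij[OF \<pi>] lookup_map_key_bij[OF bij_imp_bij_inv[OF \<pi>]]
      have inv: "Poly_Mapping.map_key \<pi> (Poly_Mapping.map_key (inv \<pi>) \<beta>) = \<beta>"
        "Poly_Mapping.map_key (inv \<pi>) (Poly_Mapping.map_key \<pi> \<beta>) = \<beta>" for \<beta> :: "nat \<Rightarrow>\<^sub>0 nat"
        using \<pi> by (auto intro!: poly_mapping_eqI simp: bij_is_inj bij_is_surj surj_f_inv_f)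
      have add: "Poly_Mapping.map_key \<sigma> (\<beta> + \<gamma>) =
          Poly_Mapping.map_key \<sigma> \<beta> + Poly_Mapping.map_key \<sigma> \<gamma>"
        if "bij \<sigma>" for \<sigma> and \<beta> \<gamma> :: "nat \<Rightarrow>\<^sub>0 nat"
        using that by (auto intro!: poly_mapping_eqI simp: lookup_map_key_bij lookup_add)
      have sym: "mpcoeff f (Poly_Mapping.map_key \<sigma> \<beta>) = mpcoeff f \<beta>"
        "mpcoeff g (Poly_Mapping.map_key \<sigma> \<beta>) = mpcoeff g \<beta>" if "bij \<sigma>" for \<sigma> \<beta>
        using f g that unfolding Lambda_Z_def by auto
      let ?m = "\<lambda>\<sigma> (\<beta>, \<gamma>). (Poly_Mapping.map_key \<sigma> \<beta>, Poly_Mapping.map_key \<sigma> \<gamma>)"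
      show ?thesis
        unfolding times_mpser_def mpcoeff_Abs
        by (rule sum.reindex_bij_witness[of _ "?m \<pi>" "?m (inv \<pi>)"])
          (auto simp: inv sym \<pi> bij_imp_bij_inv simp flip: add)
    qed
    ultimately show ?thesis
      unfolding Lambda_Z_def by blast
  qed
  moreover have "f + g \<in> Lambda_Z" if f: "f \<in> Lambda_Z" and g: "g \<in> Lambda_Z" for f g
  proof -
    obtain d e where d: "\<And>\<alpha>. mpcoeff f \<alpha> \<noteq> 0 \<Longrightarrow> mdegree \<alpha> \<le> d"
      and e: "\<And>\<alpha>. mpcoeff g \<alpha> \<noteq> 0 \<Longrightarrow> mdegree \<alpha> \<le> e"
      using f g unfolding Lambda_Z_def by blast
    have "mdegree \<alpha> \<le> max d e" if "mpcoeff (f + g) \<alpha> \<noteq> 0" for \<alpha>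
      using that d[of \<alpha>] e[of \<alpha>]
      by (cases "mpcoeff f \<alpha> = 0") (auto simp: plus_mpser_def le_max_iff_disj)
    then show ?thesis
      using f g unfolding Lambda_Z_def by (auto simp: plus_mpser_def)
  qed
  moreover have "0 \<in> Lambda_Z"
    by (simp add: Lambda_Z_def zero_mpser_def)
  moreover have "1 \<in> Lambda_Z"
  proof -
    have "Poly_Mapping.map_key \<pi> \<alpha> = 0 \<longleftrightarrow> \<alpha> = 0"
      if "bij \<pi>" for \<pi> and \<alpha> :: "nat \<Rightarrow>\<^sub>0 nat"
    proof -
      have "Poly_Mapping.map_key \<pi> \<alpha> = 0 \<longleftrightarrow> (\<forall>k. Poly_Mapping.lookup \<alpha> (\<pi> k) = 0)"
        using that by (simp add: poly_mapping_eq_iff fun_eq_iff lookup_map_key_bij)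
      also have "\<dots> \<longleftrightarrow> (\<forall>k. Poly_Mapping.lookup \<alpha> k = 0)"
        using that by (metis bij_pointE)
      finally show ?thesis
        by (simp add: poly_mapping_eq_iff fun_eq_iff)
    qed
    then show ?thesis
      by (auto simp: Lambda_Z_def one_mpser_def)
  qed
  moreover have "- f \<in> Lambda_Z" if "f \<in> Lambda_Z" for f
    using that by (simp add: Lambda_Z_def uminus_mpser_def)
  ultimately show ?thesis
    by (simp add: is_subring_def is_subsemiring_def)
qed

lemma monomial_sym_in_Lambda_Z: "monomial_sym \<mu> \<in> Lambda_Z"
proof -
  let ?e = "\<lambda>\<alpha> :: nat \<Rightarrow>\<^sub>0 nat.
    image_mset (Poly_Mapping.lookup \<alpha>) (mset_set (Poly_Mapping.keys \<alpha>))"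
  have "mdegree \<alpha> = sum_mset (?e \<alpha>)" for \<alpha>
    by (simp add: mdegree_def sum_unfold_sum_mset)
  then have "\<exists>d. \<forall>\<alpha>. mpcoeff (monomial_sym \<mu>) \<alpha> \<noteq> 0 \<longrightarrow> mdegree \<alpha> \<le> d"
    by (auto simp: monomial_sym_def)
  moreover have "?e (Poly_Mapping.map_key \<pi> \<alpha>) = ?e \<alpha>" if \<pi>: "bij \<pi>" for \<pi> \<alpha>
  proof -
    let ?K = "Poly_Mapping.keys (Poly_Mapping.map_key \<pi> \<alpha>)"
    have "\<pi> ` ?K = Poly_Mapping.keys \<alpha>"
      using \<pi> by (simp add: keys_map_key bij_is_inj bij_is_surj surj_image_vimage_eq)
    moreover have "inj_on \<pi> ?K"
      using \<pi> by (meson bij_is_inj inj_on_subset subset_UNIV)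
    ultimately have "mset_set (Poly_Mapping.keys \<alpha>) = image_mset \<pi> (mset_set ?K)"
      by (metis image_mset_mset_set)
    then have "?e \<alpha> = image_mset (\<lambda>k. Poly_Mapping.lookup \<alpha> (\<pi> k)) (mset_set ?K)"
      by (simp add: multiset.map_comp o_def)
    then show ?thesis
      by (simp add: lookup_map_key_bij[OF \<pi>] cong: image_mset_cong)
  qed
  ultimately show ?thesis
    unfolding Lambda_Z_def by (simp add: monomial_sym_def)
qed

lemma Lambda_N_subset_Lambda_Z: "Lambda_N \<subseteq> Lambda_Z"
proof -
  have sub: "0 \<in> Lambda_Z" "1 \<in> Lambda_Z"
    "\<And>f g. f \<in> Lambda_Z \<Longrightarrow> g \<in> Lambda_Z \<Longrightarrow> f + g \<in> Lambda_Z"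
    "\<And>f g. f \<in> Lambda_Z \<Longrightarrow> g \<in> Lambda_Z \<Longrightarrow> f * g \<in> Lambda_Z"
    using is_subring_Lambda_Z by (auto simp: is_subring_def is_subsemiring_def)
  have nat: "of_nat n \<in> Lambda_Z" for n
    by (induction n) (use sub in auto)
  have "(\<Sum>b\<in>F. of_nat (c b) * b) \<in> Lambda_Z" if "finite F" "F \<subseteq> Lambda_Z" for c F
    using that by (induction F) (use sub nat in auto)
  moreover have "monomial_sym ` {\<mu>. is_partition \<mu>} \<subseteq> Lambda_Z"
    using monomial_sym_in_Lambda_Z by auto
  ultimately show ?thesis
    unfolding Lambda_N_def nat_span_def by (clarify, meson order_trans)
qed

text \<open>The cardinality in the definition of \<open>schur\<close> is that of a finite set.\<close>

lemma finite_ssyt_content: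
  "finite {T \<in> ssyt \<mu>. \<forall>k. card {c \<in> young_diagram \<mu>. T c = k} = Poly_Mapping.lookup \<alpha> k}"
proof -
  have "young_diagram \<mu> = (SIGMA i:{..<length \<mu>}. {..<\<mu> ! i})"
    by (auto simp: young_diagram_def)
  then have fin: "finite (young_diagram \<mu>)" by simp
  have "{T \<in> ssyt \<mu>. \<forall>k. card {c \<in> young_diagram \<mu>. T c = k} = Poly_Mapping.lookup \<alpha> k}
      \<subseteq> (young_diagram \<mu> \<rightarrow>\<^sub>E Poly_Mapping.keys \<alpha>)"
  proof clarify
    fix T
    assume T: "T \<in> ssyt \<mu>"
      "\<forall>k. card {c \<in> young_diagram \<mu>. T c = k} = Poly_Mapping.lookup \<alpha> k"
    have "T c \<in> Poly_Mapping.keys \<alpha>" if "c \<in> young_diagram \<mu>" for c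
    proof -
      have "card {c' \<in> young_diagram \<mu>. T c' = T c} \<noteq> 0"
        using that card_gt_0_iff[of "{c' \<in> young_diagram \<mu>. T c' = T c}"] fin by fastforce
      then show ?thesis
        using T(2) by (simp add: in_keys_iff)
    qed
    then show "T \<in> young_diagram \<mu> \<rightarrow>\<^sub>E Poly_Mapping.keys \<alpha>"
      using T(1) by (auto simp: ssyt_def PiE_def)
  qed
  then show ?thesis
    using fin by (meson finite_PiE finite_keys finite_subset)
qed

end

theory Submission
  imports Defs "HOL-Combinatorics.Permutations" "Jordan_Normal_Form.Determinant"
begin

text \<open>
  If \<open>A\<close> is not dense, then it has no element in the open unit interval, since the powers of
  such an element would have dense multiples. Hence a quantity in \<open>A\<close> that decays
  superexponentially vanishes. For \<open>W(A)\<close> this applies to the values of \<open>e\<^sub>n\<close>, because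
  \<open>e\<^sub>1 e\<^sub>n - (n + 1) e\<^sub>n\<^sub>+\<^sub>1\<close> is monomial positive; so a homomorphism is
  given by finitely many elements of \<open>A\<close>. For the Schur version it applies to the staircase
  shapes: the product of \<open>s\<^sub>\<delta>\<close>, where \<open>\<delta> = (d - 1, \<dots>, 1)\<close>, with \<open>s\<^sub>1\<^sup>d\<close>
  contains the next staircase \<open>d!\<close> times. So some staircase is mapped to \<open>0\<close>, and with it
  every larger shape, in particular all large rectangles. Take \<open>k\<close> minimal such
  that some rectangle with \<open>k\<close> rows is mapped to \<open>0\<close>; the vanishing of the Jacobi--Trudi
  determinants of the longer rectangles with \<open>k\<close> rows then determines the values of all
  \<open>h\<^sub>n\<close> recursively from finitely many of them.

  If \<open>A = B \<inter> [0, \<infinity>)\<close> is dense, one chooses real-rooted polynomials \<open>q\<^sub>n\<close> with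
  negative roots, \<open>q\<^sub>n\<^sub>+\<^sub>1 = z q\<^sub>n + c\<close>, where at each step all sufficiently small
  positive \<open>c \<in> A\<close> are allowed. Evaluating at the negated roots of \<open>q\<^sub>n\<close> is monomial
  positive, sends \<open>e\<^sub>k\<close> to an element of \<open>B\<close> which is independent of \<open>n \<ge> k\<close>, and hence
  defines a homomorphism into \<open>A\<close>; two choices at each step give uncountably many.

  That the Schur-positive functions form a semiring follows from the Littlewood--Richardson
  rule, by Stembridge's sign-reversing involution; the Jacobi--Trudi identity follows from
  Macdonald's factorisation of the matrix of an alternant.
\<close>

\<comment> \<open>The monomial argument does not carry over to Schur functions: there
  \<open>e_1 e_n\<close> contains \<open>e_(n+1)\<close> only once, so nothing forces decay along
  columns. In a staircase every row, the first empty one included, can take a box independently of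
  the others; this is the source of the factorial.

  Vanishing on large shapes does not make the values of \<open>h_n\<close> vanish: they may all be
  1. Finiteness therefore has to come from a recursion, and \<open>k\<close> is taken minimal to
  keep its leading coefficient nonzero.

  The \<open>e_n\<close> and the \<open>h_n\<close> generate the two semirings only with the help of
  subtraction, so homomorphisms are first extended to differences.

  In the dense case the constant must be small to keep the roots real and positive to keep them
  negative; the root 0 of \<open>z q\<close> is simple, so a perturbation is possible. The form
  \<open>B \<inter> {0..}\<close> enters because the value of a monomial-positive function is an
  integer polynomial, with signs, in the chosen constants: it lies in \<open>B\<close> algebraically
  and is nonnegative only as an evaluation.\<close>
alias lookup = Poly_Mapping.lookup
alias keys = Poly_Mapping.keys
alias single = Poly_Mapping.single
alias mdet = Determinant.det
alias transposition = Transposition.transpose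

lemma mpcoeff_simps [simp]:
  "mpcoeff 0 \<alpha> = 0"
  "mpcoeff 1 \<alpha> = (if \<alpha> = 0 then 1 else 0)"
  "mpcoeff (f + g) \<alpha> = mpcoeff f \<alpha> + mpcoeff g \<alpha>"
  "mpcoeff (- f) \<alpha> = - mpcoeff f \<alpha>"
  "mpcoeff (f - g) \<alpha> = mpcoeff f \<alpha> - mpcoeff g \<alpha>"
  by (simp_all add: mpser_defs)

lemma mpcoeff_mult:
  "mpcoeff (f * g) \<alpha> = (\<Sum>(\<beta>, \<gamma>) | \<beta> + \<gamma> = \<alpha>. mpcoeff f \<beta> * mpcoeff g \<gamma>)"
  by (simp add: times_mpser_def)

lemma mpcoeff_sum [simp]: "mpcoeff (sum f S) \<alpha> = (\<Sum>s\<in>S. mpcoeff (f s) \<alpha>)"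
  by (induction S rule: infinite_finite_induct) auto

lemma mpcoeff_of_nat_mult [simp]: "mpcoeff (of_nat k * f) \<alpha> = int k * mpcoeff f \<alpha>"
  by (induction k) (auto simp: algebra_simps)

lemma mpcoeff_of_int_mult [simp]: "mpcoeff (of_int k * f) \<alpha> = k * mpcoeff f \<alpha>"
  by (cases k rule: int_cases2) simp_all

section \<open>Monomials and truncation\<close>

definition monom_ser :: "(nat \<Rightarrow>\<^sub>0 nat) \<Rightarrow> mpser" where
  "monom_ser \<alpha> = Abs_mpser (\<lambda>\<beta>. if \<beta> = \<alpha> then 1 else 0)"

lemma mpcoeff_monom_ser [simp]: "mpcoeff (monom_ser \<alpha>) \<beta> = (if \<beta> = \<alpha> then 1 else 0)"
  by (simp add: monom_ser_def)

lemma mpcoeff_monom_ser_mult: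
  "mpcoeff (monom_ser \<alpha> * f) \<gamma> = (\<Sum>\<beta> | \<alpha> + \<beta> = \<gamma>. mpcoeff f \<beta>)"
proof -
  have "mpcoeff (monom_ser \<alpha> * f) \<gamma> =
      (\<Sum>(\<beta>, \<gamma>') | \<beta> = \<alpha> \<and> \<alpha> + \<gamma>' = \<gamma>. mpcoeff f \<gamma>')"
    unfolding mpcoeff_mult
    by (rule sum.mono_neutral_cong_right) (auto simp: finite_add_decomp split: if_splits)
  also have "\<dots> = (\<Sum>\<beta> | \<alpha> + \<beta> = \<gamma>. mpcoeff f \<beta>)"
    by (rule sum.reindex_bij_witness[of _ "\<lambda>\<beta>. (\<alpha>, \<beta>)" snd]) auto
  finally show ?thesis .
qed

lemma monom_ser_0 [simp]: "monom_ser 0 = 1"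
  by (rule mpser_eqI) simp

lemma monom_ser_add: "monom_ser (\<alpha> + \<beta>) = monom_ser \<alpha> * monom_ser \<beta>"
proof (rule mpser_eqI)
  fix \<gamma>
  have "(\<Sum>\<delta> | \<alpha> + \<delta> = \<gamma>. mpcoeff (monom_ser \<beta>) \<delta>) =
      (\<Sum>\<delta> \<in> (if \<gamma> = \<alpha> + \<beta> then {\<beta>} else {}). 1)"
  proof (rule sum.mono_neutral_cong_right)
    have "{\<delta>. \<alpha> + \<delta> = \<gamma>} \<subseteq> snd ` {(\<beta>, \<gamma>'). \<beta> + \<gamma>' = \<gamma>}"
      by force
    then show "finite {\<delta>. \<alpha> + \<delta> = \<gamma>}"
      using finite_add_decomp finite_surj by blast
  qed (auto split: if_splits)
  then show "mpcoeff (monom_ser (\<alpha> + \<beta>)) \<gamma> = mpcoeff (monom_ser \<alpha> * monom_ser \<beta>) \<gamma>"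
    by (simp add: mpcoeff_monom_ser_mult)
qed

definition var_ser :: "nat \<Rightarrow> mpser" where
  "var_ser i = monom_ser (single i 1)"

lift_definition expv :: "nat \<Rightarrow> (nat \<Rightarrow> nat) \<Rightarrow> nat \<Rightarrow>\<^sub>0 nat" is
  "\<lambda>n a i. if i < n then a i else 0"
  by (rule finite_subset[of _ "{..<n}" for n]) auto

lemma lookup_expv [simp]: "lookup (expv n a) i = (if i < n then a i else 0)"
  by (simp add: expv.rep_eq)

lemma keys_expv: "keys (expv n a) \<subseteq> {..<n}"
  by (auto simp: in_keys_iff split: if_splits)

lemma expv_lookup: "keys \<alpha> \<subseteq> {..<n} \<Longrightarrow> expv n (lookup \<alpha>) = \<alpha>"
  by (rule poly_mapping_eqI) (auto simp: in_keys_iff subset_iff)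

lemma var_ser_power: "var_ser i ^ k = monom_ser (single i k)"
  by (induction k) (auto simp: var_ser_def simp flip: monom_ser_add single_add)

lemma prod_var_ser: "(\<Prod>i<n. var_ser i ^ a i) = monom_ser (expv n a)"
proof (induction n)
  case (Suc n)
  have "expv (Suc n) a = expv n a + single n (a n)"
    by (rule poly_mapping_eqI) (auto simp: lookup_add lookup_single when_def)
  with Suc show ?case
    by (simp add: var_ser_power monom_ser_add)
next
  case 0
  have "expv 0 a = 0"
    by (rule poly_mapping_eqI) auto
  then show ?case by simp
qed

text \<open>Setting all variables from \<open>n\<close> on to 0. Alternants exist only in finitely
  many variables, so identities of symmetric functions are proved after truncation and then lifted
  back.\<close>

definition trunc :: "nat \<Rightarrow> mpser \<Rightarrow> mpser" where
  "trunc n f = Abs_mpser (\<lambda>\<alpha>. if keys \<alpha> \<subseteq> {..<n} then mpcoeff f \<alpha> else 0)"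

lemma mpcoeff_trunc [simp]:
  "mpcoeff (trunc n f) \<alpha> = (if keys \<alpha> \<subseteq> {..<n} then mpcoeff f \<alpha> else 0)"
  by (simp add: trunc_def)

lemma keys_plus_nat: "keys (\<alpha> + \<beta> :: nat \<Rightarrow>\<^sub>0 nat) = keys \<alpha> \<union> keys \<beta>"
  by (auto simp: in_keys_iff lookup_add)


lemma trunc_add [simp]: "trunc n (f + g) = trunc n f + trunc n g"
  and trunc_diff [simp]: "trunc n (f - g) = trunc n f - trunc n g"
  and trunc_0 [simp]: "trunc n 0 = 0"
  and trunc_1 [simp]: "trunc n 1 = 1"
  by (auto intro!: mpser_eqI)

text \<open>Exponents cannot cancel: a product monomial involves exactly the variables of its two
  factors.\<close>

lemma trunc_mult [simp]: "trunc n (f * g) = trunc n f * trunc n g"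
proof (rule mpser_eqI)
  fix \<alpha>
  show "mpcoeff (trunc n (f * g)) \<alpha> = mpcoeff (trunc n f * trunc n g) \<alpha>"
  proof (cases "keys \<alpha> \<subseteq> {..<n}")
    case True
    then show ?thesis
      by (auto simp: mpcoeff_mult keys_plus_nat intro!: sum.cong)
  next
    case False
    then show ?thesis
      by (auto simp: mpcoeff_mult keys_plus_nat intro!: sum.neutral)
  qed
qed

lemma trunc_hom: "comm_ring_hom (trunc n)"
  by unfold_locales auto

lemmas trunc_det = comm_ring_hom.hom_det[OF trunc_hom, symmetric]

lemma trunc_sum [simp]: "trunc n (sum f S) = (\<Sum>s\<in>S. trunc n (f s))"
  by (auto intro!: mpser_eqI)

lemma mpser_eq_if_trunc_eq:
  assumes "\<And>n. N \<le> n \<Longrightarrow> trunc n f = trunc n g"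
  shows "f = g"
proof (rule mpser_eqI)
  fix \<alpha> :: "nat \<Rightarrow>\<^sub>0 nat"
  obtain m where "keys \<alpha> \<subseteq> {..<m}"
    using finite_nat_iff_bounded[of "keys \<alpha>"] by auto
  then have "keys \<alpha> \<subseteq> {..<max N m}"
    by auto
  then show "mpcoeff f \<alpha> = mpcoeff g \<alpha>"
    using assms[of "max N m"] by (metis max.cobounded1 mpcoeff_trunc)
qed

text \<open>The leading monomials for the lexicographic order on exponents multiply.\<close>

lemma mpser_mult_eq_0D:
  assumes fg: "f * g = 0"
    and fin: "finite {\<alpha>. mpcoeff f \<alpha> \<noteq> 0}" "finite {\<alpha>. mpcoeff g \<alpha> \<noteq> 0}"
    and f: "f \<noteq> 0"
  shows "g = 0"
proof (rule ccontr)
  assume g: "g \<noteq> 0"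
  let ?F = "{\<alpha>. mpcoeff f \<alpha> \<noteq> 0}" and ?G = "{\<alpha>. mpcoeff g \<alpha> \<noteq> 0}"
  define a b where "a = Max ?F" and "b = Max ?G"
  have ne: "?F \<noteq> {}" "?G \<noteq> {}"
    using f g mpser_eqI[of f 0] mpser_eqI[of g 0] by auto
  have a: "mpcoeff f a \<noteq> 0" "\<And>\<alpha>. mpcoeff f \<alpha> \<noteq> 0 \<Longrightarrow> \<alpha> \<le> a"
    and b: "mpcoeff g b \<noteq> 0" "\<And>\<alpha>. mpcoeff g \<alpha> \<noteq> 0 \<Longrightarrow> \<alpha> \<le> b"
    using Max_in[OF fin(1) ne(1)] Max_in[OF fin(2) ne(2)] Max_ge[OF fin(1)] Max_ge[OF fin(2)]
    unfolding a_def b_def by auto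
  have "mpcoeff (f * g) (a + b) = (\<Sum>(\<beta>, \<gamma>) \<in> {(a, b)}. mpcoeff f \<beta> * mpcoeff g \<gamma>)"
    unfolding mpcoeff_mult
  proof (rule sum.mono_neutral_right)
    show "\<forall>i\<in>{(\<beta>, \<gamma>). \<beta> + \<gamma> = a + b} - {(a, b)}.
        (case i of (\<beta>, \<gamma>) \<Rightarrow> mpcoeff f \<beta> * mpcoeff g \<gamma>) = 0"
    proof (clarify, rule ccontr)
      fix \<beta> \<gamma>
      assume s: "\<beta> + \<gamma> = a + b" "(\<beta>, \<gamma>) \<notin> {}" "mpcoeff f \<beta> * mpcoeff g \<gamma> \<noteq> 0"
        "\<not> (\<beta> = a \<and> \<gamma> = b)"
      then have le: "\<beta> \<le> a" "\<gamma> \<le> b"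
        using a b by auto
      then have "\<beta> + \<gamma> < a + b"
        using s(4) by (metis add_le_less_mono add_less_le_mono order_le_less)
      with s(1) show False by simp
    qed
  qed (auto simp: finite_add_decomp)
  then show False
    using fg a b by simp
qed

section \<open>Symmetric functions and exponent multisets\<close>

text \<open>A complete invariant of a monomial under permutations of the variables; symmetry of a
  series becomes constancy on the fibres of \<open>expm\<close>.\<close>

definition expm :: "(nat \<Rightarrow>\<^sub>0 nat) \<Rightarrow> nat multiset" where
  "expm \<alpha> = image_mset (lookup \<alpha>) (mset_set (keys \<alpha>))"

lemma mpcoeff_monomial_sym [simp]:
  "mpcoeff (monomial_sym \<mu>) \<alpha> = (if expm \<alpha> = mset \<mu> then 1 else 0)"
  by (simp add: monomial_sym_def expm_def)

lemma size_expm [simp]: "size (expm \<alpha>) = card (keys \<alpha>)"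
  by (simp add: expm_def)

lemma sum_mset_expm: "sum_mset (expm \<alpha>) = mdegree \<alpha>"
  by (simp add: expm_def mdegree_def sum_unfold_sum_mset)

lemma zero_notin_expm: "0 \<notin># expm \<alpha>"
  by (auto simp: expm_def in_keys_iff)

lemma expm_superset:
  assumes "finite S" "keys \<alpha> \<subseteq> S"
  shows "image_mset (lookup \<alpha>) (mset_set S) = expm \<alpha> + replicate_mset (card S - card (keys \<alpha>)) 0"
proof -
  have "mset_set S = mset_set (keys \<alpha>) + mset_set (S - keys \<alpha>)"
    using assms by (subst mset_set_Union[symmetric]) (auto simp: Un_absorb1)
  moreover have "image_mset (lookup \<alpha>) (mset_set (S - keys \<alpha>)) = image_mset (\<lambda>_. 0) (mset_set (S - keys \<alpha>))"
    using assms by (intro image_mset_cong) (auto simp: in_keys_iff)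
  ultimately show ?thesis
    using assms by (simp add: expm_def image_mset_const_eq card_Diff_subset)
qed

text \<open>Over the common set \<open>S\<close>, zeros included, both exponent vectors have the
  same multiset of values, so a permutation of \<open>S\<close> matches them.\<close>

lemma expm_eq_imp_permutes:
  assumes "expm \<alpha> = expm \<beta>" "finite S" "keys \<alpha> \<subseteq> S" "keys \<beta> \<subseteq> S"
  obtains p where "p permutes S" "\<And>i. lookup \<beta> i = lookup \<alpha> (p i)"
proof -
  have "image_mset (lookup \<beta>) (mset_set S) = image_mset (lookup \<alpha>) (mset_set S)"
    using assms by (metis expm_superset size_expm)
  from image_mset_eq_implies_permutes[OF assms(2) this] obtain p
    where p: "p permutes S" "\<forall>i\<in>S. lookup \<beta> i = lookup \<alpha> (p i)" by blast
  moreover have "lookup \<beta> i = lookup \<alpha> (p i)" if "i \<notin> S" for i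
    using that assms p(1) by (metis in_keys_iff permutes_not_in subsetD)
  ultimately show thesis
    using that by blast
qed

text \<open>Read off from the known symmetry of \<open>monomial_sym\<close>, whose coefficients are
  the indicator of one fibre of \<open>expm\<close>.\<close>

lemma expm_map_key:
  assumes "bij \<pi>"
  shows "expm (Poly_Mapping.map_key \<pi> \<alpha>) = expm \<alpha>"
proof -
  define \<mu> where "\<mu> = sorted_list_of_multiset (expm \<alpha>)"
  have "mpcoeff (monomial_sym \<mu>) (Poly_Mapping.map_key \<pi> \<alpha>) = mpcoeff (monomial_sym \<mu>) \<alpha>"
    using monomial_sym_in_Lambda_Z[of \<mu>] assms unfolding Lambda_Z_def by blast
  then show ?thesis
    by (auto simp: \<mu>_def split: if_splits)
qed

lemma Lambda_Z_iff:
  "f \<in> Lambda_Z \<longleftrightarrow> (\<exists>d. \<forall>\<alpha>. mpcoeff f \<alpha> \<noteq> 0 \<longrightarrow> mdegree \<alpha> \<le> d) \<and>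
    (\<forall>\<alpha> \<beta>. expm \<alpha> = expm \<beta> \<longrightarrow> mpcoeff f \<alpha> = mpcoeff f \<beta>)"
proof -
  have "mpcoeff f \<alpha> = mpcoeff f \<beta>"
    if sym: "\<And>\<pi> \<alpha>. bij \<pi> \<Longrightarrow> mpcoeff f (Poly_Mapping.map_key \<pi> \<alpha>) = mpcoeff f \<alpha>"
      and eq: "expm \<alpha> = expm \<beta>" for \<alpha> \<beta>
  proof -
    obtain p where p: "p permutes (keys \<alpha> \<union> keys \<beta>)" "\<And>i. lookup \<beta> i = lookup \<alpha> (p i)"
      using expm_eq_imp_permutes[OF eq, of "keys \<alpha> \<union> keys \<beta>"] by auto
    then have "\<beta> = Poly_Mapping.map_key p \<alpha>"
      by (intro poly_mapping_eqI) (simp add: lookup_map_key_bij permutes_bij)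
    then show ?thesis
      using sym p by (simp add: permutes_bij)
  qed
  then show ?thesis
    unfolding Lambda_Z_def using expm_map_key by blast
qed

lemma Lambda_Z_cong: "f \<in> Lambda_Z \<Longrightarrow> expm \<alpha> = expm \<beta> \<Longrightarrow> mpcoeff f \<alpha> = mpcoeff f \<beta>"
  unfolding Lambda_Z_iff by blast

lemma Lambda_Z_closed [intro, simp]:
  "0 \<in> Lambda_Z" "1 \<in> Lambda_Z"
  "f \<in> Lambda_Z \<Longrightarrow> g \<in> Lambda_Z \<Longrightarrow> f + g \<in> Lambda_Z"
  "f \<in> Lambda_Z \<Longrightarrow> g \<in> Lambda_Z \<Longrightarrow> f * g \<in> Lambda_Z"
  "f \<in> Lambda_Z \<Longrightarrow> - f \<in> Lambda_Z"
  using is_subring_Lambda_Z by (auto simp: is_subring_def is_subsemiring_def)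

lemma Lambda_Z_diff [intro, simp]: "f \<in> Lambda_Z \<Longrightarrow> g \<in> Lambda_Z \<Longrightarrow> f - g \<in> Lambda_Z"
  by (metis Lambda_Z_closed(3,5) diff_conv_add_uminus)

lemma Lambda_Z_sum [intro, simp]: "(\<And>s. s \<in> S \<Longrightarrow> f s \<in> Lambda_Z) \<Longrightarrow> sum f S \<in> Lambda_Z"
  by (induction S rule: infinite_finite_induct) auto

lemma ex_expm:
  assumes "0 \<notin># M" "size M \<le> n"
  obtains \<alpha> where "expm \<alpha> = M" "keys \<alpha> \<subseteq> {..<n}"
proof -
  obtain xs where xs: "mset xs = M" using ex_mset by blast
  define \<alpha> where "\<alpha> = expv (length xs) (\<lambda>i. xs ! i)"
  have pos: "0 < xs ! i" if "i < length xs" for i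
  proof (rule gr0I)
    assume "xs ! i = 0"
    with nth_mem_mset[OF that] assms(1) xs show False by simp
  qed
  have lk: "lookup \<alpha> i = (if i < length xs then xs ! i else 0)" for i
    by (simp add: \<alpha>_def)
  have ks: "keys \<alpha> = {..<length xs}"
    by (rule Set.set_eqI) (simp add: in_keys_iff lk pos)
  have "expm \<alpha> = image_mset (\<lambda>i. xs ! i) (mset_set {..<length xs})"
    unfolding expm_def ks by (rule image_mset_cong) (simp add: lk)
  also have "\<dots> = mset (map (\<lambda>i. xs ! i) [0..<length xs])"
    by (simp add: lessThan_atLeast0)
  finally have "expm \<alpha> = M"
    using xs by (simp add: map_nth)
  moreover have "keys \<alpha> \<subseteq> {..<n}"
    using assms(2) xs[symmetric] by (simp add: ks)
  ultimately show thesis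
    by (rule that)
qed

lemma card_keys_le_mdegree: "card (keys \<alpha>) \<le> mdegree \<alpha>"
proof -
  have "(\<Sum>k\<in>keys \<alpha>. 1) \<le> (\<Sum>k\<in>keys \<alpha>. lookup \<alpha> k)"
    by (intro sum_mono) (auto simp: in_keys_iff Suc_le_eq)
  then show ?thesis
    by (simp add: mdegree_def)
qed

text \<open>A monomial of degree at most \<open>n\<close> involves at most \<open>n\<close>
  variables, and a permutation moves it into the first \<open>n\<close>; up to that degree
  truncation loses nothing.\<close>

lemma symmetric_eq_if_trunc_eq:
  assumes "f \<in> Lambda_Z" "g \<in> Lambda_Z" "trunc n f = trunc n g"
    and deg: "\<And>\<alpha>. mpcoeff f \<alpha> \<noteq> 0 \<Longrightarrow> mdegree \<alpha> \<le> n" "\<And>\<alpha>. mpcoeff g \<alpha> \<noteq> 0 \<Longrightarrow> mdegree \<alpha> \<le> n"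
  shows "f = g"
proof (rule mpser_eqI)
  fix \<alpha>
  show "mpcoeff f \<alpha> = mpcoeff g \<alpha>"
  proof (cases "mdegree \<alpha> \<le> n")
    case True
    then obtain \<beta> where \<beta>: "expm \<beta> = expm \<alpha>" "keys \<beta> \<subseteq> {..<n}"
      using ex_expm[of "expm \<alpha>" n] card_keys_le_mdegree[of \<alpha>] zero_notin_expm by auto
    then have "mpcoeff f \<beta> = mpcoeff g \<beta>"
      using arg_cong[OF assms(3), of "\<lambda>h. mpcoeff h \<beta>"] by simp
    then show ?thesis
      using \<beta> assms(1,2) Lambda_Z_cong by metis
  next
    case False
    then show ?thesis using deg by metis
  qed
qed

lemma mpcoeff_of_int [simp]: "mpcoeff (of_int c) \<alpha> = (if \<alpha> = 0 then c else 0)"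
  using mpcoeff_of_int_mult[of c 1 \<alpha>] by simp

section \<open>Monomial positivity and elementary symmetric functions\<close>

lemma nat_span_scale:
  assumes "b \<in> X"
  shows "of_nat k * b \<in> nat_span X"
  using assms unfolding nat_span_def
  by (intro CollectI exI[of _ "{b}"] exI[of _ "\<lambda>_. k"]) auto

lemma nat_span_superset: "X \<subseteq> nat_span X"
  using nat_span_scale[of _ X 1] by auto

lemma nat_span_add:
  assumes "f \<in> nat_span X" "g \<in> nat_span X"
  shows "f + g \<in> nat_span X"
proof -
  obtain F c where F: "finite F" "F \<subseteq> X" "f = (\<Sum>b\<in>F. of_nat (c b) * b)"
    using assms(1) unfolding nat_span_def by blast
  obtain G d where G: "finite G" "G \<subseteq> X" "g = (\<Sum>b\<in>G. of_nat (d b) * b)"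
    using assms(2) unfolding nat_span_def by blast
  let ?c = "\<lambda>b. (if b \<in> F then c b else 0) + (if b \<in> G then d b else 0)"
  have "f = (\<Sum>b\<in>F \<union> G. of_nat (if b \<in> F then c b else 0) * b)"
    unfolding F(3) using F G by (intro sum.mono_neutral_cong_left) auto
  moreover have "g = (\<Sum>b\<in>F \<union> G. of_nat (if b \<in> G then d b else 0) * b)"
    unfolding G(3) using F G by (intro sum.mono_neutral_cong_left) auto
  ultimately have "f + g = (\<Sum>b\<in>F \<union> G. of_nat (?c b) * b)"
    by (simp only: sum.distrib[symmetric] distrib_right of_nat_add)
  moreover have "finite (F \<union> G)" "F \<union> G \<subseteq> X"
    using F G by auto
  ultimately show ?thesis
    unfolding nat_span_def by (intro CollectI exI[of _ "F \<union> G"] exI[of _ ?c]) simp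
qed

lemma nat_span_0 [simp]: "0 \<in> nat_span X"
  unfolding nat_span_def by (intro CollectI exI[of _ "{}"]) auto

lemma nat_span_sum: "(\<And>s. s \<in> S \<Longrightarrow> f s \<in> nat_span X) \<Longrightarrow> sum f S \<in> nat_span X"
  by (induction S rule: infinite_finite_induct) (auto intro: nat_span_add)

lemma nat_span_induct [consumes 1, case_names 0 base add]:
  assumes "f \<in> nat_span X" "P 0" "\<And>b. b \<in> X \<Longrightarrow> P b"
    "\<And>f g. f \<in> nat_span X \<Longrightarrow> g \<in> nat_span X \<Longrightarrow> P f \<Longrightarrow> P g \<Longrightarrow> P (f + g)"
  shows "P f"
proof -
  have scale: "P (of_nat k * b)" if "b \<in> X" for k b
  proof (induction k)
    case (Suc k)
    have "P (of_nat k * b + b)"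
      using Suc that assms(3,4) nat_span_scale nat_span_superset by blast
    then show ?case by (simp add: algebra_simps)
  qed (use assms in auto)
  obtain F c where F: "finite F" "F \<subseteq> X" "f = (\<Sum>b\<in>F. of_nat (c b) * b)"
    using assms(1) unfolding nat_span_def by blast
  have "P (\<Sum>b\<in>F. of_nat (c b) * b)"
    using F(1,2)
  proof (induction F)
    case (insert b F)
    then have "P (of_nat (c b) * b + (\<Sum>b\<in>F. of_nat (c b) * b))"
      by (intro assms(4) nat_span_sum nat_span_scale scale) auto
    with insert show ?case by simp
  qed (use assms in auto)
  with F show ?thesis by simp
qed

section \<open>Partitions and the description of \<open>Lambda_N\<close> by nonnegative
  coefficients\<close>

definition part_of :: "nat multiset \<Rightarrow> nat list" where
  "part_of M = rev (sorted_list_of_multiset M)"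

lemma mset_part_of [simp]: "mset (part_of M) = M"
  by (simp add: part_of_def)

lemma is_partition_part_of: "0 \<notin># M \<Longrightarrow> is_partition (part_of M)"
  by (auto simp: is_partition_def part_of_def sorted_wrt_rev)

lemma part_of_mset: "is_partition \<mu> \<Longrightarrow> part_of (mset \<mu>) = \<mu>"
proof -
  assume "is_partition \<mu>"
  then have "sorted (rev \<mu>)"
    by (simp add: is_partition_def sorted_wrt_rev)
  then have "sorted_list_of_multiset (mset (rev \<mu>)) = rev \<mu>"
    by (simp only: sorted_list_of_multiset_mset sorted_sort_id)
  then show ?thesis
    by (simp add: part_of_def)
qed

lemma finite_partitions: "finite {\<mu>. is_partition \<mu> \<and> sum_list \<mu> \<le> d}"
proof (rule finite_subset)
  have len: "length \<mu> \<le> sum_list \<mu>" if "0 \<notin> set \<mu>" for \<mu> :: "nat list"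
    using that by (induction \<mu>) auto
  show "{\<mu>. is_partition \<mu> \<and> sum_list \<mu> \<le> d} \<subseteq> {\<mu>. set \<mu> \<subseteq> {..d} \<and> length \<mu> \<le> d}"
  proof clarify
    fix \<mu> assume \<mu>: "is_partition \<mu>" "sum_list \<mu> \<le> d"
    have "k \<le> d" if "k \<in> set \<mu>" for k
      using member_le_sum_list[OF that] \<mu>(2) by simp
    then show "set \<mu> \<subseteq> {..d} \<and> length \<mu> \<le> d"
      using len[of \<mu>] \<mu> by (auto simp: is_partition_def)
  qed
qed (simp add: finite_lists_length_le)

text \<open>The multiplicity of a monomial symmetric function in \<open>f\<close> is the coefficient
  of \<open>f\<close> at any monomial of that type, and the degree bound leaves finitely many types.
  Membership thus becomes a sign check on coefficients.\<close>

lemma Lambda_N_iff: "f \<in> Lambda_N \<longleftrightarrow> f \<in> Lambda_Z \<and> (\<forall>\<alpha>. 0 \<le> mpcoeff f \<alpha>)"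
proof
  assume f: "f \<in> Lambda_N"
  then have "\<forall>\<alpha>. 0 \<le> mpcoeff f \<alpha>"
    unfolding Lambda_N_def by (induction rule: nat_span_induct) auto
  with f show "f \<in> Lambda_Z \<and> (\<forall>\<alpha>. 0 \<le> mpcoeff f \<alpha>)"
    using Lambda_N_subset_Lambda_Z by auto
next
  assume "f \<in> Lambda_Z \<and> (\<forall>\<alpha>. 0 \<le> mpcoeff f \<alpha>)"
  then have f: "f \<in> Lambda_Z" and nn: "\<And>\<alpha>. 0 \<le> mpcoeff f \<alpha>" by auto
  then obtain d where d: "\<And>\<alpha>. mpcoeff f \<alpha> \<noteq> 0 \<Longrightarrow> mdegree \<alpha> \<le> d"
    unfolding Lambda_Z_iff by blast
  let ?P = "{\<mu>. is_partition \<mu> \<and> sum_list \<mu> \<le> d}"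
  define c where "c \<mu> = nat (mpcoeff f (SOME \<alpha>. expm \<alpha> = mset \<mu>))" for \<mu>
  have c: "int (c \<mu>) = mpcoeff f \<alpha>" if "expm \<alpha> = mset \<mu>" for \<alpha> \<mu>
  proof -
    have "expm (SOME \<alpha>. expm \<alpha> = mset \<mu>) = mset \<mu>"
      using that by (rule someI)
    then have "mpcoeff f (SOME \<alpha>. expm \<alpha> = mset \<mu>) = mpcoeff f \<alpha>"
      using Lambda_Z_cong[OF f, of "SOME \<alpha>. expm \<alpha> = mset \<mu>" \<alpha>] that by argo
    then show ?thesis
      using nn by (simp add: c_def)
  qed
  have "f = (\<Sum>\<mu>\<in>?P. of_nat (c \<mu>) * monomial_sym \<mu>)"
  proof (rule mpser_eqI)
    fix \<alpha>
    let ?\<mu> = "part_of (expm \<alpha>)"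
    have "mpcoeff (\<Sum>\<mu>\<in>?P. of_nat (c \<mu>) * monomial_sym \<mu>) \<alpha> =
        (\<Sum>\<mu>\<in>?P. if expm \<alpha> = mset \<mu> then mpcoeff f \<alpha> else 0)"
      by (auto simp: c intro!: sum.cong)
    also have "\<dots> = (\<Sum>\<mu>\<in>?P. if \<mu> = ?\<mu> then mpcoeff f \<alpha> else 0)"
      by (intro sum.cong) (auto simp: part_of_mset)
    also have "\<dots> = (if ?\<mu> \<in> ?P then mpcoeff f \<alpha> else 0)"
      using finite_partitions by simp
    also have "\<dots> = mpcoeff f \<alpha>"
    proof -
      have "sum_list ?\<mu> = mdegree \<alpha>"
        by (metis mset_part_of sum_mset_expm sum_mset_sum_list)
      then show ?thesis
        using d[of \<alpha>] is_partition_part_of[OF zero_notin_expm, of \<alpha>] by auto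
    qed
    finally show "mpcoeff f \<alpha> = mpcoeff (\<Sum>\<mu>\<in>?P. of_nat (c \<mu>) * monomial_sym \<mu>) \<alpha>" ..
  qed
  also have "\<dots> \<in> Lambda_N"
    unfolding Lambda_N_def by (intro nat_span_sum nat_span_scale) auto
  finally show "f \<in> Lambda_N" .
qed

lemma is_subsemiring_Lambda_N: "is_subsemiring Lambda_N"
  unfolding is_subsemiring_def
  by (auto simp: Lambda_N_iff mpcoeff_mult intro!: sum_nonneg)

section \<open>Elementary symmetric functions and their generation of
  \<open>Lambda_Z\<close>\<close>

definition elem_sym :: "nat \<Rightarrow> mpser" where
  "elem_sym n = monomial_sym (replicate n 1)"

lemma elem_sym_in_Lambda_N: "elem_sym n \<in> Lambda_N"
  by (simp add: Lambda_N_iff elem_sym_def monomial_sym_in_Lambda_Z)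

definition indv :: "nat set \<Rightarrow> nat \<Rightarrow>\<^sub>0 nat" where
  "indv S = (\<Sum>i\<in>S. single i 1)"

lemma lookup_indv [simp]: "finite S \<Longrightarrow> lookup (indv S) i = (if i \<in> S then 1 else 0)"
  by (simp add: indv_def lookup_sum lookup_single when_def)

lemma keys_indv [simp]: "finite S \<Longrightarrow> keys (indv S) = S"
  by (auto simp: in_keys_iff split: if_splits)

lemma expm_eq_replicate_iff:
  "expm \<alpha> = replicate_mset n (Suc 0) \<longleftrightarrow> card (keys \<alpha>) = n \<and> \<alpha> = indv (keys \<alpha>)"
proof
  assume a: "expm \<alpha> = replicate_mset n (Suc 0)"
  then have "lookup \<alpha> i = 1" if "i \<in> keys \<alpha>" for i
  proof -
    have "lookup \<alpha> i \<in># expm \<alpha>"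
      using that by (simp add: expm_def)
    with a show ?thesis by (simp split: if_splits)
  qed
  then have "\<alpha> = indv (keys \<alpha>)"
    by (intro poly_mapping_eqI) (auto simp: in_keys_iff)
  with a show "card (keys \<alpha>) = n \<and> \<alpha> = indv (keys \<alpha>)"
    by (metis size_expm size_replicate_mset)
next
  assume a: "card (keys \<alpha>) = n \<and> \<alpha> = indv (keys \<alpha>)"
  then have "lookup \<alpha> i = 1" if "i \<in> keys \<alpha>" for i
    using that by (metis finite_keys lookup_indv)
  then have "expm \<alpha> = image_mset (\<lambda>_. Suc 0) (mset_set (keys \<alpha>))"
    unfolding expm_def by (intro image_mset_cong) auto
  with a show "expm \<alpha> = replicate_mset n (Suc 0)"
    by (simp add: image_mset_const_eq)
qed

lemma mpcoeff_elem_sym: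
  "mpcoeff (elem_sym n) \<alpha> = (if card (keys \<alpha>) = n \<and> \<alpha> = indv (keys \<alpha>) then 1 else 0)"
  by (simp add: elem_sym_def expm_eq_replicate_iff)

lemma mdegree_indv: "finite S \<Longrightarrow> mdegree (indv S) = card S"
  by (simp add: mdegree_def)

text \<open>The generated subring, in inductive form so that statements about homomorphisms and
  evaluations spread from the generators by rule induction.\<close>

inductive_set ring_gen :: "'a::comm_ring_1 set \<Rightarrow> 'a set" for X where
  base: "x \<in> X \<Longrightarrow> x \<in> ring_gen X"
| one: "1 \<in> ring_gen X"
| add: "x \<in> ring_gen X \<Longrightarrow> y \<in> ring_gen X \<Longrightarrow> x + y \<in> ring_gen X"
| mult: "x \<in> ring_gen X \<Longrightarrow> y \<in> ring_gen X \<Longrightarrow> x * y \<in> ring_gen X"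
| neg: "x \<in> ring_gen X \<Longrightarrow> - x \<in> ring_gen X"

lemma ring_gen_0: "0 \<in> ring_gen X"
  using ring_gen.add[OF ring_gen.one ring_gen.neg[OF ring_gen.one], of X] by simp

lemma ring_gen_of_int: "of_int k \<in> ring_gen X"
proof -
  have "of_nat n \<in> ring_gen X" for n
    by (induction n) (auto intro: ring_gen_0 ring_gen.intros)
  then show ?thesis
    by (cases k rule: int_cases2) (simp_all add: ring_gen.neg)
qed

lemma ring_gen_sum: "(\<And>s. s \<in> S \<Longrightarrow> f s \<in> ring_gen X) \<Longrightarrow> sum f S \<in> ring_gen X"
  by (induction S rule: infinite_finite_induct) (auto intro: ring_gen.intros ring_gen_0)

lemma ring_gen_prod: "(\<And>s. s \<in> S \<Longrightarrow> f s \<in> ring_gen X) \<Longrightarrow> prod f S \<in> ring_gen X"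
  by (induction S rule: infinite_finite_induct) (auto intro: ring_gen.intros)

text \<open>Dividing the part of \<open>f\<close> with exactly \<open>n\<close> variables per monomial by \<open>e\<^sub>n\<close>
  leaves a remainder in which every monomial involves more than \<open>n\<close> variables.\<close>

lemma elem_sym_division:
  assumes f: "f \<in> Lambda_Z" and n: "0 < n" "n \<le> d"
    and supp: "\<And>\<alpha>. mpcoeff f \<alpha> \<noteq> 0 \<Longrightarrow> mdegree \<alpha> \<le> d \<and> n \<le> card (keys \<alpha>)"
  obtains g where "g \<in> Lambda_Z" "\<And>\<alpha>. mpcoeff g \<alpha> \<noteq> 0 \<Longrightarrow> mdegree \<alpha> \<le> d - n"
    "\<And>\<alpha>. mpcoeff (f - elem_sym n * g) \<alpha> \<noteq> 0 \<Longrightarrow> mdegree \<alpha> \<le> d \<and> Suc n \<le> card (keys \<alpha>)"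
proof -
  define G where "G M = mpcoeff f (SOME \<alpha>. expm \<alpha> = M)" for M
  have G: "G (expm \<alpha>) = mpcoeff f \<alpha>" for \<alpha>
    unfolding G_def by (rule Lambda_Z_cong[OF f]) (rule someI, rule refl)
  \<comment> \<open>Multiplying a monomial by a product of \<open>n\<close> variables that include
    all of its own raises \<open>n\<close> exponents, zeros included, by one; \<open>lift\<close> is
    the effect on exponent multisets.\<close>
  define lift where "lift M = image_mset Suc (M + replicate_mset (n - size M) 0)" for M
  define g where "g = Abs_mpser (\<lambda>\<beta>. if card (keys \<beta>) \<le> n then G (lift (expm \<beta>)) else 0)"
  have g: "mpcoeff g \<beta> = (if card (keys \<beta>) \<le> n then G (lift (expm \<beta>)) else 0)" for \<beta>
    by (simp add: g_def)
  have deg: "mdegree \<beta> \<le> d - n" if nz: "mpcoeff g \<beta> \<noteq> 0" for \<beta>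
  proof -
    have c: "card (keys \<beta>) \<le> n" and G0: "G (lift (expm \<beta>)) \<noteq> 0"
      using nz by (auto simp: g split: if_splits)
    obtain \<alpha> where \<alpha>: "expm \<alpha> = lift (expm \<beta>)"
      by (rule ex_expm[of "lift (expm \<beta>)" "size (lift (expm \<beta>))"]) (auto simp: lift_def)
    have "sum_mset (image_mset Suc M) = size M + sum_mset M" for M
      by (induction M) auto
    then have "mdegree \<alpha> = n + mdegree \<beta>"
      using c by (simp add: sum_mset_expm[symmetric] \<alpha>) (simp add: lift_def)
    moreover have "mdegree \<alpha> \<le> d"
      using G0 supp by (simp add: G \<alpha>[symmetric])
    ultimately show ?thesis by simp
  qed
  have gL: "g \<in> Lambda_Z"
    unfolding Lambda_Z_iff
  proof
    show "\<exists>d. \<forall>\<alpha>. mpcoeff g \<alpha> \<noteq> 0 \<longrightarrow> mdegree \<alpha> \<le> d"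
      using deg by blast
  qed (simp add: g flip: size_expm)
  have "mdegree \<alpha> \<le> d \<and> Suc n \<le> card (keys \<alpha>)" if nz: "mpcoeff (f - elem_sym n * g) \<alpha> \<noteq> 0" for \<alpha>
  proof (rule conjI; rule ccontr)
    assume big: "\<not> mdegree \<alpha> \<le> d"
    then have "mpcoeff f \<alpha> = 0"
      using supp by blast
    moreover have "mpcoeff (elem_sym n * g) \<alpha> = 0"
      unfolding mpcoeff_mult
    proof (rule sum.neutral, clarify, rule ccontr)
      fix \<beta> \<gamma> assume "\<alpha> = \<beta> + \<gamma>" "mpcoeff (elem_sym n) \<beta> * mpcoeff g \<gamma> \<noteq> 0"
      then have "mdegree \<beta> = n" "mdegree \<gamma> \<le> d - n"
        using deg mdegree_indv[of "keys \<beta>"] by (auto simp: mpcoeff_elem_sym split: if_splits)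
      with big \<open>\<alpha> = \<beta> + \<gamma>\<close> n show False
        by (simp add: mdegree_add)
    qed
    ultimately show False using nz by simp
  next
    assume "\<not> Suc n \<le> card (keys \<alpha>)"
    then have small: "card (keys \<alpha>) \<le> n" by simp
    let ?t = "\<lambda>(\<beta>, \<gamma>). mpcoeff (elem_sym n) \<beta> * mpcoeff g \<gamma>"
    \<comment> \<open>As \<alpha> has at most \<open>n\<close> variables, the factor taken from
      \<open>elem_sym n\<close> must be the product of all of them. So at most one term of the
      convolution survives.\<close>
    have only: "card (keys \<alpha>) = n \<and> \<beta> = indv (keys \<alpha>)"
      if "\<beta> + \<gamma> = \<alpha>" "?t (\<beta>, \<gamma>) \<noteq> 0" for \<beta> \<gamma>
    proof -
      have b: "card (keys \<beta>) = n" and ind: "\<beta> = indv (keys \<beta>)"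
        using that by (auto simp: mpcoeff_elem_sym split: if_splits)
      have "keys \<beta> \<subseteq> keys \<alpha>"
        using that keys_plus_nat by blast
      then have "keys \<beta> = keys \<alpha>"
        using small b by (intro card_seteq) auto
      with b ind show ?thesis by simp
    qed
    show False
    proof (cases "card (keys \<alpha>) = n")
      case False
      then have "mpcoeff (elem_sym n * g) \<alpha> = 0"
        unfolding mpcoeff_mult using only by (intro sum.neutral) auto
      moreover have "mpcoeff f \<alpha> = 0"
        using supp[of \<alpha>] small False by force
      ultimately show False using nz by simp
    next
      case True
      define \<gamma> where "\<gamma> = \<alpha> - indv (keys \<alpha>)"
      have ag: "indv (keys \<alpha>) + \<gamma> = \<alpha>"
      proof (rule poly_mapping_eqI)
        fix i
        have "i \<in> keys \<alpha> \<longleftrightarrow> lookup \<alpha> i \<noteq> 0"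
          by (rule in_keys_iff)
        then show "lookup (indv (keys \<alpha>) + \<gamma>) i = lookup \<alpha> i"
          by (cases "i \<in> keys \<alpha>") (simp_all add: \<gamma>_def lookup_add lookup_minus)
      qed
      have "keys \<gamma> \<subseteq> keys (indv (keys \<alpha>) + \<gamma>)"
        by (simp only: keys_plus_nat Un_upper2)
      then have kg: "keys \<gamma> \<subseteq> keys \<alpha>"
        by (simp only: ag)
      have "mpcoeff (elem_sym n * g) \<alpha> = sum ?t {(indv (keys \<alpha>), \<gamma>)}"
        unfolding mpcoeff_mult
      proof (rule sum.mono_neutral_right)
        show "\<forall>i\<in>{(\<beta>, \<gamma>). \<beta> + \<gamma> = \<alpha>} - {(indv (keys \<alpha>), \<gamma>)}. ?t i = 0"
        proof (clarify, rule ccontr)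
          fix \<beta> \<gamma>' assume "\<alpha> = \<beta> + \<gamma>'" "mpcoeff (elem_sym n) \<beta> * mpcoeff g \<gamma>' \<noteq> 0"
            "(\<beta>, \<gamma>') \<notin> {}" "\<not> (\<beta> = indv (keys (\<beta> + \<gamma>')) \<and> \<gamma>' = \<gamma>)"
          then show False
            using only[of \<beta> \<gamma>'] ag by simp
        qed
      qed (use ag in \<open>auto simp: finite_add_decomp\<close>)
      also have "\<dots> = mpcoeff g \<gamma>"
        using True by (simp add: mpcoeff_elem_sym)
      also have "\<dots> = G (lift (expm \<gamma>))"
        using True card_mono[OF _ kg] by (simp add: g)
      also have "lift (expm \<gamma>) = image_mset Suc (image_mset (lookup \<gamma>) (mset_set (keys \<alpha>)))"
        using True kg by (simp add: expm_superset lift_def)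
      also have "\<dots> = expm \<alpha>"
        unfolding expm_def multiset.map_comp
      proof (rule image_mset_cong)
        fix i assume "i \<in># mset_set (keys \<alpha>)"
        then have "lookup (indv (keys \<alpha>) + \<gamma>) i = Suc (lookup \<gamma> i)"
          by (simp add: lookup_add)
        then show "(Suc \<circ> lookup \<gamma>) i = lookup \<alpha> i"
          by (simp add: ag)
      qed
      finally show False
        using nz by (simp add: G)
    qed
  qed
  with gL deg that show thesis by blast
qed

text \<open>Repeated division by \<open>elem_sym n\<close>, with a lexicographic measure: the
  quotient has a smaller degree bound \<open>d\<close>, the remainder keeps \<open>d\<close> but has
  larger \<open>n\<close>. For \<open>n > d\<close> nothing is left, since each variable contributes
  at least one to the degree.\<close>

theorem Lambda_Z_subset_ring_gen: "Lambda_Z \<subseteq> ring_gen (range elem_sym)"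
proof -
  have main: "f \<in> ring_gen (range elem_sym)"
    if "f \<in> Lambda_Z" "\<And>\<alpha>. mpcoeff f \<alpha> \<noteq> 0 \<Longrightarrow> mdegree \<alpha> \<le> d \<and> n \<le> card (keys \<alpha>)" for f d n
    using that
  proof (induction "(d, Suc d - n)" arbitrary: f d n rule: wf_induct_rule[OF wf_lex_prod[OF wf_less wf_less]])
    case (1 d n f)
    note IH = 1(1) and f = 1(2) and supp = 1(3)
    consider "n > d" | "n = 0" | "0 < n" "n \<le> d" by linarith
    then show ?case
    proof cases
      case 1
      have "mpcoeff f \<alpha> = 0" for \<alpha>
        using supp[of \<alpha>] card_keys_le_mdegree[of \<alpha>] 1 by force
      then have "f = 0"
        by (auto intro: mpser_eqI)
      then show ?thesis by (simp add: ring_gen_0)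
    next
      \<comment> \<open>Dividing by \<open>elem_sym 0\<close> would not lower the degree, so the
        constant term is split off instead.\<close>
      case 2
      define c where "c = mpcoeff f 0"
      have "mdegree \<alpha> \<le> d \<and> 1 \<le> card (keys \<alpha>)" if "mpcoeff (f - of_int c) \<alpha> \<noteq> 0" for \<alpha>
      proof -
        have "\<alpha> \<noteq> 0" "mpcoeff f \<alpha> \<noteq> 0"
          using that by (auto simp: c_def split: if_splits)
        then show ?thesis
          using supp by (simp add: Suc_le_eq card_gt_0_iff)
      qed
      moreover have "of_int c \<in> Lambda_Z"
        unfolding Lambda_Z_iff
      proof
        show "\<exists>d. \<forall>\<alpha>. mpcoeff (of_int c :: mpser) \<alpha> \<noteq> 0 \<longrightarrow> mdegree \<alpha> \<le> d"
          by (intro exI[of _ 0]) (auto simp: mdegree_def)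
        have "\<alpha> = 0 \<longleftrightarrow> size (expm \<alpha>) = 0" for \<alpha>
          by simp
        then show "\<forall>\<alpha> \<beta>. expm \<alpha> = expm \<beta> \<longrightarrow> mpcoeff (of_int c :: mpser) \<alpha> = mpcoeff (of_int c) \<beta>"
          unfolding mpcoeff_of_int by metis
      qed
      ultimately have "f - of_int c \<in> ring_gen (range elem_sym)"
        using f 2 by (intro IH[of d 1]) auto
      then have "(f - of_int c) + of_int c \<in> ring_gen (range elem_sym)"
        by (intro ring_gen.add ring_gen_of_int)
      then show ?thesis by simp
    next
      case 3
      obtain g where g: "g \<in> Lambda_Z" "\<And>\<alpha>. mpcoeff g \<alpha> \<noteq> 0 \<Longrightarrow> mdegree \<alpha> \<le> d - n"
        "\<And>\<alpha>. mpcoeff (f - elem_sym n * g) \<alpha> \<noteq> 0 \<Longrightarrow> mdegree \<alpha> \<le> d \<and> Suc n \<le> card (keys \<alpha>)"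
        using elem_sym_division[OF f 3 supp] by blast
      have "g \<in> ring_gen (range elem_sym)"
        using g 3 by (intro IH[of "d - n" 0]) auto
      then have "elem_sym n * g \<in> ring_gen (range elem_sym)"
        by (rule ring_gen.mult[OF ring_gen.base[OF rangeI]])
      moreover have "f - elem_sym n * g \<in> ring_gen (range elem_sym)"
      proof (intro IH[of d "Suc n"])
        show "f - elem_sym n * g \<in> Lambda_Z"
          using f g by (simp add: elem_sym_def monomial_sym_in_Lambda_Z)
      qed (use g 3 in auto)
      ultimately have "(f - elem_sym n * g) + elem_sym n * g \<in> ring_gen (range elem_sym)"
        by (rule ring_gen.add[rotated])
      then show ?thesis by simp
    qed
  qed
  show ?thesis
  proof
    fix f assume f: "f \<in> Lambda_Z"
    then obtain d where "\<forall>\<alpha>. mpcoeff f \<alpha> \<noteq> 0 \<longrightarrow> mdegree \<alpha> \<le> d"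
      unfolding Lambda_Z_iff by blast
    then show "f \<in> ring_gen (range elem_sym)"
      using f by (intro main[of f d 0]) auto
  qed
qed

section \<open>Column tableaux and the Bender--Knuth involutions\<close>

definition cnt :: "nat set \<Rightarrow> nat \<Rightarrow> nat" where
  "cnt C v = card (C \<inter> {..<v})"

lemma cnt_Suc: "cnt C (Suc v) = cnt C v + (if v \<in> C then 1 else 0)"
  by (simp add: cnt_def lessThan_Suc Int_insert_right)

lemma cnt_eq_card: "C \<subseteq> {..<n} \<Longrightarrow> cnt C n = card C"
  by (simp add: cnt_def Int_absorb2)

text \<open>If \<open>C\<close> and \<open>D\<close> list the entries of two adjacent columns of a semistandard tableau,
  then \<open>colle C D\<close> says that the rows increase weakly from \<open>C\<close> to \<open>D\<close>.\<close>

definition colle :: "nat set \<Rightarrow> nat set \<Rightarrow> bool" where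
  "colle C D \<longleftrightarrow> (\<forall>v. cnt D v \<le> cnt C v)"

lemma transp_colle: "transp colle"
  by (auto simp: transp_def colle_def intro: order_trans)

text \<open>A tableau is the list of its columns, each stored as the set of its entries. Strict
  increase down a column is then automatic, and only the row condition \<open>colle\<close>
  remains.\<close>

definition coltab :: "nat \<Rightarrow> nat list \<Rightarrow> nat set list set" where
  "coltab n cs = {Ts. map card Ts = cs \<and> (\<forall>C\<in>set Ts. C \<subseteq> {..<n}) \<and> sorted_wrt colle Ts}"

definition wt :: "nat set list \<Rightarrow> nat \<Rightarrow> nat" where
  "wt Ts i = length (filter (\<lambda>C. i \<in> C) Ts)"

lemma wt_simps [simp]:
  "wt [] i = 0"
  "wt (C # Ts) i = (if i \<in> C then 1 else 0) + wt Ts i"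
  "wt (Ts @ Us) i = wt Ts i + wt Us i"
  by (auto simp: wt_def)

lemma wt_conv_card: "wt Ts i = card {j. j < length Ts \<and> i \<in> Ts ! j}"
  by (simp add: wt_def length_filter_conv_card)

lemma finite_coltab: "finite (coltab n cs)"
proof (rule finite_subset)
  show "coltab n cs \<subseteq> {Ts. set Ts \<subseteq> Pow {..<n} \<and> length Ts = length cs}"
    by (auto simp: coltab_def)
qed (simp add: finite_lists_length_eq)

text \<open>Reflection within the block of indices that share the values of \<open>d\<close> and
  \<open>f\<close>. For antitone \<open>d\<close> and \<open>f\<close> a block is an interval, and
  the sum of its ends minus \<open>j\<close> is the mirror image of \<open>j\<close>.\<close>

definition mirror :: "(nat \<Rightarrow> nat) \<Rightarrow> (nat \<Rightarrow> nat) \<Rightarrow> nat \<Rightarrow> nat \<Rightarrow> nat" where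
  "mirror d f m j =
    Min {l. l < m \<and> d l = d j \<and> f l = f j} + Max {l. l < m \<and> d l = d j \<and> f l = f j} - j"

lemma mirror:
  assumes anti: "\<And>i j. i \<le> j \<Longrightarrow> j < m \<Longrightarrow> d j \<le> d i" "\<And>i j. i \<le> j \<Longrightarrow> j < m \<Longrightarrow> f j \<le> f i"
    and j: "j < m"
  shows "mirror d f m j < m" "d (mirror d f m j) = d j" "f (mirror d f m j) = f j"
    "mirror d f m (mirror d f m j) = j"
    "Suc j < m \<Longrightarrow> d (Suc j) = d j \<Longrightarrow> f (Suc j) = f j \<Longrightarrow>
      mirror d f m j = Suc (mirror d f m (Suc j))"
proof -
  define K where "K i = {l. l < m \<and> d l = d i \<and> f l = f i}" for i
  have r: "mirror d f m i = Min (K i) + Max (K i) - i" for i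
    by (simp add: mirror_def K_def)
  have fin: "finite (K j)" and jK: "j \<in> K j"
    using j by (auto simp: K_def)
  then have le: "Min (K j) \<le> j" "j \<le> Max (K j)" and
    mem: "Min (K j) \<in> K j" "Max (K j) \<in> K j"
    by (auto intro: Min_in Max_in)
  have Max: "Max (K j) < m" "d (Max (K j)) = d j" "f (Max (K j)) = f j"
    and Min: "d (Min (K j)) = d j" "f (Min (K j)) = f j"
    using mem unfolding K_def by auto
  have b: "Min (K j) \<le> mirror d f m j" "mirror d f m j \<le> Max (K j)"
    using le unfolding r by auto
  then show lt: "mirror d f m j < m"
    using Max by simp
  show d: "d (mirror d f m j) = d j"
    using anti(1)[OF b(1) lt] anti(1)[OF b(2) Max(1)] Max Min by simp
  show f: "f (mirror d f m j) = f j"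
    using anti(2)[OF b(1) lt] anti(2)[OF b(2) Max(1)] Max Min by simp
  have "K (mirror d f m j) = K j"
    unfolding K_def d f ..
  then have "mirror d f m (mirror d f m j) = Min (K j) + Max (K j) - mirror d f m j"
    by (simp only: r)
  then show "mirror d f m (mirror d f m j) = j"
    using le unfolding r[of j] by simp
  show "mirror d f m j = Suc (mirror d f m (Suc j))"
    if "Suc j < m" "d (Suc j) = d j" "f (Suc j) = f j"
  proof -
    have "Suc j \<in> K j" and K: "K (Suc j) = K j"
      using that by (auto simp: K_def)
    then have "Suc j \<le> Max (K j)"
      using fin by simp
    then show ?thesis
      unfolding r K by simp
  qed
qed

lemma mirror_cong:
  assumes "\<And>l. l < m \<Longrightarrow> d l = d' l" "\<And>l. l < m \<Longrightarrow> f l = f' l" "j < m"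
  shows "mirror d f m j = mirror d' f' m j"
proof -
  have "{l. l < m \<and> d l = d j \<and> f l = f j} = {l. l < m \<and> d' l = d' j \<and> f' l = f' j}"
    using assms by auto
  then show ?thesis
    by (simp add: mirror_def)
qed

text \<open>Columns with equal counts below \<open>k\<close> and below \<open>k + 2\<close> form a
  block. If these counts differ by one, each column of the block holds exactly one of
  \<open>k\<close> and \<open>k + 1\<close>, all in the same row: these are the free entries of
  Bender and Knuth.\<close>

definition bk_mirror :: "nat \<Rightarrow> nat set list \<Rightarrow> nat \<Rightarrow> nat" where
  "bk_mirror k Ts =
    mirror (\<lambda>j. cnt (Ts ! j) k) (\<lambda>j. cnt (Ts ! j) (Suc (Suc k))) (length Ts)"

text \<open>Within a block the order of the free entries is reversed and \<open>k\<close> is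
  exchanged with \<open>k + 1\<close>. This swaps the two multiplicities and keeps the row weakly
  increasing; columns with both or neither entry do not change.\<close>

definition bk :: "nat \<Rightarrow> nat set list \<Rightarrow> nat set list" where
  "bk k Ts = map (\<lambda>j. {i. if i = k then Suc k \<in> Ts ! bk_mirror k Ts j
    else if i = Suc k then k \<in> Ts ! bk_mirror k Ts j else i \<in> Ts ! j}) [0..<length Ts]"

lemma length_bk [simp]: "length (bk k Ts) = length Ts"
  by (simp add: bk_def)

lemma in_bk_nth:
  "j < length Ts \<Longrightarrow> i \<in> bk k Ts ! j \<longleftrightarrow> (if i = k then Suc k \<in> Ts ! bk_mirror k Ts j
    else if i = Suc k then k \<in> Ts ! bk_mirror k Ts j else i \<in> Ts ! j)"
  by (simp add: bk_def)

context
  fixes k :: nat and Ts :: "nat set list"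
  assumes sorted: "sorted_wrt colle Ts"
begin

lemma cnt_antimono: "i \<le> j \<Longrightarrow> j < length Ts \<Longrightarrow> cnt (Ts ! j) v \<le> cnt (Ts ! i) v"
  using sorted by (cases "i = j") (auto simp: sorted_wrt_iff_nth_less colle_def)

lemma bk_mirror:
  assumes "j < length Ts"
  shows "bk_mirror k Ts j < length Ts" "cnt (Ts ! bk_mirror k Ts j) k = cnt (Ts ! j) k"
    "cnt (Ts ! bk_mirror k Ts j) (Suc (Suc k)) = cnt (Ts ! j) (Suc (Suc k))" "bk_mirror k Ts (bk_mirror k Ts j) = j"
    "Suc j < length Ts \<Longrightarrow> cnt (Ts ! Suc j) k = cnt (Ts ! j) k \<Longrightarrow>
      cnt (Ts ! Suc j) (Suc (Suc k)) = cnt (Ts ! j) (Suc (Suc k)) \<Longrightarrow> bk_mirror k Ts j = Suc (bk_mirror k Ts (Suc j))"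
  unfolding bk_mirror_def
  using mirror[OF cnt_antimono[of _ _ k] cnt_antimono[of _ _ "Suc (Suc k)"] assms] by simp_all

text \<open>Only the count below \<open>k + 1\<close> can change. The blocks depend on the counts
  below \<open>k\<close> and \<open>k + 2\<close>, so they persist, which makes \<open>bk\<close> an
  involution.\<close>

lemma cnt_bk:
  assumes "j < length Ts"
  shows "cnt (bk k Ts ! j) v = (if v = Suc k
    then cnt (Ts ! j) k + (if Suc k \<in> Ts ! bk_mirror k Ts j then 1 else 0) else cnt (Ts ! j) v)"
proof -
  have low: "cnt (bk k Ts ! j) v = cnt (Ts ! j) v" if "v \<le> k" for v
    unfolding cnt_def using that assms by (intro arg_cong[of _ _ card]) (auto simp: in_bk_nth)
  have mid: "cnt (bk k Ts ! j) (Suc k) = cnt (Ts ! j) k + (if Suc k \<in> Ts ! bk_mirror k Ts j then 1 else 0)"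
    using assms by (simp add: cnt_Suc low in_bk_nth)
  have "cnt (bk k Ts ! j) (Suc (Suc k)) = cnt (Ts ! bk_mirror k Ts j) (Suc (Suc k))"
    using assms unfolding cnt_Suc[of _ "Suc k"] mid
    by (simp add: in_bk_nth cnt_Suc bk_mirror)
  then have two: "cnt (bk k Ts ! j) (Suc (Suc k)) = cnt (Ts ! j) (Suc (Suc k))"
    using assms by (simp add: bk_mirror)
  have high: "cnt (bk k Ts ! j) v = cnt (Ts ! j) v" if "Suc (Suc k) \<le> v" for v
    using that
  proof (induction v rule: dec_induct)
    case (step v)
    then show ?case
      using assms by (simp add: cnt_Suc[of _ v] in_bk_nth)
  qed (rule two)
  consider "v \<le> k" | "v = Suc k" | "Suc (Suc k) \<le> v" by linarith
  then show ?thesis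
    using low mid high by cases auto
qed

lemma bk_bk: "bk k (bk k Ts) = Ts"
proof (rule nth_equalityI)
  fix j assume "j < length (bk k (bk k Ts))"
  then have j: "j < length Ts" by simp
  have "bk_mirror k (bk k Ts) j = bk_mirror k Ts j"
    unfolding bk_mirror_def length_bk by (rule mirror_cong) (auto simp: cnt_bk j)
  then show "bk k (bk k Ts) ! j = Ts ! j"
    using j bk_mirror[OF j] by (intro Set.set_eqI) (auto simp: in_bk_nth)
qed simp

lemma sorted_bk: "sorted_wrt colle (bk k Ts)"
  unfolding sorted_wrt_iff_nth_Suc_transp[OF transp_colle] colle_def
proof (intro allI impI)
  fix j v assume "Suc j < length (bk k Ts)"
  then have j: "j < length Ts" "Suc j < length Ts" by auto
  note le = cnt_antimono[OF le_SucI[OF order_refl] j(2)]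
  show "cnt (bk k Ts ! Suc j) v \<le> cnt (bk k Ts ! j) v"
  proof (cases "v = Suc k")
    case False
    then show ?thesis using j le by (simp add: cnt_bk)
  next
    case True
    have f: "cnt (Ts ! i) (Suc (Suc k)) = cnt (Ts ! i) k +
        (if k \<in> Ts ! bk_mirror k Ts i then 1 else 0) + (if Suc k \<in> Ts ! bk_mirror k Ts i then 1 else 0)"
      if "i < length Ts" for i
      using bk_mirror(2,3)[OF that] by (simp add: cnt_Suc)
    show ?thesis
    proof (cases "cnt (Ts ! Suc j) k = cnt (Ts ! j) k \<and>
        cnt (Ts ! Suc j) (Suc (Suc k)) = cnt (Ts ! j) (Suc (Suc k))")
      case True
      \<comment> \<open>In one block the two columns are mirrored to neighbours in the opposite
        order; exchanging \<open>k\<close> and \<open>k + 1\<close> reverses the inequality once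
        more.\<close>
      then have "bk_mirror k Ts j = Suc (bk_mirror k Ts (Suc j))"
        using bk_mirror(5)[OF j(1) j(2)] by simp
      moreover have "bk_mirror k Ts j < length Ts" "bk_mirror k Ts (Suc j) < length Ts"
        using bk_mirror(1) j by auto
      ultimately have "cnt (Ts ! bk_mirror k Ts j) (Suc k) \<le> cnt (Ts ! bk_mirror k Ts (Suc j)) (Suc k)"
        by (intro cnt_antimono) auto
      then have "cnt (Ts ! j) k + (if k \<in> Ts ! bk_mirror k Ts j then 1 else 0) \<le>
          cnt (Ts ! Suc j) k + (if k \<in> Ts ! bk_mirror k Ts (Suc j) then 1 else 0)"
        by (simp only: cnt_Suc bk_mirror(2)[OF j(1)] bk_mirror(2)[OF j(2)])
      then show ?thesis
        using f[OF j(1)] f[OF j(2)] True \<open>v = Suc k\<close> j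
        by (auto simp: cnt_bk split: if_splits)
    next
      case False
      \<comment> \<open>At a block boundary the count below \<open>k\<close> or below
        \<open>k + 2\<close> drops by at least one, while the count below \<open>k + 1\<close>
        differs from each of them by at most one.\<close>
      then have "cnt (Ts ! Suc j) k < cnt (Ts ! j) k \<or>
          cnt (Ts ! Suc j) (Suc (Suc k)) < cnt (Ts ! j) (Suc (Suc k))"
        using le[of k] le[of "Suc (Suc k)"] by linarith
      then show ?thesis
        using f[OF j(1)] f[OF j(2)] \<open>v = Suc k\<close> j le[of k]
        by (auto simp: cnt_bk split: if_splits)
    qed
  qed
qed

lemma wt_bk: "wt (bk k Ts) = wt Ts \<circ> transposition k (Suc k)"
proof
  fix i
  have inv: "card {j. j < length Ts \<and> l \<in> Ts ! bk_mirror k Ts j} = card {j. j < length Ts \<and> l \<in> Ts ! j}" for l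
    by (rule bij_betw_same_card[of "bk_mirror k Ts"], rule bij_betwI[of _ _ _ "bk_mirror k Ts"]) (auto simp: bk_mirror)
  have "wt (bk k Ts) i = card {j. j < length Ts \<and> i \<in> bk k Ts ! j}"
    by (simp add: wt_conv_card)
  also have "{j. j < length Ts \<and> i \<in> bk k Ts ! j} =
      (if i = k then {j. j < length Ts \<and> Suc k \<in> Ts ! bk_mirror k Ts j}
       else if i = Suc k then {j. j < length Ts \<and> k \<in> Ts ! bk_mirror k Ts j}
       else {j. j < length Ts \<and> i \<in> Ts ! j})"
    by (auto simp: in_bk_nth)
  also have "card \<dots> = wt Ts (transposition k (Suc k) i)"
    by (auto simp: inv wt_conv_card Transposition.transpose_def)
  finally show "wt (bk k Ts) i = (wt Ts \<circ> transposition k (Suc k)) i" by simp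
qed

lemma bk_subset:
  assumes sub: "\<forall>C\<in>set Ts. C \<subseteq> {..<n}" and k: "Suc k < n"
  shows "(\<forall>C\<in>set (bk k Ts). C \<subseteq> {..<n}) \<and> map card (bk k Ts) = map card Ts"
proof -
  have s: "Ts ! j \<subseteq> {..<n}" if "j < length Ts" for j
    using sub that by auto
  have s': "bk k Ts ! j \<subseteq> {..<n}" if "j < length Ts" for j
    using s[OF that] k that by (auto simp: in_bk_nth split: if_splits)
  have "card (bk k Ts ! j) = card (Ts ! j)" if "j < length Ts" for j
    using cnt_bk[OF that, of n] cnt_eq_card[OF s[OF that]] cnt_eq_card[OF s'[OF that]] k by simp
  then have "map card (bk k Ts) = map card Ts"
    by (intro nth_equalityI) auto
  moreover have "C \<subseteq> {..<n}" if C: "C \<in> set (bk k Ts)" for C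
    using C s' unfolding in_set_conv_nth by auto
  ultimately show ?thesis by blast
qed

end

lemma bk_coltab: "Ts \<in> coltab n cs \<Longrightarrow> Suc k < n \<Longrightarrow> bk k Ts \<in> coltab n cs"
  unfolding coltab_def using bk_subset[of Ts n k] sorted_bk[of Ts k] by auto

text \<open>The symmetry of Schur polynomials: \<open>bk\<close> handles adjacent transpositions,
  and these generate all permutations.\<close>

lemma sum_coltab_permute:
  assumes "\<pi> permutes {..<n}"
  shows "(\<Sum>Ts\<in>coltab n cs. F (wt Ts)) = (\<Sum>Ts\<in>coltab n cs. F (wt Ts \<circ> \<pi>))"
proof -
  \<comment> \<open>Quantifying over all \<open>F\<close> allows \<open>F\<close> to be replaced by
    its precomposition with a permutation, which makes \<open>P\<close> closed under
    composition.\<close>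
  define P where "P \<pi> \<longleftrightarrow>
    (\<forall>F. (\<Sum>Ts\<in>coltab n cs. F (wt Ts) :: 'a) = (\<Sum>Ts\<in>coltab n cs. F (wt Ts \<circ> \<pi>)))" for \<pi>
  have comp: "P (\<pi> \<circ> \<sigma>)" if "P \<pi>" "P \<sigma>" for \<pi> \<sigma>
    unfolding P_def
  proof
    fix F :: "(nat \<Rightarrow> nat) \<Rightarrow> 'a"
    have "(\<Sum>Ts\<in>coltab n cs. F (wt Ts)) = (\<Sum>Ts\<in>coltab n cs. F (wt Ts \<circ> \<sigma>))"
      using that(2) unfolding P_def by blast
    also have "\<dots> = (\<Sum>Ts\<in>coltab n cs. F (wt Ts \<circ> \<pi> \<circ> \<sigma>))"
      using that(1)[unfolded P_def, rule_format, of "\<lambda>w. F (w \<circ> \<sigma>)"] .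
    finally show "(\<Sum>Ts\<in>coltab n cs. F (wt Ts)) = (\<Sum>Ts\<in>coltab n cs. F (wt Ts \<circ> (\<pi> \<circ> \<sigma>)))"
      by (simp add: comp_assoc)
  qed
  have adj: "P (transposition k (Suc k))" if "Suc k < n" for k
    unfolding P_def
  proof
    fix F :: "(nat \<Rightarrow> nat) \<Rightarrow> 'a"
    have s: "sorted_wrt colle Ts" if "Ts \<in> coltab n cs" for Ts
      using that by (simp add: coltab_def)
    show "(\<Sum>Ts\<in>coltab n cs. F (wt Ts)) = (\<Sum>Ts\<in>coltab n cs. F (wt Ts \<circ> transposition k (Suc k)))"
      by (rule sum.reindex_bij_witness[of _ "bk k" "bk k"])
        (simp_all add: s bk_bk bk_coltab that wt_bk comp_assoc)
  qed
  have tr: "P (transposition a b)" if "a < b" "b < n" for a b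
    using that
  proof (induction b)
    case (Suc b)
    show ?case
    proof (cases "a = b")
      case False
      then have "transposition a (Suc b) = transposition b (Suc b) \<circ> (transposition a b \<circ> transposition b (Suc b))"
        using Suc.prems by (auto simp: fun_eq_iff Transposition.transpose_def)
      moreover have "P (transposition a b)" "P (transposition b (Suc b))"
        using Suc False adj by auto
      ultimately show ?thesis
        by (simp only: comp)
    qed (use adj Suc in simp)
  qed simp
  have "P \<pi>"
    using assms finite_lessThan
  proof (induction rule: permutes_induct)
    case id
    show ?case unfolding P_def by (simp only: comp_id refl simp_thms)
  next
    case (swap a b p)
    then have "P (transposition a b)"
      using tr[of a b] tr[of b a] by (cases "a < b") (auto simp: transpose_commute)
    with swap show ?case by (intro comp)
  qed
  then show ?thesis
    unfolding P_def by blast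
qed

section \<open>Alternants\<close>

definition alt :: "nat \<Rightarrow> (nat \<Rightarrow> nat) \<Rightarrow> mpser" where
  "alt n \<gamma> = mdet (Matrix.mat n n (\<lambda>(i, k). var_ser k ^ \<gamma> i))"

lemma alt_expand:
  "alt n \<gamma> = (\<Sum>p | p permutes {..<n}. of_int (sign p) * (\<Prod>i<n. var_ser (p i) ^ \<gamma> i))"
  unfolding alt_def
  by (subst det_def'[of _ n])
    (auto simp: atLeast0LessThan permutes_in_image intro!: sum.cong prod.cong
      dest: permutes_in_image)

lemma alt_cong: "(\<And>i. i < n \<Longrightarrow> \<gamma> i = \<gamma>' i) \<Longrightarrow> alt n \<gamma> = alt n \<gamma>'"
  unfolding alt_def by (intro arg_cong[of _ _ mdet] eq_matI) auto

lemma alt_transposition: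
  assumes "k < n" "l < n" "k \<noteq> l"
  shows "alt n (\<gamma> \<circ> transposition k l) = - alt n \<gamma>"
proof -
  let ?p = "transposition k l"
  have p: "?p permutes {0..<n}"
    using assms by (intro permutes_swap_id) auto
  then have lt: "?p i < n" if "i < n" for i
    using that permutes_in_image[OF p, of i] by simp
  have "alt n (\<gamma> \<circ> ?p) =
      mdet (Matrix.mat n n (\<lambda>(i, j). Matrix.mat n n (\<lambda>(i, k). var_ser k ^ \<gamma> i) $$ (?p i, j)))"
    unfolding alt_def by (intro arg_cong[of _ _ mdet] eq_matI) (auto simp: lt)
  also have "\<dots> = of_int (sign ?p) * alt n \<gamma>"
    unfolding alt_def by (rule det_permute_rows[OF _ p]) simp
  finally show ?thesis
    using assms by (simp add: sign_swap_id)
qed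

section \<open>Finite supports and cancellation of the Vandermonde determinant\<close>

definition fin_supp :: "mpser \<Rightarrow> bool" where
  "fin_supp f \<longleftrightarrow> finite {\<alpha>. mpcoeff f \<alpha> \<noteq> 0}"

lemma fin_supp_monom_ser [simp]: "fin_supp (monom_ser \<alpha>)"
  by (simp add: fin_supp_def)

lemma fin_supp_0 [simp]: "fin_supp 0"
  by (simp add: fin_supp_def)

lemma fin_supp_1 [simp]: "fin_supp 1"
  by (simp add: fin_supp_def)

lemma fin_supp_add [simp]: "fin_supp f \<Longrightarrow> fin_supp g \<Longrightarrow> fin_supp (f + g)"
  unfolding fin_supp_def
  by (rule finite_subset[of _ "{\<alpha>. mpcoeff f \<alpha> \<noteq> 0} \<union> {\<alpha>. mpcoeff g \<alpha> \<noteq> 0}"]) auto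

lemma fin_supp_uminus [simp]: "fin_supp f \<Longrightarrow> fin_supp (- f)"
  by (simp add: fin_supp_def)

lemma fin_supp_diff [simp]: "fin_supp f \<Longrightarrow> fin_supp g \<Longrightarrow> fin_supp (f - g)"
  using fin_supp_add[of f "- g"] by simp

lemma fin_supp_sum [simp]: "(\<And>s. s \<in> S \<Longrightarrow> fin_supp (f s)) \<Longrightarrow> fin_supp (sum f S)"
  by (induction S rule: infinite_finite_induct) auto

lemma fin_supp_mult [simp]:
  assumes "fin_supp f" "fin_supp g"
  shows "fin_supp (f * g)"
  unfolding fin_supp_def
proof (rule finite_subset)
  show "{\<alpha>. mpcoeff (f * g) \<alpha> \<noteq> 0} \<subseteq>
      (\<lambda>(\<beta>, \<gamma>). \<beta> + \<gamma>) ` ({\<alpha>. mpcoeff f \<alpha> \<noteq> 0} \<times> {\<alpha>. mpcoeff g \<alpha> \<noteq> 0})"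
  proof
    fix \<alpha> assume "\<alpha> \<in> {\<alpha>. mpcoeff (f * g) \<alpha> \<noteq> 0}"
    then have "(\<Sum>(\<beta>, \<gamma>) | \<beta> + \<gamma> = \<alpha>. mpcoeff f \<beta> * mpcoeff g \<gamma>) \<noteq> 0"
      by (simp add: mpcoeff_mult)
    then obtain p where "p \<in> {(\<beta>, \<gamma>). \<beta> + \<gamma> = \<alpha>}" "(case p of (\<beta>, \<gamma>) \<Rightarrow> mpcoeff f \<beta> * mpcoeff g \<gamma>) \<noteq> 0"
      using sum.not_neutral_contains_not_neutral by blast
    then show "\<alpha> \<in> (\<lambda>(\<beta>, \<gamma>). \<beta> + \<gamma>) ` ({\<alpha>. mpcoeff f \<alpha> \<noteq> 0} \<times> {\<alpha>. mpcoeff g \<alpha> \<noteq> 0})"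
      by (auto intro!: rev_image_eqI[of p])
  qed
qed (use assms in \<open>simp add: fin_supp_def\<close>)

lemma fin_supp_of_int [simp]: "fin_supp (of_int c)"
  unfolding fin_supp_def by (rule finite_subset[of _ "{0}"]) auto

lemma fin_supp_prod [simp]: "(\<And>s. s \<in> S \<Longrightarrow> fin_supp (f s)) \<Longrightarrow> fin_supp (prod f S)"
  by (induction S rule: infinite_finite_induct) auto

lemma fin_supp_var_power [simp]: "fin_supp (var_ser i ^ k)"
  by (simp add: var_ser_power)

lemma fin_supp_alt [simp]: "fin_supp (alt n \<gamma>)"
  unfolding alt_expand by auto

definition rho :: "nat \<Rightarrow> nat \<Rightarrow> nat" where
  "rho n i = n - Suc i"

lemma prod_var_ser_permute:
  assumes p: "p permutes {..<n}"
  shows "(\<Prod>i<n. var_ser (p i) ^ \<gamma> i) = monom_ser (expv n (\<gamma> \<circ> Hilbert_Choice.inv p))"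
proof -
  have "monom_ser (expv n (\<gamma> \<circ> Hilbert_Choice.inv p)) = (\<Prod>i<n. var_ser i ^ (\<gamma> \<circ> Hilbert_Choice.inv p) i)"
    by (rule prod_var_ser[symmetric])
  also have "\<dots> = (\<Prod>i<n. var_ser (p i) ^ (\<gamma> \<circ> Hilbert_Choice.inv p) (p i))"
    by (subst prod.permute[OF p]) (simp add: o_def)
  finally show ?thesis
    using permutes_inverses(2)[OF p] by simp
qed

text \<open>The exponents in \<open>rho n\<close> are distinct, so the monomial of the identity
  permutation is produced by no other permutation and keeps coefficient 1.\<close>

lemma alt_rho_nonzero: "alt n (rho n) \<noteq> 0"
proof
  assume "alt n (rho n) = 0"
  then have "mpcoeff (alt n (rho n)) (expv n (rho n)) = 0" by simp
  also have "mpcoeff (alt n (rho n)) (expv n (rho n)) =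
      (\<Sum>p | p permutes {..<n}. sign p * (if p = id then 1 else 0))"
    unfolding alt_expand mpcoeff_sum mpcoeff_of_int_mult
  proof (rule sum.cong[OF refl], rule arg_cong[of _ _ "\<lambda>x. _ * x"])
    fix p assume "p \<in> {p. p permutes {..<n}}"
    then have p: "p permutes {..<n}" by simp
    have "p = id" if eq: "expv n (rho n) = expv n (rho n \<circ> Hilbert_Choice.inv p)"
    proof
      fix i
      show "p i = id i"
      proof (cases "i < n")
        case True
        then have pi: "p i < n"
          using permutes_in_image[OF p, of i] by simp
        have "lookup (expv n (rho n)) (p i) = lookup (expv n (rho n \<circ> Hilbert_Choice.inv p)) (p i)"
          using eq by simp
        then have "rho n (p i) = rho n i"
          using pi permutes_inverses(2)[OF p] by simp
        then show ?thesis
          using True pi by (simp add: rho_def)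
      next
        case False
        then show ?thesis
          using permutes_not_in[OF p] by simp
      qed
    qed
    then show "mpcoeff (\<Prod>i<n. var_ser (p i) ^ rho n i) (expv n (rho n)) = (if p = id then 1 else 0)"
      unfolding prod_var_ser_permute[OF p] by auto
  qed
  also have "\<dots> = (\<Sum>p | p permutes {..<n}. if p = id then 1 else 0)"
    by (intro sum.cong) auto
  also have "\<dots> = 1"
    by (simp add: finite_permutations permutes_id)
  finally show False by simp
qed

text \<open>Cancellation compares leading monomials; finite supports guarantee that they
  exist.\<close>

lemma alt_rho_cancel:
  assumes "alt n (rho n) * f = alt n (rho n) * g" "fin_supp f" "fin_supp g"
  shows "f = g"
proof -
  have "f - g = 0"
  proof (rule mpser_mult_eq_0D)
    show "alt n (rho n) * (f - g) = 0"
      by (simp only: right_diff_distrib assms(1) diff_self)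
    show "finite {\<alpha>. mpcoeff (alt n (rho n)) \<alpha> \<noteq> 0}"
      using fin_supp_alt unfolding fin_supp_def .
    show "finite {\<alpha>. mpcoeff (f - g) \<alpha> \<noteq> 0}"
      using fin_supp_diff[OF assms(2,3)] unfolding fin_supp_def .
  qed (rule alt_rho_nonzero)
  then show ?thesis by simp
qed

section \<open>The Littlewood--Richardson rule after Stembridge\<close>

definition tabsum :: "nat \<Rightarrow> nat list \<Rightarrow> mpser" where
  "tabsum n cs = (\<Sum>Ts\<in>coltab n cs. monom_ser (expv n (wt Ts)))"

lemma fin_supp_tabsum [simp]: "fin_supp (tabsum n cs)"
  by (auto simp: tabsum_def)

text \<open>In the term of the permutation \<open>p\<close> the symmetric factor may be rewritten
  with its variables permuted by \<open>p\<close>; the monomials then reassemble into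
  alternants.\<close>

lemma alt_mult_tabsum:
  "alt n \<gamma> * tabsum n cs = (\<Sum>Ts\<in>coltab n cs. alt n (\<lambda>i. \<gamma> i + wt Ts i))"
proof -
  have "alt n \<gamma> * tabsum n cs = (\<Sum>p | p permutes {..<n}. \<Sum>Ts\<in>coltab n cs.
      of_int (sign p) * (\<Prod>i<n. var_ser (p i) ^ (\<gamma> i + wt Ts i)))"
    unfolding alt_expand sum_distrib_right
  proof (rule sum.cong[OF refl])
    fix p assume "p \<in> {p. p permutes {..<n}}"
    then have p: "p permutes {..<n}" by simp
    have "tabsum n cs = (\<Sum>Ts\<in>coltab n cs. monom_ser (expv n (wt Ts \<circ> Hilbert_Choice.inv p)))"
      unfolding tabsum_def using permutes_inv[OF p] by (rule sum_coltab_permute)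
    also have "\<dots> = (\<Sum>Ts\<in>coltab n cs. \<Prod>i<n. var_ser (p i) ^ wt Ts i)"
      by (simp only: prod_var_ser_permute[OF p])
    finally show "of_int (sign p) * (\<Prod>i<n. var_ser (p i) ^ \<gamma> i) * tabsum n cs = (\<Sum>Ts\<in>coltab n cs.
        of_int (sign p) * (\<Prod>i<n. var_ser (p i) ^ (\<gamma> i + wt Ts i)))"
      by (simp only: sum_distrib_left power_add prod.distrib mult.assoc)
  qed
  also have "\<dots> = (\<Sum>Ts\<in>coltab n cs. alt n (\<lambda>i. \<gamma> i + wt Ts i))"
    unfolding alt_expand by (rule sum.swap)
  finally show ?thesis .
qed

definition decr :: "nat \<Rightarrow> (nat \<Rightarrow> nat) \<Rightarrow> bool" where
  "decr n \<gamma> \<longleftrightarrow> (\<forall>i. Suc i < n \<longrightarrow> \<gamma> (Suc i) \<le> \<gamma> i)"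

text \<open>The Littlewood--Richardson condition in Stembridge's form: adding the contents of the
  columns to \<open>lam\<close> one by one, from the right, never leaves the decreasing
  sequences.\<close>

definition lr_good :: "nat \<Rightarrow> (nat \<Rightarrow> nat) \<Rightarrow> nat set list \<Rightarrow> bool" where
  "lr_good n lam Ts \<longleftrightarrow> (\<forall>j\<le>length Ts. decr n (\<lambda>i. lam i + wt (drop j Ts) i))"

text \<open>The tableaux that are not \<open>lr_good\<close> cancel in pairs: apply a Bender--Knuth involution to
  the columns to the left of the first violation, reading the columns from the right.\<close>

lemma alt_sum_lr_good:
  assumes lam_decr: "decr n lam"
  shows "(\<Sum>Ts\<in>coltab n cs. alt n (\<lambda>i. lam i + rho n i + wt Ts i)) =
    (\<Sum>Ts | Ts \<in> coltab n cs \<and> lr_good n lam Ts. alt n (\<lambda>i. lam i + rho n i + wt Ts i))"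
proof -
  define u where "u Ts j = (\<lambda>i. lam i + wt (drop j Ts) i)" for Ts j
  \<comment> \<open>The cut \<open>J\<close> and the row \<open>K\<close> are determined by the
    columns from the cut on, which \<open>lrinv\<close> does not touch. A second application
    therefore finds the same cut and row.\<close>
  define J where "J Ts = Max {j. j \<le> length Ts \<and> \<not> decr n (u Ts j)}" for Ts
  define K where "K w = (LEAST k. Suc k < n \<and> w k < w (Suc k))" for w :: "nat \<Rightarrow> nat"
  define lrinv where "lrinv Ts = bk (K (u Ts (J Ts))) (take (J Ts) Ts) @ drop (J Ts) Ts" for Ts
  let ?a = "\<lambda>Ts. alt n (\<lambda>i. lam i + rho n i + wt Ts i)"
  let ?B = "{Ts \<in> coltab n cs. \<not> lr_good n lam Ts}"
  have step: "lrinv Ts \<in> ?B \<and> lrinv (lrinv Ts) = Ts \<and> ?a (lrinv Ts) = - ?a Ts" if Ts: "Ts \<in> ?B" for Ts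
  proof -
    define j where "j = J Ts"
    define k where "k = K (u Ts j)"
    let ?S = "{j. j \<le> length Ts \<and> \<not> decr n (u Ts j)}"
    have fin: "finite ?S" by simp
    have "?S \<noteq> {}"
      using Ts by (auto simp: lr_good_def u_def)
    then have jS: "j \<in> ?S"
      unfolding j_def J_def using fin by (intro Max_in)
    have jmax: "decr n (u Ts l)" if "j < l" "l \<le> length Ts" for l
      using that Max_ge[OF fin, of l] unfolding j_def J_def by fastforce
    have bad: "\<not> decr n (u Ts j)" using jS by simp
    then have jlt: "j < length Ts"
      using jS lam_decr by (cases "j = length Ts") (auto simp: u_def)
    have "\<exists>k. Suc k < n \<and> u Ts j k < u Ts j (Suc k)"
      using bad by (auto simp: decr_def not_le)
    then have k: "Suc k < n" "u Ts j k < u Ts j (Suc k)"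
      unfolding k_def K_def by (metis (mono_tags, lifting) LeastI_ex)+
    define C where "C = Ts ! j"
    have dj: "drop j Ts = C # drop (Suc j) Ts"
      unfolding C_def using jlt by (rule Cons_nth_drop_Suc[symmetric])
    have "u Ts (Suc j) (Suc k) \<le> u Ts (Suc j) k"
      using jmax[of "Suc j"] jlt k by (auto simp: decr_def)
    \<comment> \<open>One column adds at most one to each row, so at the first violation row
      \<open>k + 1\<close> exceeds row \<open>k\<close> by exactly one, the amount by which
      \<open>rho\<close> falls from \<open>k\<close> to \<open>k + 1\<close>.\<close>
    then have kC: "k \<notin> C" "Suc k \<in> C" and eq: "u Ts j (Suc k) = Suc (u Ts j k)"
      using k(2) by (auto simp: u_def dj split: if_splits)
    have sorted: "sorted_wrt colle Ts" and sub: "\<forall>C\<in>set Ts. C \<subseteq> {..<n}" and cards: "map card Ts = cs"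
      using Ts by (auto simp: coltab_def)
    define P where "P = take j Ts"
    have Pd: "Ts = P @ drop j Ts" "length P = j"
      using jlt by (auto simp: P_def)
    have sP: "sorted_wrt colle P" and sD: "sorted_wrt colle (drop j Ts)"
      and PD: "\<And>x y. x \<in> set P \<Longrightarrow> y \<in> set (drop j Ts) \<Longrightarrow> colle x y"
      using sorted Pd(1) by (metis sorted_wrt_append)+
    have iT: "lrinv Ts = bk k P @ drop j Ts"
      by (simp add: lrinv_def j_def k_def P_def)
    have len: "length (lrinv Ts) = length Ts"
      using jlt Pd(2) by (simp add: iT)
    have drp: "drop l (lrinv Ts) = drop l Ts" if "j \<le> l" for l
      using that Pd(2) by (simp add: iT)
    then have u: "u (lrinv Ts) l = u Ts l" if "j \<le> l" for l
      using that by (simp add: u_def)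
    have J: "J (lrinv Ts) = j"
      unfolding J_def
    proof (rule Max_eqI)
      show "y \<le> j" if "y \<in> {j. j \<le> length (lrinv Ts) \<and> \<not> decr n (u (lrinv Ts) j)}" for y
        using that jmax[of y] u[of y] len by (cases "j < y") auto
      show "j \<in> {j. j \<le> length (lrinv Ts) \<and> \<not> decr n (u (lrinv Ts) j)}"
        using jS u[of j] len by auto
    qed simp
    \<comment> \<open>\<open>bk\<close> alters only counts below \<open>k + 1\<close>, and never to
      less than the count below \<open>k\<close>. As \<open>k\<close> is not in \<open>C\<close>,
      the counts of \<open>C\<close> below \<open>k\<close> and \<open>k + 1\<close> agree.\<close>
    have colC: "colle x C" if x: "x \<in> set (bk k P)" for x
      unfolding colle_def
    proof
      fix v
      obtain i where i: "i < length P" "x = bk k P ! i"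
        using x by (metis in_set_conv_nth length_bk)
      have "cnt C v \<le> cnt (P ! i) v" for v
        using PD[of "P ! i" C] i by (simp add: dj colle_def)
      from this[of v] this[of k] show "cnt C v \<le> cnt x v"
        using kC i by (auto simp: cnt_bk[OF sP i(1)] cnt_Suc)
    qed
    have colD: "colle x y" if x: "x \<in> set (bk k P)" and y: "y \<in> set (drop j Ts)" for x y
      using colC[OF x] y sD transpD[OF transp_colle, of x C y] by (auto simp: dj)
    have "sorted_wrt colle (lrinv Ts)"
      unfolding iT sorted_wrt_append using sorted_bk[OF sP] sD colD by blast
    moreover have "(\<forall>C\<in>set (bk k P). C \<subseteq> {..<n}) \<and> map card (bk k P) = map card P"
      using sP sub Pd(1) k(1) by (intro bk_subset) (auto simp: P_def dest: in_set_takeD)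
    moreover have "map card P @ map card (drop j Ts) = cs"
      using cards Pd(1) by (metis map_append)
    ultimately have mem: "lrinv Ts \<in> coltab n cs"
      using sub by (auto simp: coltab_def iT dest: in_set_dropD)
    have "\<not> decr n (u (lrinv Ts) j)"
      using bad u[of j] by simp
    then have nb: "lrinv Ts \<in> ?B"
      using mem len jlt by (auto simp: lr_good_def u_def intro!: exI[of _ j])
    have "lrinv (lrinv Ts) = bk k (take j (lrinv Ts)) @ drop j (lrinv Ts)"
      unfolding lrinv_def[of "lrinv Ts"] J u[OF order_refl] k_def ..
    also have "\<dots> = bk k (bk k P) @ drop j Ts"
      using Pd(2) by (simp add: iT)
    also have "\<dots> = Ts"
      using bk_bk[OF sP] Pd(1) by simp
    finally have invinv: "lrinv (lrinv Ts) = Ts" .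
    let ?t = "transposition k (Suc k)"
    have wP: "wt P i + wt (drop j Ts) i = wt Ts i" for i
      using wt_simps(3)[of P "drop j Ts" i] by (simp add: P_def)
    have rk: "rho n k = Suc (rho n (Suc k))"
      using k(1) by (simp add: rho_def)
    \<comment> \<open>Without the columns left of the cut, the exponents at \<open>k\<close> and
      \<open>k + 1\<close> are equal. Hence swapping the contents of \<open>P\<close> alone swaps
      the whole exponent vector.\<close>
    have "lam i + rho n i + wt (lrinv Ts) i = ((\<lambda>i. lam i + rho n i + wt Ts i) \<circ> ?t) i" for i
    proof -
      have "wt (lrinv Ts) i = wt P (?t i) + wt (drop j Ts) i"
        by (simp add: iT wt_bk[OF sP])
      moreover have "lam i + wt (drop j Ts) i + rho n i =
          lam (?t i) + wt (drop j Ts) (?t i) + rho n (?t i)"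
        using eq rk by (cases "i = k"; cases "i = Suc k") (auto simp: u_def)
      ultimately show ?thesis
        using wP[of "?t i"] by simp
    qed
    then have "?a (lrinv Ts) = alt n ((\<lambda>i. lam i + rho n i + wt Ts i) \<circ> ?t)"
      by (intro alt_cong) auto
    then have "?a (lrinv Ts) = - ?a Ts"
      using k(1) by (simp add: alt_transposition)
    with nb invinv show ?thesis by blast
  qed
  have fin: "finite ?B"
    using finite_coltab by simp
  have "(\<Sum>Ts\<in>?B. ?a Ts) = (\<Sum>Ts\<in>?B. - ?a Ts)"
    by (rule sum.reindex_bij_witness[of _ lrinv lrinv]) (use step in auto)
  then have z: "(\<Sum>Ts\<in>?B. ?a Ts) + (\<Sum>Ts\<in>?B. ?a Ts) = 0"
    by (simp add: sum_negf)
  \<comment> \<open>A series equal to its own negative vanishes, because its coefficients are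
    integers.\<close>
  have B0: "(\<Sum>Ts\<in>?B. ?a Ts) = 0"
  proof (rule mpser_eqI)
    fix \<alpha>
    show "mpcoeff (\<Sum>Ts\<in>?B. ?a Ts) \<alpha> = mpcoeff 0 \<alpha>"
      using arg_cong[OF z, of "\<lambda>f. mpcoeff f \<alpha>"] by (simp only: mpcoeff_simps) 
  qed
  have "(\<Sum>Ts\<in>coltab n cs. ?a Ts) =
      (\<Sum>Ts\<in>{Ts \<in> coltab n cs. lr_good n lam Ts} \<union> ?B. ?a Ts)"
    by (rule sum.cong) auto
  also have "\<dots> = (\<Sum>Ts | Ts \<in> coltab n cs \<and> lr_good n lam Ts. ?a Ts)"
    by (subst sum.union_disjoint) (use finite_coltab B0 in auto)
  finally show ?thesis .
qed

section \<open>Shapes, conjugate shapes and the bialternant formula\<close>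

text \<open>A partition with at most \<open>n\<close> parts as an infinite sequence, so that weights
  can be added pointwise and \<open>n\<close> can be enlarged without padding.\<close>

definition shape :: "nat \<Rightarrow> (nat \<Rightarrow> nat) \<Rightarrow> bool" where
  "shape n f \<longleftrightarrow> (\<forall>i. f (Suc i) \<le> f i) \<and> (\<forall>i\<ge>n. f i = 0)"

definition colh :: "(nat \<Rightarrow> nat) \<Rightarrow> nat \<Rightarrow> nat" where
  "colh f j = card {i. j < f i}"

definition colhs :: "(nat \<Rightarrow> nat) \<Rightarrow> nat list" where
  "colhs f = map (colh f) [0..<f 0]"

lemma shape_antimono: "shape n f \<Longrightarrow> i \<le> j \<Longrightarrow> f j \<le> f i"
  unfolding shape_def by (blast intro: lift_Suc_antimono_le)

lemma shape_mono: "shape n f \<Longrightarrow> n \<le> m \<Longrightarrow> shape m f"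
  by (simp add: shape_def)

lemma down_closed_eq_lessThan:
  assumes "finite C" "\<And>i. Suc i \<in> C \<Longrightarrow> i \<in> C"
  shows "C = {..<card C}"
proof -
  have dc: "j \<in> C" if "i \<in> C" "j \<le> i" for i j
    using that
  proof (induction i)
    case (Suc i)
    then show ?case
      using assms(2)[of i] by (cases "j = Suc i") auto
  qed simp
  show ?thesis
  proof (cases "C = {}")
    case False
    then have m: "Max C \<in> C"
      using assms(1) by simp
    have "C = {..<Suc (Max C)}"
    proof (intro equalityI subsetI)
      fix j assume "j \<in> {..<Suc (Max C)}"
      then show "j \<in> C"
        by (intro dc[OF m]) simp
    next
      fix j assume "j \<in> C"
      then show "j \<in> {..<Suc (Max C)}"
        using Max_ge[OF assms(1)] by (simp add: less_Suc_eq_le)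
    qed
    then show ?thesis
      using card_lessThan[of "Suc (Max C)"] by argo
  qed simp
qed

lemma less_colh_iff:
  assumes "shape n f"
  shows "i < colh f j \<longleftrightarrow> j < f i"
proof -
  have "{i. j < f i} \<subseteq> {..<n}"
  proof
    fix i assume "i \<in> {i. j < f i}"
    then show "i \<in> {..<n}"
      using assms by (cases "i < n") (auto simp: shape_def)
  qed
  then have "{i. j < f i} = {..<card {i. j < f i}}"
    using assms by (intro down_closed_eq_lessThan) (auto simp: shape_def finite_subset intro: less_le_trans)
  then show ?thesis
    unfolding colh_def by blast
qed

lemma colh_antimono:
  assumes "shape n f" "i \<le> j"
  shows "colh f j \<le> colh f i"
proof (rule ccontr)
  assume "\<not> colh f j \<le> colh f i"
  then have "j < f (colh f i)" "\<not> i < f (colh f i)"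
    using less_colh_iff[OF assms(1)] by (auto simp flip: less_colh_iff[OF assms(1)])
  with assms(2) show False by simp
qed

lemma colh_le: "shape n f \<Longrightarrow> colh f j \<le> n"
  using less_colh_iff[of n f n j] by (force simp: shape_def not_less)

lemma length_colhs [simp]: "length (colhs f) = f 0"
  by (simp add: colhs_def)

text \<open>The highest-weight tableau: every entry equals its row index, so a column is an initial
  segment.\<close>

definition high :: "(nat \<Rightarrow> nat) \<Rightarrow> nat set list" where
  "high f = map lessThan (colhs f)"

lemma wt_high:
  assumes "shape n f"
  shows "wt (high f) i = f i"
proof -
  have "wt (high f) i = card {j. j < f 0 \<and> j < f i}"
    unfolding wt_conv_card high_def by (simp add: colhs_def less_colh_iff[OF assms] cong: conj_cong)
  also have "{j. j < f 0 \<and> j < f i} = {..<f i}"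
    using shape_antimono[OF assms, of 0 i] by auto
  finally show ?thesis by simp
qed

lemma cnt_lessThan: "cnt {..<c} v = min c v"
proof -
  have "{..<c} \<inter> {..<v} = {..<min c v}" by auto
  then show ?thesis by (simp add: cnt_def)
qed

lemma wt_eq_0: "\<forall>C\<in>set Ts. C \<subseteq> {..<n} \<Longrightarrow> n \<le> i \<Longrightarrow> wt Ts i = 0"
  by (induction Ts) auto

lemma drop_high: "drop k (high f) = map (\<lambda>j. {..<colh f j}) [k..<f 0]"
  by (simp add: high_def colhs_def drop_map)

text \<open>From the right, suppose the next column is \<open>{..<c}\<close>. The row condition puts
  \<open>{..<c}\<close> into the current column; rows from \<open>c\<close> on are still empty, so
  the decreasing condition forces the new entries to continue without gaps.\<close>

lemma lr_good_0_iff: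
  assumes f: "shape n f"
  shows "Ts \<in> coltab n (colhs f) \<and> lr_good n (\<lambda>_. 0) Ts \<longleftrightarrow> Ts = high f"
proof
  assume Ts: "Ts = high f"
  have "sorted_wrt colle (high f)"
    unfolding sorted_wrt_iff_nth_less
    using colh_antimono[OF f]
    by (auto simp: high_def colle_def cnt_lessThan colhs_def min_le_iff_disj)
  moreover have "map card (high f) = colhs f"
    by (simp add: high_def comp_def)
  moreover have "C \<subseteq> {..<n}" if "C \<in> set (high f)" for C
    using that colh_le[OF f] by (auto simp: high_def colhs_def intro: less_le_trans)
  moreover have "decr n (\<lambda>i. 0 + wt (drop k (high f)) i)" for k
  proof -
    have "wt (map (\<lambda>j. {..<colh f j}) js) (Suc i) \<le> wt (map (\<lambda>j. {..<colh f j}) js) i" for js i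
      by (induction js) auto
    then show ?thesis
      by (simp add: decr_def drop_high)
  qed
  ultimately show "Ts \<in> coltab n (colhs f) \<and> lr_good n (\<lambda>_. 0) Ts"
    by (auto simp: Ts coltab_def lr_good_def)
next
  have "Us = map (\<lambda>C. {..<card C}) Us"
    if "sorted_wrt colle Us" "\<forall>C\<in>set Us. C \<subseteq> {..<n}" "\<And>k. k \<le> length Us \<Longrightarrow> decr n (wt (drop k Us))"
    for Us
    using that
  proof (induction Us)
    case (Cons C Us)
    have "decr n (wt (drop k Us))" if "k \<le> length Us" for k
      using Cons.prems(3)[of "Suc k"] that by simp
    then have IH: "Us = map (\<lambda>C. {..<card C}) Us"
      using Cons by simp
    define c where "c = (case Us of [] \<Rightarrow> 0 | D # _ \<Rightarrow> card D)"
    have C: "C \<subseteq> {..<n}" "finite C"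
      using Cons.prems(2) finite_subset by auto
    have low: "{..<c} \<subseteq> C"
    proof (cases Us)
      case (Cons D Vs)
      then have "D = {..<c}"
        using IH by (auto simp: c_def)
      moreover have "colle C D"
        using Cons.prems(1) Cons by simp
      ultimately have "c \<le> cnt C c"
        unfolding colle_def by (metis cnt_lessThan min.idem)
      then have "C \<inter> {..<c} = {..<c}"
        unfolding cnt_def by (intro card_seteq) auto
      then show ?thesis by blast
    qed (simp add: c_def)
    have above: "wt Us i = 0" if "c \<le> i" for i
    proof (rule wt_eq_0[OF _ that], rule ballI)
      fix E assume E: "E \<in> set Us"
      then obtain D Vs where Us: "Us = D # Vs" by (cases Us) auto
      have "card E \<le> card D"
      proof (cases "E = D")
        case False
        then have "colle D E"
          using E Us Cons.prems(1) by auto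
        then have "cnt E n \<le> cnt D n" by (simp add: colle_def)
        moreover have "E \<subseteq> {..<n}" "D \<subseteq> {..<n}"
          using E Us Cons.prems(2) by auto
        ultimately show ?thesis
          by (simp add: cnt_eq_card)
      qed simp
      moreover have "E = {..<card E}"
        using IH E by (metis (no_types, lifting) card_lessThan imageE list.set_map)
      ultimately show "E \<subseteq> {..<c}"
        by (metis Us c_def lessThan_subset_iff list.simps(5))
    qed
    have "C = {..<card C}"
    proof (rule down_closed_eq_lessThan[OF C(2)])
      fix i assume i: "Suc i \<in> C"
      show "i \<in> C"
      proof (cases "i < c")
        case False
        have "wt (C # Us) (Suc i) \<le> wt (C # Us) i"
          using Cons.prems(3)[of 0] i C unfolding decr_def by auto
        then show ?thesis
          using i False above[of i] above[of "Suc i"] by (auto split: if_splits)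
      qed (use low in auto)
    qed
    with IH show ?case by simp
  qed simp
  then have *: "Us = map (\<lambda>C. {..<card C}) Us" if "Us \<in> coltab n (colhs f)" "lr_good n (\<lambda>_. 0) Us" for Us
    using that by (auto simp: coltab_def lr_good_def)
  assume "Ts \<in> coltab n (colhs f) \<and> lr_good n (\<lambda>_. 0) Ts"
  then have "Ts = map (\<lambda>C. {..<card C}) Ts" "map card Ts = colhs f"
    using *[of Ts] unfolding coltab_def by blast+
  moreover have "map (\<lambda>C. {..<card C}) Ts = map lessThan (map card Ts)"
    by simp
  ultimately show "Ts = high f"
    unfolding high_def by metis
qed

text \<open>Jacobi's bialternant formula: starting from the empty shape, only the highest-weight
  tableau survives the cancellation.\<close>

lemma alt_rho_mult_tabsum:
  assumes "shape n f"
  shows "alt n (rho n) * tabsum n (colhs f) = alt n (\<lambda>i. f i + rho n i)"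
proof -
  have "alt n (rho n) * tabsum n (colhs f) = (\<Sum>Ts\<in>coltab n (colhs f). alt n (\<lambda>i. 0 + rho n i + wt Ts i))"
    by (simp add: alt_mult_tabsum)
  also have "\<dots> = (\<Sum>Ts | Ts \<in> coltab n (colhs f) \<and> lr_good n (\<lambda>_. 0) Ts. alt n (\<lambda>i. 0 + rho n i + wt Ts i))"
    by (rule alt_sum_lr_good) (simp add: decr_def)
  also have "\<dots> = alt n (\<lambda>i. f i + rho n i)"
    unfolding lr_good_0_iff[OF assms] using wt_high[OF assms] by (simp add: add.commute)
  finally show ?thesis .
qed

lemma shape_add_wt:
  assumes "shape n f" "Ts \<in> coltab n cs" "lr_good n f Ts"
  shows "shape n (\<lambda>i. f i + wt Ts i)"
proof -
  have d: "decr n (\<lambda>i. f i + wt Ts i)"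
    using assms(3) unfolding lr_good_def by (metis drop0 le0)
  have z: "f i + wt Ts i = 0" if "n \<le> i" for i
    using assms(1,2) that wt_eq_0[of Ts n i] by (auto simp: shape_def coltab_def)
  have "f (Suc i) + wt Ts (Suc i) \<le> f i + wt Ts i" for i
    using d z[of "Suc i"] by (cases "Suc i < n") (auto simp: decr_def)
  with z show ?thesis
    unfolding shape_def by blast
qed

text \<open>After multiplication by the Vandermonde determinant both sides are the same sum of
  alternants, and that factor can be cancelled.\<close>

lemma tabsum_mult:
  assumes f: "shape n f" and g: "shape n g"
  shows "tabsum n (colhs f) * tabsum n (colhs g) =
    (\<Sum>Ts | Ts \<in> coltab n (colhs g) \<and> lr_good n f Ts. tabsum n (colhs (\<lambda>i. f i + wt Ts i)))"
proof (rule alt_rho_cancel)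
  have "alt n (rho n) * (tabsum n (colhs f) * tabsum n (colhs g)) =
      alt n (\<lambda>i. f i + rho n i) * tabsum n (colhs g)"
    by (simp add: mult.assoc[symmetric] alt_rho_mult_tabsum[OF f])
  also have "\<dots> = (\<Sum>Ts | Ts \<in> coltab n (colhs g) \<and> lr_good n f Ts. alt n (\<lambda>i. f i + rho n i + wt Ts i))"
    unfolding alt_mult_tabsum
    by (rule alt_sum_lr_good) (use f in \<open>simp add: decr_def shape_def\<close>)
  also have "\<dots> = (\<Sum>Ts | Ts \<in> coltab n (colhs g) \<and> lr_good n f Ts.
      alt n (rho n) * tabsum n (colhs (\<lambda>i. f i + wt Ts i)))"
    using f shape_add_wt by (intro sum.cong) (auto simp: alt_rho_mult_tabsum ac_simps)
  finally show "alt n (rho n) * (tabsum n (colhs f) * tabsum n (colhs g)) = alt n (rho n) *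
      (\<Sum>Ts | Ts \<in> coltab n (colhs g) \<and> lr_good n f Ts. tabsum n (colhs (\<lambda>i. f i + wt Ts i)))"
    by (simp add: sum_distrib_left)
qed auto

section \<open>Semistandard tableaux as column tableaux\<close>

definition cols_of :: "(nat \<Rightarrow> nat) \<Rightarrow> (nat \<times> nat \<Rightarrow> nat) \<Rightarrow> nat set list" where
  "cols_of f T = map (\<lambda>j. (\<lambda>i. T (i, j)) ` {..<colh f j}) [0..<f 0]"

text \<open>\<open>colh f 0\<close> counts the nonzero rows, so the list is the partition without
  trailing zeros.\<close>

definition sch :: "(nat \<Rightarrow> nat) \<Rightarrow> mpser" where
  "sch f = schur (map f [0..<colh f 0])"

lemma young_diagram_shape:
  assumes "shape n f"
  shows "young_diagram (map f [0..<colh f 0]) = {(i, j). j < f i}"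
proof -
  have "0 < f i" if "j < f i" for i j using that by simp
  then show ?thesis
    by (auto simp: young_diagram_def less_colh_iff[OF assms])
qed

lemma strict_mono_nat_upto:
  fixes t :: "nat \<Rightarrow> nat"
  assumes "\<And>i. Suc i < h \<Longrightarrow> t i < t (Suc i)" "i < j" "j < h"
  shows "t i < t j"
  using assms(2,3)
proof (induction j)
  case (Suc j)
  then show ?case
    using assms(1)[of j] by (cases "i = j") auto
qed simp

lemma inj_on_strict_upto:
  fixes t :: "nat \<Rightarrow> nat"
  assumes "\<And>i j. i < j \<Longrightarrow> j < h \<Longrightarrow> t i < t j"
  shows "inj_on t {..<h}"
proof (rule inj_onI, rule ccontr)
  fix x y assume *: "x \<in> {..<h}" "y \<in> {..<h}" "t x = t y" "x \<noteq> y"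
  then consider "x < y" | "y < x" by linarith
  then show False
    using assms[of x y] assms[of y x] * by cases auto
qed

lemma cnt_image:
  fixes t :: "nat \<Rightarrow> nat"
  assumes "\<And>i j. i < j \<Longrightarrow> j < h \<Longrightarrow> t i < t j"
  shows "cnt (t ` {..<h}) v = card {i. i < h \<and> t i < v}"
proof -
  have inj: "inj_on t {..<h}"
    by (rule inj_on_strict_upto) (rule assms)
  have "t ` {..<h} \<inter> {..<v} = t ` {i. i < h \<and> t i < v}"
    by auto
  then show ?thesis
    unfolding cnt_def using inj by (simp add: card_image inj_on_subset[of t "{..<h}"] subset_iff)
qed

text \<open>If \<open>t i\<close> exceeded \<open>s i\<close>, then \<open>s\<close> would have at
  least \<open>i + 1\<close> entries up to \<open>s i\<close>, but \<open>t\<close> at most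
  \<open>i\<close>. This identifies the counting condition \<open>colle\<close> with the usual
  comparison along rows.\<close>

lemma colle_image_iff:
  fixes t s :: "nat \<Rightarrow> nat"
  assumes t: "\<And>i j. i < j \<Longrightarrow> j < h \<Longrightarrow> t i < t j"
    and s: "\<And>i j. i < j \<Longrightarrow> j < h' \<Longrightarrow> s i < s j" and h: "h' \<le> h"
  shows "colle (t ` {..<h}) (s ` {..<h'}) \<longleftrightarrow> (\<forall>i<h'. t i \<le> s i)"
proof -
  have ct: "cnt (t ` {..<h}) v = card {i. i < h \<and> t i < v}" for v
    by (rule cnt_image) (rule t)
  have cs: "cnt (s ` {..<h'}) v = card {i. i < h' \<and> s i < v}" for v
    by (rule cnt_image) (rule s)
  show ?thesis
  proof
    assume le: "\<forall>i<h'. t i \<le> s i"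
    show "colle (t ` {..<h}) (s ` {..<h'})"
      unfolding colle_def ct cs
    proof
      fix v
      have "{i. i < h' \<and> s i < v} \<subseteq> {i. i < h \<and> t i < v}"
        using h le less_le_trans[of _ h' h] by (auto intro: le_less_trans)
      then show "card {i. i < h' \<and> s i < v} \<le> card {i. i < h \<and> t i < v}"
        by (intro card_mono) auto
    qed
  next
    assume c: "colle (t ` {..<h}) (s ` {..<h'})"
    show "\<forall>i<h'. t i \<le> s i"
    proof (intro allI impI, rule ccontr)
      fix i assume i: "i < h'" and n: "\<not> t i \<le> s i"
      have "Suc i = card {..i}" by simp
      also have "\<dots> \<le> card {l. l < h' \<and> s l < Suc (s i)}"
      proof (rule card_mono)
        show "{..i} \<subseteq> {l. l < h' \<and> s l < Suc (s i)}"
          using i s[of _ i] by (force simp: le_less)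
      qed simp
      also have "\<dots> \<le> card {l. l < h \<and> t l < Suc (s i)}"
        using c by (simp only: colle_def ct cs)
      also have "\<dots> \<le> card {..<i}"
      proof (rule card_mono)
        show "{l. l < h \<and> t l < Suc (s i)} \<subseteq> {..<i}"
        proof clarsimp
          fix l assume l: "l < h" "t l < Suc (s i)"
          show "l < i"
          proof (rule ccontr)
            assume "\<not> l < i"
            then have "t i \<le> t l"
              using t[of i l] l by (cases "l = i") auto
            with l n show False by simp
          qed
        qed
      qed simp
      finally show False by simp
    qed
  qed
qed

context
  fixes n f
  assumes f: "shape n f"
begin

lemma in_ssyt_iff:
  "T \<in> ssyt (map f [0..<colh f 0]) \<longleftrightarrow> T \<in> extensional {(i, j). j < f i} \<and>
    (\<forall>j i i'. i < i' \<and> i' < colh f j \<longrightarrow> T (i, j) < T (i', j)) \<and>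
    (\<forall>j i. i < colh f (Suc j) \<longrightarrow> T (i, j) \<le> T (i, Suc j))"
proof -
  have "(\<forall>j i i'. i < i' \<and> i' < colh f j \<longrightarrow> T (i, j) < T (i', j)) \<longleftrightarrow>
      (\<forall>i j. j < f i \<and> j < f (Suc i) \<longrightarrow> T (i, j) < T (Suc i, j))"
  proof (intro iffI allI impI; (elim conjE)?)
    fix j i i' assume *: "\<forall>i j. j < f i \<and> j < f (Suc i) \<longrightarrow> T (i, j) < T (Suc i, j)" "i < i'" "i' < colh f j"
    show "T (i, j) < T (i', j)"
    proof (rule strict_mono_nat_upto[of "colh f j" "\<lambda>i. T (i, j)"])
      fix l assume "Suc l < colh f j"
      moreover from this have "l < colh f j" by simp
      ultimately show "T (l, j) < T (Suc l, j)"
        using *(1) unfolding less_colh_iff[OF f] by blast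
    qed (use * in auto)
  qed (auto simp: less_colh_iff[OF f])
  moreover have "j < f i" if "Suc j < f i" for i j using that by simp
  ultimately show ?thesis
    unfolding ssyt_def young_diagram_shape[OF f] PiE_UNIV_domain
    by (auto simp: PiE_def less_colh_iff[OF f])
qed

lemma wt_cols_of:
  assumes T: "T \<in> ssyt (map f [0..<colh f 0])"
  shows "wt (cols_of f T) k = card {c \<in> young_diagram (map f [0..<colh f 0]). T c = k}"
proof -
  have "wt (cols_of f T) k = card {j. j < f 0 \<and> (\<exists>i<colh f j. T (i, j) = k)}"
    unfolding wt_conv_card by (intro arg_cong[of _ _ card]) (auto simp: cols_of_def)
  also have "{j. j < f 0 \<and> (\<exists>i<colh f j. T (i, j) = k)} = snd ` {c. case c of (i, j) \<Rightarrow> j < f i \<and> T (i, j) = k}"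
  proof (intro equalityI subsetI)
    fix j assume "j \<in> {j. j < f 0 \<and> (\<exists>i<colh f j. T (i, j) = k)}"
    then obtain i where "i < colh f j" "T (i, j) = k" by auto
    then show "j \<in> snd ` {c. case c of (i, j) \<Rightarrow> j < f i \<and> T (i, j) = k}"
      by (intro image_eqI[of _ _ "(i, j)"]) (auto simp: less_colh_iff[OF f])
  next
    fix j assume "j \<in> snd ` {c. case c of (i, j) \<Rightarrow> j < f i \<and> T (i, j) = k}"
    then obtain i where "j < f i" "T (i, j) = k" by auto
    then show "j \<in> {j. j < f 0 \<and> (\<exists>i<colh f j. T (i, j) = k)}"
      using shape_antimono[OF f, of 0 i] by (auto simp: less_colh_iff[OF f])
  qed
  also have "card \<dots> = card {c. case c of (i, j) \<Rightarrow> j < f i \<and> T (i, j) = k}"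
  proof (rule card_image, rule inj_onI, clarsimp)
    fix i i' j assume "j < f i" "j < f i'" "T (i', j) = T (i, j)" "k = T (i, j)"
    then show "i = i'"
      using T[unfolded in_ssyt_iff] unfolding less_colh_iff[OF f]
      by (metis linorder_neqE_nat nat_neq_iff)
  qed
  also have "{c. case c of (i, j) \<Rightarrow> j < f i \<and> T (i, j) = k} =
      {c \<in> young_diagram (map f [0..<colh f 0]). T c = k}"
    by (auto simp: young_diagram_shape[OF f])
  finally show ?thesis .
qed

lemma bij_betw_cols_of:
  "bij_betw (cols_of f) (ssyt (map f [0..<colh f 0]))
    {Ts. map card Ts = colhs f \<and> (\<forall>C\<in>set Ts. finite C) \<and> sorted_wrt colle Ts}"
    (is "bij_betw _ ?S ?C")
proof -
  have inj: "inj_on (cols_of f) ?S"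
  proof (rule inj_onI)
    fix T T' assume T: "T \<in> ?S" "T' \<in> ?S" and eq: "cols_of f T = cols_of f T'"
    have "T (i, j) = T' (i, j)" if "j < f i" for i j
    proof -
      have "j < f 0"
        using that shape_antimono[OF f, of 0 i] by simp
      then have im: "(\<lambda>i. T (i, j)) ` {..<colh f j} = (\<lambda>i. T' (i, j)) ` {..<colh f j}"
        using arg_cong[OF eq, of "\<lambda>Ts. Ts ! j"] by (simp add: cols_of_def)
      have mono: "\<And>i i'. i < i' \<Longrightarrow> i' < colh f j \<Longrightarrow> T (i, j) < T (i', j)"
        "\<And>i i'. i < i' \<Longrightarrow> i' < colh f j \<Longrightarrow> T' (i, j) < T' (i', j)"
        using T unfolding in_ssyt_iff by blast+
      \<comment> \<open>Equal columns satisfy \<open>colle\<close> in both directions, which gives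
        both inequalities.\<close>
      have "\<forall>i<colh f j. T (i, j) \<le> T' (i, j)" "\<forall>i<colh f j. T' (i, j) \<le> T (i, j)"
        using colle_image_iff[of "colh f j" "\<lambda>i. T (i, j)" "colh f j" "\<lambda>i. T' (i, j)"]
          colle_image_iff[of "colh f j" "\<lambda>i. T' (i, j)" "colh f j" "\<lambda>i. T (i, j)"] mono
        unfolding im by (simp_all add: colle_def)
      then show ?thesis
        using that by (simp add: less_colh_iff[OF f] le_antisym)
    qed
    then show "T = T'"
      using T unfolding in_ssyt_iff by (intro extensionalityI[of _ "{(i, j). j < f i}"]) auto
  qed
  have into: "cols_of f T \<in> ?C" if T: "T \<in> ?S" for T
  proof -
    have mono: "\<And>j i i'. i < i' \<Longrightarrow> i' < colh f j \<Longrightarrow> T (i, j) < T (i', j)"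
      using T unfolding in_ssyt_iff by blast
    have "card ((\<lambda>i. T (i, j)) ` {..<colh f j}) = colh f j" for j
    proof -
      have "inj_on (\<lambda>i. T (i, j)) {..<colh f j}"
        by (rule inj_on_strict_upto) (rule mono)
      then show ?thesis
        by (simp add: card_image)
    qed
    then have "map card (cols_of f T) = colhs f"
      by (simp add: cols_of_def colhs_def comp_def)
    moreover have "sorted_wrt colle (cols_of f T)"
      unfolding sorted_wrt_iff_nth_Suc_transp[OF transp_colle]
    proof (intro allI impI)
      fix j assume "Suc j < length (cols_of f T)"
      then have j: "j < f 0" "Suc j < f 0"
        by (auto simp: cols_of_def)
      have "colle ((\<lambda>i. T (i, j)) ` {..<colh f j}) ((\<lambda>i. T (i, Suc j)) ` {..<colh f (Suc j)})"
        using T mono colh_antimono[OF f, of j "Suc j"] unfolding in_ssyt_iff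
        by (subst colle_image_iff) auto
      then show "colle (cols_of f T ! j) (cols_of f T ! Suc j)"
        using j by (simp add: cols_of_def del: upt_Suc)
    qed
    ultimately show ?thesis
      by (auto simp: cols_of_def)
  qed
  have onto: "Ts \<in> cols_of f ` ?S" if Ts: "Ts \<in> ?C" for Ts
  proof
    define t where "t j i = sorted_list_of_set (Ts ! j) ! i" for j i
    define T where "T = (\<lambda>c. if snd c < f (fst c) then t (snd c) (fst c) else undefined)"
    have len: "length Ts = f 0"
      using Ts by (metis (mono_tags, lifting) length_colhs length_map mem_Collect_eq)
    have fin: "finite (Ts ! j)" if "j < f 0" for j
      using Ts that len by auto
    have card: "card (Ts ! j) = colh f j" if "j < f 0" for j
    proof -
      have "map card Ts ! j = colhs f ! j"
        using Ts by simp
      then show ?thesis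
        using that len by (simp add: colhs_def)
    qed
    have mono: "t j i < t j i'" if "i < i'" "i' < colh f j" "j < f 0" for i i' j
      using that fin[of j] card[of j] strict_sorted_list_of_set[of "Ts ! j"]
      unfolding t_def sorted_wrt_iff_nth_less by simp
    have im: "t j ` {..<colh f j} = Ts ! j" if "j < f 0" for j
    proof -
      have "t j ` {..<colh f j} = set (sorted_list_of_set (Ts ! j))"
        using card[OF that] by (auto simp: t_def set_conv_nth)
      then show ?thesis
        using fin[OF that] by simp
    qed
    have T: "T (i, j) = t j i" if "i < colh f j" for i j
      using that by (simp add: T_def less_colh_iff[OF f])
    have j0: "j < f 0" if "i < colh f j" for i j
      using that shape_antimono[OF f, of 0 i] by (simp add: less_colh_iff[OF f])
    show "T \<in> ?S"
      unfolding in_ssyt_iff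
    proof (intro conjI allI impI; (elim conjE)?)
      show "T \<in> extensional {(i, j). j < f i}"
        by (auto simp: T_def extensional_def)
      show "T (i, j) < T (i', j)" if "i < i'" "i' < colh f j" for i i' j
        using mono[OF that j0[OF that(2)]] T[OF that(2)] T[of i j] that by simp
      show "T (i, j) \<le> T (i, Suc j)" if i: "i < colh f (Suc j)" for i j
      proof -
        have S: "Suc j < f 0" using j0[OF i] .
        then have j: "j < f 0" by simp
        have h: "colh f (Suc j) \<le> colh f j"
          using colh_antimono[OF f] by simp
        have "colle (Ts ! j) (Ts ! Suc j)"
          using Ts S len by (auto simp: sorted_wrt_iff_nth_less)
        then have "\<forall>i<colh f (Suc j). t j i \<le> t (Suc j) i"
          using colle_image_iff[of "colh f j" "t j" "colh f (Suc j)" "t (Suc j)"] mono S j h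
          by (simp add: im)
        then show ?thesis
          using i h T[OF i] T[of i j] by simp
      qed
    qed
    show "Ts = cols_of f T"
    proof (rule nth_equalityI)
      fix j assume "j < length Ts"
      then have j: "j < f 0" by (simp add: len)
      have "(\<lambda>i. T (i, j)) ` {..<colh f j} = t j ` {..<colh f j}"
        by (intro image_cong) (auto simp: T)
      then show "Ts ! j = cols_of f T ! j"
        using j im[OF j] by (simp add: cols_of_def)
    qed (simp add: len cols_of_def)
  qed
  have "cols_of f ` ?S = ?C"
    using into onto by blast
  with inj show ?thesis
    by (rule bij_betw_imageI)
qed

lemma mpcoeff_tabsum:
  assumes "keys \<alpha> \<subseteq> {..<m}"
  shows "mpcoeff (tabsum m cs) \<alpha> = int (card {Ts \<in> coltab m cs. wt Ts = lookup \<alpha>})"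
proof -
  have "expv m (wt Ts) = \<alpha> \<longleftrightarrow> wt Ts = lookup \<alpha>" if "Ts \<in> coltab m cs" for Ts
  proof
    assume *: "expv m (wt Ts) = \<alpha>"
    show "wt Ts = lookup \<alpha>"
    proof
      fix i
      show "wt Ts i = lookup \<alpha> i"
        unfolding *[symmetric] using wt_eq_0[of Ts m i] that by (auto simp: coltab_def)
    qed
  qed (simp add: expv_lookup assms)
  then have "mpcoeff (tabsum m cs) \<alpha> = (\<Sum>Ts\<in>coltab m cs. if wt Ts = lookup \<alpha> then 1 else 0)"
    unfolding tabsum_def mpcoeff_sum by (intro sum.cong) auto
  also have "\<dots> = (\<Sum>Ts\<in>{Ts \<in> coltab m cs. wt Ts = lookup \<alpha>}. 1)"
    by (intro sum.mono_neutral_cong_right) (auto simp: finite_coltab)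
  finally show ?thesis by simp
qed

lemma mpcoeff_sch:
  assumes "keys \<alpha> \<subseteq> {..<m}"
  shows "mpcoeff (sch f) \<alpha> = mpcoeff (tabsum m (colhs f)) \<alpha>"
proof -
  let ?\<mu> = "map f [0..<colh f 0]"
  let ?C = "{Ts. map card Ts = colhs f \<and> (\<forall>C\<in>set Ts. finite C) \<and> sorted_wrt colle Ts}"
  let ?A = "{T \<in> ssyt ?\<mu>. \<forall>k. card {c \<in> young_diagram ?\<mu>. T c = k} = lookup \<alpha> k}"
  have inj: "inj_on (cols_of f) (ssyt ?\<mu>)" and im: "cols_of f ` ssyt ?\<mu> = ?C"
    using bij_betw_cols_of by (auto simp: bij_betw_def)
  have "?A = {T \<in> ssyt ?\<mu>. wt (cols_of f T) = lookup \<alpha>}"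
    by (auto simp: fun_eq_iff wt_cols_of)
  then have "cols_of f ` ?A = {Ts \<in> cols_of f ` ssyt ?\<mu>. wt Ts = lookup \<alpha>}"
    by auto
  also have "\<dots> = {Ts \<in> coltab m (colhs f). wt Ts = lookup \<alpha>}"
  proof -
    have "C \<subseteq> {..<m}" if "C \<in> set Ts" "wt Ts = lookup \<alpha>" for C Ts
    proof
      fix i assume "i \<in> C"
      then have "wt Ts i \<noteq> 0"
        using that(1) by (auto simp: wt_def filter_empty_conv)
      then have "i \<in> keys \<alpha>"
        by (simp add: that(2) in_keys_iff)
      with assms show "i \<in> {..<m}" ..
    qed
    then show ?thesis
      unfolding im coltab_def by (auto intro: finite_subset)
  qed
  finally have "card ?A = card {Ts \<in> coltab m (colhs f). wt Ts = lookup \<alpha>}"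
    using card_image[OF inj_on_subset[OF inj], of ?A] by auto
  then show ?thesis
    unfolding mpcoeff_tabsum[OF assms] sch_def schur_def by simp
qed

end

section \<open>Schur functions\<close>

lemma trunc_sch:
  assumes "shape k f"
  shows "trunc n (sch f) = tabsum n (colhs f)"
proof (rule mpser_eqI)
  fix \<alpha>
  show "mpcoeff (trunc n (sch f)) \<alpha> = mpcoeff (tabsum n (colhs f)) \<alpha>"
  proof (cases "keys \<alpha> \<subseteq> {..<n}")
    case False
    then have "\<alpha> \<noteq> expv n a" for a
      using keys_expv by blast
    then show ?thesis
      using False by (simp add: tabsum_def)
  qed (simp add: mpcoeff_sch[OF assms])
qed

lemma mdegree_eq_sum: "keys \<alpha> \<subseteq> {..<n} \<Longrightarrow> mdegree \<alpha> = (\<Sum>i<n. lookup \<alpha> i)"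
  unfolding mdegree_def by (rule sum.mono_neutral_left) (auto simp: in_keys_iff)

lemma sum_wt: "\<forall>C\<in>set Ts. C \<subseteq> {..<m} \<Longrightarrow> (\<Sum>i<m. wt Ts i) = sum_list (map card Ts)"
proof (induction Ts)
  case (Cons C Ts)
  then have "(\<Sum>i<m. if i \<in> C then 1 else 0) = card C"
    by (simp add: sum.If_cases Int_absorb1)
  with Cons show ?case by (simp add: sum.distrib)
qed simp

lemma sum_shape:
  assumes "shape n f" "n \<le> m"
  shows "(\<Sum>i<m. f i) = (\<Sum>i<n. f i)" "(\<Sum>i<m. f i) = sum_list (colhs f)"
proof -
  show "(\<Sum>i<m. f i) = (\<Sum>i<n. f i)"
    using assms by (intro sum.mono_neutral_right) (auto simp: shape_def)
  have f: "shape m f"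
    using assms shape_mono by blast
  have "high f \<in> coltab m (colhs f)"
    using lr_good_0_iff[OF f] by blast
  then have "(\<Sum>i<m. wt (high f) i) = sum_list (colhs f)"
    by (simp add: coltab_def sum_wt)
  then show "(\<Sum>i<m. f i) = sum_list (colhs f)"
    by (simp add: wt_high[OF f])
qed

lemma sch_coeff_tab:
  assumes "shape n f" "mpcoeff (sch f) \<alpha> \<noteq> 0" "keys \<alpha> \<subseteq> {..<m}"
  obtains Ts where "Ts \<in> coltab m (colhs f)" "wt Ts = lookup \<alpha>"
proof -
  have "card {Ts \<in> coltab m (colhs f). wt Ts = lookup \<alpha>} \<noteq> 0"
    using assms(2) by (simp add: mpcoeff_sch[OF assms(1,3)] mpcoeff_tabsum[OF assms(1,3)])
  then have "{Ts \<in> coltab m (colhs f). wt Ts = lookup \<alpha>} \<noteq> {}"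
    by (metis card.empty)
  then show thesis
    using that by blast
qed

lemma keys_bounded: "\<exists>m\<ge>n. keys (\<alpha> :: nat \<Rightarrow>\<^sub>0 nat) \<subseteq> {..<m}"
proof -
  obtain m where "keys \<alpha> \<subseteq> {..<m}"
    using finite_nat_iff_bounded[of "keys \<alpha>"] by auto
  then have "keys \<alpha> \<subseteq> {..<max m n}"
    by auto
  then show ?thesis
    using max.cobounded2 by blast
qed

lemma sch_degree:
  assumes f: "shape n f" and nz: "mpcoeff (sch f) \<alpha> \<noteq> 0"
  shows "mdegree \<alpha> = (\<Sum>i<n. f i)"
proof -
  obtain m where m: "keys \<alpha> \<subseteq> {..<m}" "n \<le> m"
    using keys_bounded[of n \<alpha>] by blast
  obtain Ts where Ts: "Ts \<in> coltab m (colhs f)" "wt Ts = lookup \<alpha>"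
    using sch_coeff_tab[OF f nz m(1)] .
  then have "mdegree \<alpha> = sum_list (colhs f)"
    using sum_wt[of Ts m] by (simp add: mdegree_eq_sum[OF m(1)] coltab_def)
  then show ?thesis
    using sum_shape[OF f m(2)] by simp
qed

lemma sch_in_Lambda_Z:
  assumes f: "shape n f"
  shows "sch f \<in> Lambda_Z"
  unfolding Lambda_Z_iff
proof (intro conjI allI impI)
  show "\<exists>d. \<forall>\<alpha>. mpcoeff (sch f) \<alpha> \<noteq> 0 \<longrightarrow> mdegree \<alpha> \<le> d"
    using sch_degree[OF f] by (intro exI[of _ "\<Sum>i<n. f i"]) auto
next
  fix \<alpha> \<beta> :: "nat \<Rightarrow>\<^sub>0 nat"
  assume eq: "expm \<alpha> = expm \<beta>"
  obtain m where m: "keys \<alpha> \<subseteq> {..<m}" using keys_bounded[of 0 \<alpha>] by blast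
  obtain m' where m': "keys \<beta> \<subseteq> {..<m'}" "m \<le> m'" using keys_bounded[of m \<beta>] by blast
  then have k: "keys \<alpha> \<subseteq> {..<m'}" using m by auto
  obtain p where p: "p permutes {..<m'}" and lk: "\<And>i. lookup \<beta> i = lookup \<alpha> (p i)"
    using expm_eq_imp_permutes[OF eq _ k m'(1)] by blast
  \<comment> \<open>With this indicator the permutation-invariant sum counts the tableaux of a
    prescribed content.\<close>
  let ?F = "\<lambda>w. if w = lookup \<beta> then 1 else 0 :: int"
  have "w \<circ> p = lookup \<beta> \<longleftrightarrow> w = lookup \<alpha>" for w
  proof
    assume "w \<circ> p = lookup \<beta>"
    then have "w (p i) = lookup \<alpha> (p i)" for i
      using lk by (metis comp_apply)
    then show "w = lookup \<alpha>"
      using permutes_surj[OF p] by (metis ext surjD)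
  qed (simp add: fun_eq_iff lk)
  then have "(\<Sum>Ts\<in>coltab m' (colhs f). ?F (wt Ts)) =
      (\<Sum>Ts\<in>coltab m' (colhs f). if wt Ts = lookup \<alpha> then 1 else 0)"
    using sum_coltab_permute[OF p, of ?F "colhs f"] by simp
  then have "int (card {Ts \<in> coltab m' (colhs f). wt Ts = lookup \<beta>}) =
      int (card {Ts \<in> coltab m' (colhs f). wt Ts = lookup \<alpha>})"
    by (simp add: sum.If_cases finite_coltab Collect_conj_eq)
  then show "mpcoeff (sch f) \<alpha> = mpcoeff (sch f) \<beta>"
    by (simp add: mpcoeff_sch[OF f k] mpcoeff_sch[OF f m'(1)] mpcoeff_tabsum[OF f k] mpcoeff_tabsum[OF f m'(1)])
qed

text \<open>The bound makes \<open>n\<close> at least the degree of both sides, so the identity in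
  \<open>n\<close> variables lifts to symmetric functions.\<close>

lemma sch_mult:
  assumes f: "shape n f" and g: "shape n g" and n: "(\<Sum>i<n. f i) + (\<Sum>i<n. g i) \<le> n"
  shows "sch f * sch g = (\<Sum>Ts | Ts \<in> coltab n (colhs g) \<and> lr_good n f Ts. sch (\<lambda>i. f i + wt Ts i))"
proof (rule symmetric_eq_if_trunc_eq)
  have sh: "shape n (\<lambda>i. f i + wt Ts i)" and deg: "(\<Sum>i<n. f i + wt Ts i) \<le> n"
    if "Ts \<in> coltab n (colhs g)" "lr_good n f Ts" for Ts
  proof -
    have "(\<Sum>i<n. wt Ts i) = (\<Sum>i<n. g i)"
      using that(1) sum_wt[of Ts n] sum_shape(2)[OF g order_refl] by (simp add: coltab_def)
    then show "(\<Sum>i<n. f i + wt Ts i) \<le> n"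
      using n by (simp add: sum.distrib)
  qed (use shape_add_wt[OF f] that in blast)
  show "sch f * sch g \<in> Lambda_Z"
    using sch_in_Lambda_Z f g by blast
  show "(\<Sum>Ts | Ts \<in> coltab n (colhs g) \<and> lr_good n f Ts. sch (\<lambda>i. f i + wt Ts i)) \<in> Lambda_Z"
    using sch_in_Lambda_Z sh by (intro Lambda_Z_sum) blast
  show "trunc n (sch f * sch g) =
      trunc n (\<Sum>Ts | Ts \<in> coltab n (colhs g) \<and> lr_good n f Ts. sch (\<lambda>i. f i + wt Ts i))"
    by (auto simp: trunc_sch[OF f] trunc_sch[OF g] tabsum_mult[OF f g] trunc_sch[OF sh] intro!: sum.cong)
  show "mdegree \<alpha> \<le> n" if nz: "mpcoeff (sch f * sch g) \<alpha> \<noteq> 0" for \<alpha>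
  proof -
    obtain p where p: "p \<in> {(\<beta>, \<gamma>). \<beta> + \<gamma> = \<alpha>}"
      "(case p of (\<beta>, \<gamma>) \<Rightarrow> mpcoeff (sch f) \<beta> * mpcoeff (sch g) \<gamma>) \<noteq> 0"
      using nz unfolding mpcoeff_mult by (meson sum.neutral)
    then show ?thesis
      using n sch_degree[OF f] sch_degree[OF g] by (auto simp: mdegree_add)
  qed
  show "mdegree \<alpha> \<le> n"
    if nz: "mpcoeff (\<Sum>Ts | Ts \<in> coltab n (colhs g) \<and> lr_good n f Ts. sch (\<lambda>i. f i + wt Ts i)) \<alpha> \<noteq> 0" for \<alpha>
  proof -
    obtain Ts where "Ts \<in> coltab n (colhs g)" "lr_good n f Ts" "mpcoeff (sch (\<lambda>i. f i + wt Ts i)) \<alpha> \<noteq> 0"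
      using nz unfolding mpcoeff_sum by (metis (mono_tags, lifting) mem_Collect_eq sum.neutral)
    then show ?thesis
      using sch_degree sh deg by metis
  qed
qed

section \<open>Partitions as shapes and the semiring of Schur-positive functions\<close>

definition of_part :: "nat list \<Rightarrow> nat \<Rightarrow> nat" where
  "of_part \<mu> i = (if i < length \<mu> then \<mu> ! i else 0)"

lemma shape_of_part:
  assumes "is_partition \<mu>"
  shows "shape (length \<mu>) (of_part \<mu>)"
  using assms by (auto simp: is_partition_def shape_def of_part_def sorted_wrt_iff_nth_less)

lemma schur_eq_sch:
  assumes "is_partition \<mu>"
  shows "schur \<mu> = sch (of_part \<mu>)"
proof -
  have "\<mu> ! i \<noteq> 0" if "i < length \<mu>" for i
    using assms that unfolding is_partition_def by (metis nth_mem)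
  then have "{i. 0 < of_part \<mu> i} = {..<length \<mu>}"
    by (auto simp: of_part_def split: if_splits)
  then have "map (of_part \<mu>) [0..<colh (of_part \<mu>) 0] = \<mu>"
    by (intro nth_equalityI) (auto simp: colh_def of_part_def)
  then show ?thesis
    by (simp add: sch_def)
qed

lemma sch_eq_schur:
  assumes "shape n f"
  shows "\<exists>\<mu>. is_partition \<mu> \<and> sch f = schur \<mu>"
proof (intro exI conjI)
  show "is_partition (map f [0..<colh f 0])"
    unfolding is_partition_def
  proof
    show "sorted_wrt (\<ge>) (map f [0..<colh f 0])"
      using shape_antimono[OF assms] by (auto simp: sorted_wrt_iff_nth_less)
    show "0 \<notin> set (map f [0..<colh f 0])"
    proof
      assume "0 \<in> set (map f [0..<colh f 0])"
      then obtain i where "i < colh f 0" "f i = 0"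
        by auto
      with less_colh_iff[OF assms, of i 0] show False by simp
    qed
  qed
qed (simp add: sch_def)

lemma schur_basis_eq: "schur ` {\<mu>. is_partition \<mu>} = {sch f | f n. shape n f}"
proof (intro equalityI subsetI)
  fix b assume "b \<in> schur ` {\<mu>. is_partition \<mu>}"
  then show "b \<in> {sch f | f n. shape n f}"
    using schur_eq_sch shape_of_part by blast
next
  fix b assume "b \<in> {sch f | f n. shape n f}"
  then obtain f n where "b = sch f" "shape n f" by blast
  then show "b \<in> schur ` {\<mu>. is_partition \<mu>}"
    using sch_eq_schur by blast
qed

lemma sch_in_Lambda_Sch: "shape n f \<Longrightarrow> sch f \<in> Lambda_Sch"
  unfolding Lambda_Sch_def schur_basis_eq by (rule subsetD[OF nat_span_superset]) blast

lemma sch_0: "sch (\<lambda>_. 0) = 1"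
proof (rule mpser_eqI)
  fix \<alpha> :: "nat \<Rightarrow>\<^sub>0 nat"
  have "shape 0 (\<lambda>_. 0)" by (simp add: shape_def)
  obtain m where m: "keys \<alpha> \<subseteq> {..<m}" using keys_bounded[of 0 \<alpha>] by blast
  have "colhs (\<lambda>_. 0) = []" by (simp add: colhs_def)
  moreover have "coltab m [] = {[]}" by (auto simp: coltab_def)
  moreover have "wt [] = lookup \<alpha> \<longleftrightarrow> \<alpha> = 0"
    by (auto simp: fun_eq_iff poly_mapping_eq_iff)
  ultimately show "mpcoeff (sch (\<lambda>_. 0)) \<alpha> = mpcoeff 1 \<alpha>"
    using mpcoeff_sch[OF \<open>shape 0 _\<close> m] mpcoeff_tabsum[OF \<open>shape 0 _\<close> m, of "[]"]
    by (simp add: Collect_conv_if cong: conj_cong)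
qed

lemma Lambda_Sch_mult:
  assumes "a \<in> Lambda_Sch" "b \<in> Lambda_Sch"
  shows "a * b \<in> Lambda_Sch"
proof -
  have *: "sch f * sch g \<in> Lambda_Sch" if fg: "shape k f" "shape l g" for f g k l
  proof -
    \<comment> \<open>Large enough both for the rows of the two shapes and for their total
      size.\<close>
    define n where "n = k + l + (\<Sum>i<k. f i) + (\<Sum>i<l. g i)"
    have sh: "shape n f" "shape n g"
      using fg by (auto simp: n_def intro: shape_mono)
    have "(\<Sum>i<n. f i) + (\<Sum>i<n. g i) \<le> n"
      using sum_shape(1)[OF fg(1), of n] sum_shape(1)[OF fg(2), of n] by (simp add: n_def)
    then show ?thesis
      unfolding sch_mult[OF sh \<open>_ \<le> n\<close>] Lambda_Sch_def
      by (intro nat_span_sum sch_in_Lambda_Sch[unfolded Lambda_Sch_def, of n] shape_add_wt[OF sh(1)]) auto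
  qed
  have 1: "a * sch g \<in> Lambda_Sch" if "a \<in> Lambda_Sch" "shape l g" for a g l
    using that(1) unfolding Lambda_Sch_def schur_basis_eq
  proof (induction rule: nat_span_induct)
    case (base b)
    then show ?case
      using * that(2) unfolding Lambda_Sch_def schur_basis_eq by auto
  qed (auto simp: distrib_right nat_span_add)
  show ?thesis
    using assms(2) unfolding Lambda_Sch_def schur_basis_eq
  proof (induction rule: nat_span_induct)
    case (base b)
    then show ?case
      using 1 assms(1) unfolding Lambda_Sch_def schur_basis_eq by auto
  qed (auto simp: distrib_left nat_span_add)
qed

lemma is_subsemiring_Lambda_Sch: "is_subsemiring Lambda_Sch"
  unfolding is_subsemiring_def
proof (intro conjI ballI)
  show "0 \<in> Lambda_Sch" by (simp add: Lambda_Sch_def)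
  have "shape 0 (\<lambda>_. 0)" by (simp add: shape_def)
  then show "1 \<in> Lambda_Sch"
    using sch_in_Lambda_Sch sch_0 by metis
  show "a + b \<in> Lambda_Sch" "a * b \<in> Lambda_Sch" if "a \<in> Lambda_Sch" "b \<in> Lambda_Sch" for a b
    using that nat_span_add Lambda_Sch_mult unfolding Lambda_Sch_def by blast+
qed

lemma Lambda_Sch_subset_Lambda_N: "Lambda_Sch \<subseteq> Lambda_N"
proof
  fix a assume "a \<in> Lambda_Sch"
  then show "a \<in> Lambda_N"
    unfolding Lambda_Sch_def
  proof (induction rule: nat_span_induct)
    case 0
    then show ?case by (simp add: Lambda_N_iff)
  next
    case (base b)
    then obtain \<mu> where \<mu>: "is_partition \<mu>" "b = schur \<mu>" by blast
    then have "b \<in> Lambda_Z"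
      using schur_eq_sch sch_in_Lambda_Z[OF shape_of_part] by simp
    with \<mu> show ?case
      by (simp add: Lambda_N_iff schur_def)
  next
    case (add f g)
    then show ?case
      by (simp add: Lambda_N_iff)
  qed
qed

definition row_shape :: "nat \<Rightarrow> nat \<Rightarrow> nat" where
  "row_shape m i = (if i = 0 then m else 0)"

lemma shape_row: "shape 1 (row_shape m)" "1 \<le> n \<Longrightarrow> shape n (row_shape m)"
  by (auto simp: shape_def row_shape_def)

text \<open>A tableau with one box is the choice of a row to lengthen. The strict bound leaves room
  for the added box.\<close>

lemma sch_mult_box:
  assumes f: "shape n f" and n: "(\<Sum>i<n. f i) < n"
  shows "sch f * sch (row_shape 1) = (\<Sum>i | i < n \<and> decr n (f(i := Suc (f i))). sch (f(i := Suc (f i))))"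
proof -
  let ?g = "row_shape 1"
  have g: "shape n ?g"
    using n by (intro shape_row) simp
  have "(\<Sum>i<n. ?g i) = 1"
    using sum_shape(1)[OF shape_row(1), of n 1] n by (simp add: row_shape_def)
  then have le: "(\<Sum>i<n. f i) + (\<Sum>i<n. ?g i) \<le> n"
    using n by simp
  have "colhs ?g = [1]"
    by (simp add: colhs_def colh_def row_shape_def)
  moreover have "coltab n [1] = (\<lambda>i. [{i}]) ` {..<n}"
    by (auto simp: coltab_def card_Suc_eq Cons_eq_map_conv map_eq_Cons_conv)
  moreover have add: "(\<lambda>l. f l + wt [{i}] l) = f(i := Suc (f i))" for i
    by auto
  moreover have "lr_good n f [{i}] \<longleftrightarrow> decr n (f(i := Suc (f i)))" for i
  proof -
    have "decr n f"
      using f by (auto simp: decr_def shape_def)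
    moreover have "j \<le> length [{i}] \<longleftrightarrow> j = 0 \<or> j = 1" for j by auto
    ultimately show ?thesis
      unfolding lr_good_def using add[of i] by auto
  qed
  ultimately have eq: "{Ts \<in> coltab n (colhs ?g). lr_good n f Ts} =
      (\<lambda>i. [{i}]) ` {i. i < n \<and> decr n (f(i := Suc (f i)))}"
    by auto
  have "sch f * sch ?g = (\<Sum>i | i < n \<and> decr n (f(i := Suc (f i))). sch (\<lambda>l. f l + wt [{i}] l))"
    unfolding sch_mult[OF f g le] eq by (subst sum.reindex) (auto simp: inj_on_def comp_def)
  then show ?thesis
    unfolding add .
qed

section \<open>The Jacobi--Trudi identity\<close>

definition geom :: "nat \<Rightarrow> mpser fps" where
  "geom i = Abs_fps (\<lambda>m. var_ser i ^ m)"

definition comp_gf :: "nat \<Rightarrow> mpser fps" where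
  "comp_gf n = (\<Prod>i<n. geom i)"

text \<open>Generating function of the signed elementary symmetric polynomials in the first
  \<open>n\<close> variables without the \<open>k\<close>-th; multiplied by \<open>comp_gf n\<close>
  it leaves the geometric series of that variable alone.\<close>

definition elem_gf :: "nat \<Rightarrow> nat \<Rightarrow> mpser fps" where
  "elem_gf n k = (\<Prod>i\<in>{..<n} - {k}. 1 - fps_const (var_ser i) * fps_X)"

lemma geom_inverse: "geom i * (1 - fps_const (var_ser i) * fps_X) = 1"
proof (rule fps_ext)
  fix m
  have "geom i * (1 - fps_const (var_ser i) * fps_X) = geom i - fps_const (var_ser i) * (fps_X * geom i)"
    by (simp add: algebra_simps)
  then have "fps_nth (geom i * (1 - fps_const (var_ser i) * fps_X)) m =
      fps_nth (geom i) m - var_ser i * fps_nth (fps_X * geom i) m"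
    by simp
  then show "fps_nth (geom i * (1 - fps_const (var_ser i) * fps_X)) m = fps_nth 1 m"
    by (cases m) (simp_all add: geom_def)
qed

lemma comp_gf_mult_elem_gf:
  assumes "k < n"
  shows "comp_gf n * elem_gf n k = geom k"
proof -
  have "comp_gf n = geom k * (\<Prod>i\<in>{..<n} - {k}. geom i)"
    unfolding comp_gf_def using assms by (intro prod.remove) auto
  then have "comp_gf n * elem_gf n k =
      geom k * (\<Prod>i\<in>{..<n} - {k}. geom i * (1 - fps_const (var_ser i) * fps_X))"
    by (simp only: elem_gf_def prod.distrib mult.assoc)
  then show ?thesis
    by (simp add: geom_inverse)
qed

lemma linear_prod_nth_eq_0:
  fixes c :: "nat \<Rightarrow> 'a::comm_ring_1"
  assumes "finite S" "card S < l"
  shows "fps_nth (\<Prod>i\<in>S. 1 - fps_const (c i) * fps_X) l = 0"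
  using assms
proof (induction S arbitrary: l)
  case (insert i S)
  let ?P = "\<Prod>i\<in>S. 1 - fps_const (c i) * fps_X"
  have "(\<Prod>i\<in>insert i S. 1 - fps_const (c i) * fps_X) = ?P - fps_const (c i) * (fps_X * ?P)"
    using insert.hyps by (simp add: algebra_simps)
  then have "fps_nth (\<Prod>i\<in>insert i S. 1 - fps_const (c i) * fps_X) l =
      fps_nth ?P l - c i * fps_nth (fps_X * ?P) l"
    by simp
  moreover have "fps_nth ?P l = 0" "fps_nth ?P (l - 1) = 0"
    using insert by auto
  ultimately show ?case by simp
qed simp

lemma elem_gf_nth_eq_0: "k < n \<Longrightarrow> n \<le> l \<Longrightarrow> fps_nth (elem_gf n k) l = 0"
  unfolding elem_gf_def by (rule linear_prod_nth_eq_0) auto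

text \<open>The entry is \<open>h\<close> at index \<open>f i - i + j\<close>. The test supplies 0
  for negative indices, where truncated subtraction would give \<open>h 0\<close>.\<close>

definition jt_mat :: "nat \<Rightarrow> (nat \<Rightarrow> nat) \<Rightarrow> (nat \<Rightarrow> 'a::comm_ring_1) \<Rightarrow> 'a mat" where
  "jt_mat n f h = Matrix.mat n n (\<lambda>(i, j). if i \<le> f i + j then h (f i + j - i) else 0)"

lemma jt_mat_carrier [simp]: "jt_mat n f h \<in> carrier_mat n n"
  by (simp add: jt_mat_def)

lemma comp_gf_nth_0: "fps_nth (comp_gf n) 0 = 1"
  unfolding comp_gf_def by (induction n) (simp_all add: geom_def)

text \<open>The product of the two matrices reads off coefficients of
  \<open>comp_gf n * elem_gf n k\<close>, a geometric series. \<open>M\<close> does not depend on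
  \<open>f\<close>, so the empty shape later identifies its determinant with the Vandermonde
  determinant.\<close>

lemma alt_eq_det:
  obtains M where "\<And>f. alt n (\<lambda>i. f i + rho n i) = mdet (jt_mat n f (fps_nth (comp_gf n))) * mdet M"
proof -
  define M where "M = Matrix.mat n n (\<lambda>(j, k). fps_nth (elem_gf n k) (n - Suc j))"
  have "alt n (\<lambda>i. f i + rho n i) = mdet (jt_mat n f (fps_nth (comp_gf n))) * mdet M" for f
  proof -
    let ?h = "fps_nth (comp_gf n)"
    have "jt_mat n f ?h * M = Matrix.mat n n (\<lambda>(i, k). var_ser k ^ (f i + rho n i))"
    proof (rule eq_matI)
      fix i k
      assume "i < dim_row (Matrix.mat n n (\<lambda>(i, k). var_ser k ^ (f i + rho n i)))"
        "k < dim_col (Matrix.mat n n (\<lambda>(i, k). var_ser k ^ (f i + rho n i)))"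
      then have ik: "i < n" "k < n" by auto
      let ?a = "f i + rho n i"
      have "(jt_mat n f ?h * M) $$ (i, k) =
          (\<Sum>j = 0..<n. (if i \<le> f i + j then ?h (f i + j - i) else 0) * fps_nth (elem_gf n k) (n - Suc j))"
        using ik by (simp add: jt_mat_def M_def scalar_prod_def)
      also have "\<dots> = (\<Sum>l = 0..<n. (if l \<le> ?a then ?h (?a - l) else 0) * fps_nth (elem_gf n k) l)"
        using ik by (intro sum.reindex_bij_witness[of _ "\<lambda>l. n - Suc l" "\<lambda>j. n - Suc j"])
          (auto simp: rho_def intro!: arg_cong[of _ _ ?h])
      \<comment> \<open>The two ranges differ only by zero terms: \<open>h\<close> contributes
        nothing at negative indices, and the coefficients of \<open>elem_gf n k\<close> vanish from
        \<open>n\<close> on.\<close>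
      also have "\<dots> = (\<Sum>l\<in>{0..?a}. ?h (?a - l) * fps_nth (elem_gf n k) l)"
      proof (rule sum.mono_neutral_cong)
        show "(if l \<le> ?a then ?h (?a - l) else 0) * fps_nth (elem_gf n k) l = 0"
          if "l \<in> {0..<n} - {0..?a}" for l using that by simp
        show "?h (?a - l) * fps_nth (elem_gf n k) l = 0" if "l \<in> {0..?a} - {0..<n}" for l
          using that elem_gf_nth_eq_0[OF ik(2), of l] by simp
      qed auto
      also have "\<dots> = fps_nth (elem_gf n k * comp_gf n) ?a"
        unfolding fps_mult_nth by (intro sum.cong) (auto simp: mult.commute)
      also have "\<dots> = var_ser k ^ ?a"
        using comp_gf_mult_elem_gf[OF ik(2)] by (simp add: mult.commute geom_def)
      finally show "(jt_mat n f ?h * M) $$ (i, k) =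
          Matrix.mat n n (\<lambda>(i, k). var_ser k ^ (f i + rho n i)) $$ (i, k)"
        using ik by simp
    qed (auto simp: M_def jt_mat_def)
    then show ?thesis
      unfolding alt_def by (subst det_mult[symmetric, of _ n]) (auto simp: M_def)
  qed
  then show thesis by (rule that)
qed

lemma fin_supp_comp_gf [simp]: "fin_supp (fps_nth (comp_gf n) m)"
proof -
  have "\<forall>m. fin_supp (fps_nth (comp_gf n) m)"
    unfolding comp_gf_def
  proof (induction n)
    case 0
    then show ?case by simp
  next
    case (Suc n)
    then show ?case
      by (simp add: fps_mult_nth geom_def)
  qed
  then show ?thesis ..
qed

lemma fin_supp_det:
  assumes "A \<in> carrier_mat n n" "\<And>i j. i < n \<Longrightarrow> j < n \<Longrightarrow> fin_supp (A $$ (i, j))"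
  shows "fin_supp (mdet A)"
  unfolding det_def'[OF assms(1)]
  by (intro fin_supp_sum fin_supp_mult fin_supp_of_int fin_supp_prod assms(2))
    (auto dest: permutes_in_image)

text \<open>Empty rows below the first leave ones on the diagonal. The case \<open>m = 0\<close>
  evaluates the empty shape, and general \<open>m\<close> identifies the coefficients of
  \<open>comp_gf\<close> with truncated \<open>comp_sym\<close>.\<close>

lemma det_jt_mat_triangular:
  assumes "h 0 = 1" "0 < n"
  shows "mdet (jt_mat n (row_shape m) h) = h m"
proof -
  have "upper_triangular (jt_mat n (row_shape m) h)"
    by (auto simp: upper_triangular_def jt_mat_def row_shape_def)
  then have "mdet (jt_mat n (row_shape m) h) = prod_list (diag_mat (jt_mat n (row_shape m) h))"
    by (rule det_upper_triangular[OF _ jt_mat_carrier])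
  also have "\<dots> = (\<Prod>i = 0..<n. if i = 0 then h m else 1)"
    unfolding prod_list_diag_prod using assms
    by (intro prod.cong) (auto simp: jt_mat_def row_shape_def)
  also have "\<dots> = h m"
    using assms by simp
  finally show ?thesis .
qed

lemma tabsum_eq_det:
  assumes f: "shape n f"
  shows "tabsum n (colhs f) = mdet (jt_mat n f (fps_nth (comp_gf n)))"
proof (cases "n = 0")
  case True
  then have "f = (\<lambda>_. 0)"
    using f by (auto simp: shape_def)
  then have "tabsum n (colhs f) = trunc n 1"
    using f trunc_sch[OF f, of n] sch_0 by simp
  then show ?thesis
    using True jt_mat_carrier[of 0 f "fps_nth (comp_gf n)"] by (simp del: jt_mat_carrier)
next
  case False
  obtain M where M: "\<And>f. alt n (\<lambda>i. f i + rho n i) = mdet (jt_mat n f (fps_nth (comp_gf n))) * mdet M"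
    using alt_eq_det by blast
  have "alt n (\<lambda>i. row_shape 0 i + rho n i) = mdet M"
    using False by (simp only: M) (simp add: det_jt_mat_triangular comp_gf_nth_0)
  then have "alt n (rho n) = mdet M"
    by (simp add: row_shape_def)
  then have "alt n (rho n) * tabsum n (colhs f) =
      alt n (rho n) * mdet (jt_mat n f (fps_nth (comp_gf n)))"
    unfolding alt_rho_mult_tabsum[OF f] M by (simp add: mult.commute)
  then show ?thesis
    by (rule alt_rho_cancel) (auto intro!: fin_supp_det simp: jt_mat_def)
qed

definition comp_sym :: "nat \<Rightarrow> mpser" where
  "comp_sym m = sch (row_shape m)"

lemma trunc_comp_sym:
  assumes "0 < n"
  shows "trunc n (comp_sym m) = fps_nth (comp_gf n) m"
  using assms shape_row(2)[of n m]
  by (simp add: comp_sym_def trunc_sch[OF shape_row(1)] tabsum_eq_det det_jt_mat_triangular comp_gf_nth_0)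

text \<open>An empty last row of the shape gives a last matrix row whose only nonzero entry is a 1
  on the diagonal. This reconciles the number of variables with the number of rows.\<close>

lemma det_jt_mat_extend:
  fixes h :: "nat \<Rightarrow> 'a::comm_ring_1"
  assumes "h 0 = 1" "shape k f" "k \<le> n"
  shows "mdet (jt_mat n f h) = mdet (jt_mat k f h)"
  using assms(3)
proof (induction n rule: dec_induct)
  case (step n)
  let ?A = "jt_mat (Suc n) f h"
  have "f n = 0"
    using assms(2) step(1) by (simp add: shape_def)
  then have row: "?A $$ (n, j) = (if j = n then 1 else 0)" if "j < Suc n" for j
    using that assms(1) by (auto simp: jt_mat_def)
  have "mdet ?A = (\<Sum>j<Suc n. ?A $$ (n, j) * cofactor ?A n j)"
    by (rule laplace_expansion_row) auto
  also have "\<dots> = cofactor ?A n n"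
    by (simp add: row)
  also have "mat_delete ?A n n = jt_mat n f h"
    by (rule eq_matI) (auto simp: mat_delete_def jt_mat_def)
  then have "cofactor ?A n n = mdet (jt_mat n f h)"
    by (simp add: cofactor_def)
  finally show ?case
    using step by simp
qed simp

theorem jacobi_trudi:
  assumes f: "shape k f"
  shows "sch f = mdet (jt_mat k f comp_sym)"
proof (rule mpser_eq_if_trunc_eq)
  \<comment> \<open>The successor ensures a positive number of variables even for
    \<open>k = 0\<close>, as \<open>trunc_comp_sym\<close> demands.\<close>
  fix n assume n: "Suc k \<le> n"
  then have "shape n f"
    using f shape_mono by simp
  then have "trunc n (sch f) = mdet (jt_mat k f (fps_nth (comp_gf n)))"
    using n det_jt_mat_extend[of "fps_nth (comp_gf n)", OF comp_gf_nth_0 f, of n]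
    by (simp add: trunc_sch tabsum_eq_det)
  also have "jt_mat k f (fps_nth (comp_gf n)) = map_mat (trunc n) (jt_mat k f comp_sym)"
    using n by (intro eq_matI) (auto simp: jt_mat_def trunc_comp_sym)
  finally show "trunc n (sch f) = trunc n (mdet (jt_mat k f comp_sym))"
    by (simp add: trunc_det)
qed

lemma det_in_ring_gen:
  assumes "A \<in> carrier_mat n n" "\<And>i j. i < n \<Longrightarrow> j < n \<Longrightarrow> A $$ (i, j) \<in> ring_gen X"
  shows "mdet A \<in> ring_gen X"
  unfolding det_def'[OF assms(1)]
  by (intro ring_gen_sum ring_gen.mult ring_gen_of_int ring_gen_prod assms(2))
    (auto dest: permutes_in_image)

lemma Lambda_Sch_subset_ring_gen: "Lambda_Sch \<subseteq> ring_gen (range comp_sym)"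
proof
  fix a assume "a \<in> Lambda_Sch"
  then show "a \<in> ring_gen (range comp_sym)"
    unfolding Lambda_Sch_def schur_basis_eq
  proof (induction rule: nat_span_induct)
    case (base b)
    then obtain f k where f: "b = sch f" "shape k f" by blast
    have "mdet (jt_mat k f comp_sym) \<in> ring_gen (range comp_sym)"
      by (rule det_in_ring_gen[OF jt_mat_carrier])
        (auto simp: jt_mat_def intro: ring_gen.base ring_gen_0)
    with f show ?case
      by (simp add: jacobi_trudi)
  qed (auto intro: ring_gen_0 ring_gen.add)
qed

section \<open>Elementary symmetric functions as one-column Schur functions\<close>

definition col_shape :: "nat \<Rightarrow> nat \<Rightarrow> nat" where
  "col_shape n i = (if i < n then 1 else 0)"

lemma shape_col: "shape n (col_shape n)"
  by (simp add: shape_def col_shape_def)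

text \<open>A one-column tableau is a set of \<open>n\<close> variables. This places the elementary
  symmetric functions in \<open>Lambda_Sch\<close>, where they will separate homomorphisms.\<close>

lemma elem_sym_eq_sch:
  assumes "0 < n"
  shows "elem_sym n = sch (col_shape n)"
proof (rule mpser_eqI)
  fix \<alpha> :: "nat \<Rightarrow>\<^sub>0 nat"
  obtain m where m: "keys \<alpha> \<subseteq> {..<m}"
    using keys_bounded[of 0 \<alpha>] by blast
  have "{i. 0 < col_shape n i} = {..<n}"
    by (auto simp: col_shape_def)
  then have "colh (col_shape n) 0 = n"
    by (simp add: colh_def)
  then have "colhs (col_shape n) = [n]"
    using assms by (simp add: colhs_def) (simp add: col_shape_def)
  moreover have "coltab m [n] = (\<lambda>C. [C]) ` {C. C \<subseteq> {..<m} \<and> card C = n}"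
    by (auto simp: coltab_def map_eq_Cons_conv)
  moreover have "wt [C] = lookup \<alpha> \<longleftrightarrow> C = keys \<alpha> \<and> \<alpha> = indv (keys \<alpha>)" if "C \<subseteq> {..<m}" for C
  proof
    assume w: "wt [C] = lookup \<alpha>"
    then have l: "lookup \<alpha> i = (if i \<in> C then 1 else 0)" for i
      by (metis add.right_neutral wt_simps(1,2))
    have "C = keys \<alpha>"
      by (intro Set.set_eqI) (simp add: in_keys_iff l)
    moreover from this have "\<alpha> = indv (keys \<alpha>)"
      by (intro poly_mapping_eqI) (simp add: l)
    ultimately show "C = keys \<alpha> \<and> \<alpha> = indv (keys \<alpha>)" ..
  next
    assume C: "C = keys \<alpha> \<and> \<alpha> = indv (keys \<alpha>)"
    then have "lookup \<alpha> i = (if i \<in> keys \<alpha> then 1 else 0)" for i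
      by (metis finite_keys lookup_indv)
    with C show "wt [C] = lookup \<alpha>"
      by (intro ext) simp
  qed
  ultimately have "{Ts \<in> coltab m (colhs (col_shape n)). wt Ts = lookup \<alpha>} =
      (if card (keys \<alpha>) = n \<and> \<alpha> = indv (keys \<alpha>) then {[keys \<alpha>]} else {})"
    using m by auto
  then show "mpcoeff (elem_sym n) \<alpha> = mpcoeff (sch (col_shape n)) \<alpha>"
    by (simp add: mpcoeff_elem_sym mpcoeff_sch[OF shape_col m] mpcoeff_tabsum[OF shape_col m])
qed

section \<open>Semiring homomorphisms into the nonnegative reals\<close>

locale real_char =
  fixes S :: "mpser set" and A :: "real set" and \<phi> :: "mpser \<Rightarrow> real"
  assumes S: "is_subsemiring S" and A: "A \<subseteq> {0..}" and hom: "\<phi> \<in> Defs.semiring_hom S A"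
begin

lemma S_closed: "0 \<in> S" "1 \<in> S" "f \<in> S \<Longrightarrow> g \<in> S \<Longrightarrow> f + g \<in> S" "f \<in> S \<Longrightarrow> g \<in> S \<Longrightarrow> f * g \<in> S"
  using S by (auto simp: is_subsemiring_def)

lemma S_sum: "(\<And>s. s \<in> I \<Longrightarrow> f s \<in> S) \<Longrightarrow> sum f I \<in> S"
  by (induction I rule: infinite_finite_induct) (auto intro: S_closed)

lemma hom_simps:
  "\<phi> 0 = 0" "\<phi> 1 = 1"
  "f \<in> S \<Longrightarrow> g \<in> S \<Longrightarrow> \<phi> (f + g) = \<phi> f + \<phi> g"
  "f \<in> S \<Longrightarrow> g \<in> S \<Longrightarrow> \<phi> (f * g) = \<phi> f * \<phi> g"
  using hom by (auto simp: Defs.semiring_hom_def)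

lemma hom_in: "f \<in> S \<Longrightarrow> \<phi> f \<in> A"
  using hom by (auto simp: Defs.semiring_hom_def)

lemma hom_nonneg: "f \<in> S \<Longrightarrow> 0 \<le> \<phi> f"
  using hom_in A by auto

lemma hom_sum: "(\<And>s. s \<in> I \<Longrightarrow> f s \<in> S) \<Longrightarrow> \<phi> (sum f I) = (\<Sum>s\<in>I. \<phi> (f s))"
  by (induction I rule: infinite_finite_induct) (auto simp: hom_simps S_sum)

lemma hom_of_nat_mult: "f \<in> S \<Longrightarrow> of_nat k * f \<in> S \<and> \<phi> (of_nat k * f) = real k * \<phi> f"
  by (induction k) (auto simp: hom_simps S_closed distrib_right)

text \<open>The extension of \<phi> to differences of elements of \<open>S\<close>, well defined
  since equal differences amount to an equation between sums in \<open>S\<close>. Determinants and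
  other signed expressions are evaluated there.\<close>

definition diff_ext :: "mpser \<Rightarrow> real" where
  "diff_ext x = (SOME r. \<exists>f\<in>S. \<exists>g\<in>S. x = f - g \<and> r = \<phi> f - \<phi> g)"

lemma diff_ext_diff:
  assumes "f \<in> S" "g \<in> S"
  shows "diff_ext (f - g) = \<phi> f - \<phi> g"
proof -
  have "\<exists>f'\<in>S. \<exists>g'\<in>S. f - g = f' - g' \<and> diff_ext (f - g) = \<phi> f' - \<phi> g'"
    unfolding diff_ext_def by (rule someI_ex) (use assms in blast)
  then obtain f' g' where *: "f' \<in> S" "g' \<in> S" "f - g = f' - g'" "diff_ext (f - g) = \<phi> f' - \<phi> g'"
    by blast
  have "\<phi> (f + g') = \<phi> (f' + g)"
    using *(3) by (simp add: algebra_simps)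
  with * assms show ?thesis
    by (simp add: hom_simps)
qed

definition diffs :: "mpser set" where
  "diffs = {f - g | f g. f \<in> S \<and> g \<in> S}"

lemma diff_ext_in: "f \<in> S \<Longrightarrow> f \<in> diffs \<and> diff_ext f = \<phi> f"
  using diff_ext_diff[of f 0] S_closed(1) unfolding diffs_def by (force simp: hom_simps)

lemma diff_ext_add: "x \<in> diffs \<Longrightarrow> y \<in> diffs \<Longrightarrow> x + y \<in> diffs \<and> diff_ext (x + y) = diff_ext x + diff_ext y"
proof -
  assume "x \<in> diffs" "y \<in> diffs"
  then obtain a b c d where *: "x = a - b" "y = c - d" "a \<in> S" "b \<in> S" "c \<in> S" "d \<in> S"
    unfolding diffs_def by blast
  have eq: "x + y = (a + c) - (b + d)"
    unfolding *(1,2) by (simp add: algebra_simps)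
  have "x + y \<in> diffs"
    unfolding eq diffs_def using * S_closed by blast
  moreover have "diff_ext (x + y) = (\<phi> a - \<phi> b) + (\<phi> c - \<phi> d)"
    unfolding eq using *(3-6) by (simp add: diff_ext_diff hom_simps S_closed)
  ultimately show ?thesis
    unfolding *(1,2) using *(3-6) by (simp add: diff_ext_diff)
qed

lemma diff_ext_mult: "x \<in> diffs \<Longrightarrow> y \<in> diffs \<Longrightarrow> x * y \<in> diffs \<and> diff_ext (x * y) = diff_ext x * diff_ext y"
proof -
  assume "x \<in> diffs" "y \<in> diffs"
  then obtain a b c d where *: "x = a - b" "y = c - d" "a \<in> S" "b \<in> S" "c \<in> S" "d \<in> S"
    unfolding diffs_def by blast
  have eq: "x * y = (a * c + b * d) - (a * d + b * c)"
    unfolding *(1,2) by (simp add: algebra_simps)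
  have "x * y \<in> diffs"
    unfolding eq diffs_def using * S_closed by blast
  moreover have "diff_ext (x * y) = (\<phi> a - \<phi> b) * (\<phi> c - \<phi> d)"
    unfolding eq using *(3-6) by (simp add: diff_ext_diff hom_simps S_closed algebra_simps)
  ultimately show ?thesis
    unfolding *(1,2) using *(3-6) by (simp add: diff_ext_diff)
qed

lemma diff_ext_uminus: "x \<in> diffs \<Longrightarrow> - x \<in> diffs \<and> diff_ext (- x) = - diff_ext x"
proof -
  assume "x \<in> diffs"
  then obtain a b where *: "x = a - b" "a \<in> S" "b \<in> S"
    unfolding diffs_def by blast
  have eq: "- x = b - a" using * by simp
  show ?thesis
    unfolding eq using * by (auto simp: diffs_def diff_ext_diff)
qed

lemma diff_ext_sum: "(\<And>s. s \<in> I \<Longrightarrow> f s \<in> diffs) \<Longrightarrow> sum f I \<in> diffs \<and> diff_ext (sum f I) = (\<Sum>s\<in>I. diff_ext (f s))"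
  using diff_ext_in[OF S_closed(1)]
  by (induction I rule: infinite_finite_induct) (auto simp: diff_ext_add hom_simps)

lemma diff_ext_prod: "(\<And>s. s \<in> I \<Longrightarrow> f s \<in> diffs) \<Longrightarrow> prod f I \<in> diffs \<and> diff_ext (prod f I) = (\<Prod>s\<in>I. diff_ext (f s))"
  using diff_ext_in[OF S_closed(2)]
  by (induction I rule: infinite_finite_induct) (auto simp: diff_ext_mult hom_simps)

lemma diff_ext_sign: "of_int (sign p) \<in> diffs \<and> diff_ext (of_int (sign p)) = of_int (sign p)"
  using diff_ext_in[OF S_closed(2)] diff_ext_uminus[of 1] by (auto simp: sign_def hom_simps)

lemma diff_ext_det:
  assumes B: "B \<in> carrier_mat n n" and d: "\<And>i j. i < n \<Longrightarrow> j < n \<Longrightarrow> B $$ (i, j) \<in> diffs"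
  shows "diff_ext (mdet B) = mdet (map_mat diff_ext B)"
proof -
  have B': "map_mat diff_ext B \<in> carrier_mat n n" using B by simp
  have pin: "p i < n" if "p permutes {0..<n}" "i < n" for p i
    using that permutes_in_image[of p "{0..<n}" i] by simp
  have pr: "(\<Prod>i = 0..<n. B $$ (i, p i)) \<in> diffs \<and>
      diff_ext (\<Prod>i = 0..<n. B $$ (i, p i)) = (\<Prod>i = 0..<n. map_mat diff_ext B $$ (i, p i))"
    if p: "p permutes {0..<n}" for p
  proof -
    have "B $$ (i, p i) \<in> diffs" if "i \<in> {0..<n}" for i
      using that d pin[OF p] by auto
    moreover have "(\<Prod>i = 0..<n. map_mat diff_ext B $$ (i, p i)) = (\<Prod>i = 0..<n. diff_ext (B $$ (i, p i)))"
      using B pin[OF p] by (intro prod.cong) auto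
    ultimately show ?thesis
      using diff_ext_prod[of "{0..<n}" "\<lambda>i. B $$ (i, p i)"] by simp
  qed
  have tm: "of_int (sign p) * (\<Prod>i = 0..<n. B $$ (i, p i)) \<in> diffs \<and>
      diff_ext (of_int (sign p) * (\<Prod>i = 0..<n. B $$ (i, p i))) =
      of_int (sign p) * (\<Prod>i = 0..<n. map_mat diff_ext B $$ (i, p i))"
    if p: "p permutes {0..<n}" for p
    using pr[OF p] diff_ext_sign[of p] diff_ext_mult by metis
  show ?thesis
    unfolding det_def'[OF B] det_def'[OF B']
    using diff_ext_sum[of "{p. p permutes {0..<n}}" "\<lambda>p. of_int (sign p) * (\<Prod>i = 0..<n. B $$ (i, p i))"] tm
    by (auto intro!: sum.cong)
qed

end

text \<open>\<open>X\<close> generates \<open>S\<close> only with subtraction, so agreement on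
  \<open>X\<close> is carried through the extensions to differences and then restricted back to
  \<open>S\<close>.\<close>

lemma real_char_eqI:
  assumes "real_char S A \<phi>" "real_char S A \<psi>" "X \<subseteq> S" "S \<subseteq> ring_gen X"
    and eq: "\<And>x. x \<in> X \<Longrightarrow> \<phi> x = \<psi> x"
  shows "\<phi> = \<psi>"
proof -
  interpret p: real_char S A \<phi> by fact
  interpret q: real_char S A \<psi> by fact
  have d: "q.diffs = p.diffs"
    by (simp add: p.diffs_def q.diffs_def)
  have "x \<in> p.diffs \<and> p.diff_ext x = q.diff_ext x" if "x \<in> ring_gen X" for x
    using that
  proof induction
    case (base x)
    then show ?case
      using p.diff_ext_in q.diff_ext_in eq assms(3) by (metis subsetD)
  next
    case one
    then show ?case
      using p.diff_ext_in q.diff_ext_in p.S_closed(2) p.hom_simps(2) q.hom_simps(2) by metis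
  next
    case (add x y)
    then show ?case
      using p.diff_ext_add[of x y] q.diff_ext_add[of x y] d by simp
  next
    case (mult x y)
    then show ?case
      using p.diff_ext_mult[of x y] q.diff_ext_mult[of x y] d by simp
  next
    case (neg x)
    then show ?case
      using p.diff_ext_uminus[of x] q.diff_ext_uminus[of x] d by simp
  qed
  then have "\<phi> x = \<psi> x" if "x \<in> S" for x
    using that assms(4) p.diff_ext_in q.diff_ext_in by (metis subsetD)
  then show ?thesis
    using p.hom q.hom unfolding Defs.semiring_hom_def
    by (intro extensionalityI[of _ S]) (auto simp: PiE_def)
qed

text \<open>Each \<open>W i\<close> injects into the finite lists over \<open>A\<close>, and there
  are countably many indices.\<close>

lemma countable_if_determined:
  fixes W :: "'i::countable \<Rightarrow> ('b \<Rightarrow> 'a) set" and N :: "'i \<Rightarrow> nat" and g :: "nat \<Rightarrow> 'b"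
  assumes A: "countable A"
    and val: "\<And>i \<phi> n. \<phi> \<in> W i \<Longrightarrow> \<phi> (g n) \<in> A"
    and det: "\<And>i \<phi> \<psi>. \<phi> \<in> W i \<Longrightarrow> \<psi> \<in> W i \<Longrightarrow> (\<And>n. n < N i \<Longrightarrow> \<phi> (g n) = \<psi> (g n)) \<Longrightarrow> \<phi> = \<psi>"
  shows "countable (\<Union>i. W i)"
proof (rule countable_UN)
  fix i
  let ?r = "\<lambda>\<phi>. map (\<lambda>n. \<phi> (g n)) [0..<N i]"
  have inj: "inj_on ?r (W i)"
  proof (rule inj_onI)
    fix \<phi> \<psi> assume *: "\<phi> \<in> W i" "\<psi> \<in> W i" "?r \<phi> = ?r \<psi>"
    have "\<phi> (g n) = \<psi> (g n)" if "n < N i" for n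
      using arg_cong[OF *(3), of "\<lambda>xs. xs ! n"] that by simp
    then show "\<phi> = \<psi>"
      by (rule det[OF *(1,2)])
  qed
  have "?r ` W i \<subseteq> lists A"
    using val by auto
  then have "countable (?r ` W i)"
    by (rule countable_subset) (rule countable_lists[OF A])
  then show "countable (W i)"
    using inj by (rule countable_image_inj_on)
qed simp

section \<open>Gaps in nondense semirings\<close>

lemma not_dense_gap:
  fixes A :: "real set"
  assumes A: "is_subsemiring A" "A \<subseteq> {0..}" and nd: "closure A \<noteq> {0..}" and a: "a \<in> A"
  shows "a = 0 \<or> 1 \<le> a"
proof (rule ccontr)
  assume "\<not> (a = 0 \<or> 1 \<le> a)"
  then have a01: "0 < a" "a < 1" using a A(2) by force+
  have pow: "a ^ n \<in> A" for n
    using A(1) a by (induction n) (auto simp: is_subsemiring_def)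
  have mul: "real k * a ^ n \<in> A" for k n
  proof (induction k)
    case (Suc k)
    then show ?case
      using A(1) pow[of n] by (auto simp: is_subsemiring_def distrib_right)
  qed (use A(1) in \<open>simp add: is_subsemiring_def\<close>)
  have "closure A \<subseteq> {0..}"
    using A(2) by (intro closure_minimal) auto
  moreover have "x \<in> closure A" if x: "0 \<le> x" for x
    unfolding closure_approachable
  proof (intro allI impI)
    fix e :: real assume "0 < e"
    then obtain n where n: "a ^ n < e"
      using real_arch_pow_inv a01 by blast
    define k where "k = nat \<lfloor>x / a ^ n\<rfloor>"
    have p: "0 < a ^ n" using a01 by simp
    have k: "real k \<le> x / a ^ n" "x / a ^ n < real k + 1"
      using x p by (auto simp: k_def)
    then have "real k * a ^ n \<le> x" "x < (real k + 1) * a ^ n"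
      using p by (auto simp: field_simps)
    then have "dist (real k * a ^ n) x < e"
      using n by (simp add: dist_real_def algebra_simps abs_if)
    then show "\<exists>y\<in>A. dist y x < e"
      using mul by blast
  qed
  ultimately show False
    using nd by auto
qed

text \<open>Once \<open>r\<close> is below 1/2, the sequence at least halves at every step and falls
  below 1, where the gap leaves only 0.\<close>

lemma eventually_hits_0:
  fixes t r :: "nat \<Rightarrow> real"
  assumes gap: "\<And>n. t n = 0 \<or> 1 \<le> t n" and r: "r \<longlonglongrightarrow> 0" and le: "\<And>n. t (Suc n) \<le> r n * t n"
  shows "\<exists>n. t n = 0"
proof -
  have nn: "0 \<le> t n" for n
    using gap[of n] by auto
  have "eventually (\<lambda>n. r n < 1 / 2) sequentially"
    by (rule order_tendstoD(2)[OF r]) simp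
  then obtain N where N: "\<And>n. N \<le> n \<Longrightarrow> r n < 1 / 2"
    by (auto simp: eventually_sequentially)
  have dec: "t (N + k) \<le> (1 / 2) ^ k * t N" for k
  proof (induction k)
    case (Suc k)
    have "t (N + Suc k) \<le> r (N + k) * t (N + k)"
      using le[of "N + k"] by simp
    also have "\<dots> \<le> 1 / 2 * t (N + k)"
      using N[of "N + k"] nn by (intro mult_right_mono) auto
    finally show ?case
      using Suc by simp
  qed simp
  have "(\<lambda>k. (1 / 2) ^ k * t N) \<longlonglongrightarrow> 0 * t N"
    by (intro tendsto_intros) simp
  then have "eventually (\<lambda>k. (1 / 2) ^ k * t N < 1) sequentially"
    by (intro order_tendstoD(2)) auto
  then obtain k where "(1 / 2) ^ k * t N < 1"
    by (auto simp: eventually_sequentially)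
  then have "t (N + k) < 1"
    using dec[of k] by simp
  then show ?thesis
    using gap[of "N + k"] by auto
qed

section \<open>Countability of the monomial Witt vectors\<close>

text \<open>A product of \<open>n + 1\<close> distinct variables splits in \<open>n + 1\<close> ways
  into one variable and a product of \<open>n\<close>; all other coefficients of the left side are
  nonnegative.\<close>

lemma elem_sym_mult_1:
  obtains r where "r \<in> Lambda_N" "elem_sym 1 * elem_sym n = of_nat (Suc n) * elem_sym (Suc n) + r"
proof -
  define r where "r = elem_sym 1 * elem_sym n - of_nat (Suc n) * elem_sym (Suc n)"
  have Z: "elem_sym m \<in> Lambda_Z" for m
    using elem_sym_in_Lambda_N Lambda_N_iff by blast
  have "of_nat m * f \<in> Lambda_Z" if "f \<in> Lambda_Z" for m f
    using that by (induction m) (auto simp: distrib_right)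
  then have "r \<in> Lambda_Z"
    using Z unfolding r_def by blast
  moreover have "0 \<le> mpcoeff r \<alpha>" for \<alpha>
  proof -
    let ?t = "\<lambda>(\<beta>, \<gamma>). mpcoeff (elem_sym 1) \<beta> * mpcoeff (elem_sym n) \<gamma>"
    have nn: "0 \<le> ?t p" for p
      by (auto simp: mpcoeff_elem_sym split: prod.splits)
    have "int (Suc n) * mpcoeff (elem_sym (Suc n)) \<alpha> \<le> mpcoeff (elem_sym 1 * elem_sym n) \<alpha>"
    proof (cases "card (keys \<alpha>) = Suc n \<and> \<alpha> = indv (keys \<alpha>)")
      case True
      define K where "K = keys \<alpha>"
      have K: "card K = Suc n" "finite K" "\<alpha> = indv K"
        using True by (auto simp: K_def)
      let ?p = "\<lambda>i. (indv {i}, indv (K - {i}))"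
      have inj: "inj_on ?p K"
        by (rule inj_onI) (metis finite.emptyI finite.insertI keys_indv prod.inject singleton_inject)
      have "int (Suc n) = (\<Sum>i\<in>K. 1)"
        using K by simp
      also have "\<dots> = (\<Sum>i\<in>K. ?t (?p i))"
        using K by (intro sum.cong) (auto simp: mpcoeff_elem_sym)
      also have "\<dots> = sum ?t (?p ` K)"
        using inj by (simp add: sum.reindex)
      also have "\<dots> \<le> mpcoeff (elem_sym 1 * elem_sym n) \<alpha>"
        unfolding mpcoeff_mult
      proof (rule sum_mono2)
        show "?p ` K \<subseteq> {(\<beta>, \<gamma>). \<beta> + \<gamma> = \<alpha>}"
          using K by (auto intro!: poly_mapping_eqI simp: lookup_add)
      qed (use nn finite_add_decomp in auto)
      finally show ?thesis
        using True by (simp add: mpcoeff_elem_sym)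
    next
      case False
      then show ?thesis
        using nn by (auto simp: mpcoeff_elem_sym mpcoeff_mult intro!: sum_nonneg)
    qed
    then show ?thesis
      by (simp only: r_def mpcoeff_simps mpcoeff_of_nat_mult)
  qed
  ultimately have "r \<in> Lambda_N"
    by (simp add: Lambda_N_iff)
  then show thesis
    by (rule that) (simp add: r_def)
qed

lemma countable_Witt:
  fixes A :: "real set"
  assumes sA: "is_subsemiring A" "A \<subseteq> {0..}" "countable A" and nd: "closure A \<noteq> {0..}"
  shows "countable (Witt A)"
proof -
  define W where "W N = {\<phi> \<in> Witt A. \<forall>n\<ge>N. \<phi> (elem_sym n) = 0}" for N :: nat
  have char: "real_char Lambda_N A \<phi>" if "\<phi> \<in> Witt A" for \<phi>
    using that sA is_subsemiring_Lambda_N by unfold_locales (auto simp: Witt_def)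
  have "\<exists>N. \<phi> \<in> W N" if \<phi>: "\<phi> \<in> Witt A" for \<phi>
  proof -
    interpret real_char Lambda_N A \<phi> by (rule char[OF \<phi>])
    define t where "t n = \<phi> (elem_sym n)" for n
    have e: "elem_sym n \<in> Lambda_N" for n
      by (rule elem_sym_in_Lambda_N)
    have step: "real (Suc n) * t (Suc n) \<le> t 1 * t n" for n
    proof -
      obtain r where r: "r \<in> Lambda_N" "elem_sym 1 * elem_sym n = of_nat (Suc n) * elem_sym (Suc n) + r"
        using elem_sym_mult_1 .
      have "t 1 * t n = \<phi> (elem_sym 1 * elem_sym n)"
        by (simp add: t_def hom_simps e)
      also have "\<dots> = real (Suc n) * t (Suc n) + \<phi> r"
        unfolding r(2) using hom_of_nat_mult[OF e, of "Suc n" "Suc n"] r(1)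
        by (simp add: hom_simps(3) t_def del: of_nat_Suc)
      finally show ?thesis
        using hom_nonneg[OF r(1)] by simp
    qed
    have gap: "t n = 0 \<or> 1 \<le> t n" for n
      using not_dense_gap[OF sA(1,2) nd] hom_in[OF e] by (simp add: t_def)
    have "(\<lambda>n. t 1 / real (Suc n)) \<longlonglongrightarrow> 0"
      by (rule lim_const_over_n[THEN LIMSEQ_Suc])
    moreover have "t (Suc n) \<le> t 1 / real (Suc n) * t n" for n
      using step[of n] by (simp add: field_simps)
    ultimately have "\<exists>N. t N = 0"
      by (rule eventually_hits_0[of t, OF gap])
    then obtain N where N: "t N = 0" ..
    \<comment> \<open>A zero persists, so only the generators below \<open>N\<close> carry
      information.\<close>
    have "t n = 0" if "N \<le> n" for n
      using that
    proof (induction n rule: dec_induct)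
      case (step n)
      then have "real (Suc n) * t (Suc n) \<le> 0"
        using \<open>\<And>n. real (Suc n) * t (Suc n) \<le> t 1 * t n\<close>[of n] by simp
      then have "t (Suc n) \<le> 0"
        by (simp add: mult_le_0_iff)
      then show ?case
        using gap[of "Suc n"] by auto
    qed (rule N)
    with \<phi> show ?thesis
      by (auto simp: W_def t_def)
  qed
  then have "Witt A = (\<Union>N. W N)"
    by (auto simp: W_def)
  also have "countable \<dots>"
  proof (rule countable_if_determined[OF sA(3), of W elem_sym "\<lambda>N. N"])
    show "\<phi> (elem_sym n) \<in> A" if "\<phi> \<in> W N" for \<phi> n N
      using that real_char.hom_in[OF char elem_sym_in_Lambda_N] by (simp add: W_def)
    show "\<phi> = \<psi>" if w: "\<phi> \<in> W N" "\<psi> \<in> W N" and eq: "\<And>n. n < N \<Longrightarrow> \<phi> (elem_sym n) = \<psi> (elem_sym n)"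
      for \<phi> \<psi> N
    proof (rule real_char_eqI)
      show "real_char Lambda_N A \<phi>" "real_char Lambda_N A \<psi>"
        using w char by (auto simp: W_def)
      show "range elem_sym \<subseteq> Lambda_N"
        using elem_sym_in_Lambda_N by auto
      show "Lambda_N \<subseteq> ring_gen (range elem_sym)"
        using Lambda_N_subset_Lambda_Z Lambda_Z_subset_ring_gen by blast
      show "\<phi> x = \<psi> x" if x: "x \<in> range elem_sym" for x
      proof -
        obtain n where n: "x = elem_sym n" using x by blast
        show ?thesis
          using w eq[of n] by (cases "n < N") (auto simp: n W_def)
      qed
    qed
  qed
  finally show ?thesis .
qed

section \<open>Countability of the Schur Witt vectors\<close>

definition stair :: "nat \<Rightarrow> nat \<Rightarrow> nat" where
  "stair d i = d - i"

definition rect :: "nat \<Rightarrow> nat \<Rightarrow> nat \<Rightarrow> nat" where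
  "rect k m i = (if i < k then m else 0)"

lemma shape_stair: "shape d (stair d)"
  by (auto simp: shape_def stair_def)

lemma shape_rect: "shape k (rect k m)"
  by (auto simp: shape_def rect_def)

locale schur_char = real_char Lambda_Sch A \<phi> for A :: "real set" and \<phi> :: "mpser \<Rightarrow> real"
begin

definition c where "c = \<phi> (sch (row_shape 1))"

lemma c_nonneg: "0 \<le> c"
  unfolding c_def using hom_nonneg sch_in_Lambda_Sch shape_row(1) by blast

lemma sch_hom_nonneg: "shape n f \<Longrightarrow> 0 \<le> \<phi> (sch f)"
  using hom_nonneg sch_in_Lambda_Sch by blast

text \<open>The one-box product rule with only some of its nonnegative terms kept.\<close>

lemma box_le:
  assumes f: "shape n f" and I: "finite I" "\<And>i. i \<in> I \<Longrightarrow> shape n (f(i := Suc (f i)))"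
  shows "(\<Sum>i\<in>I. \<phi> (sch (f(i := Suc (f i))))) \<le> c * \<phi> (sch f)"
proof -
  \<comment> \<open>Strictly above the size, as \<open>sch_mult_box\<close> requires, and large
    enough for all rows.\<close>
  define m where "m = Suc (n + (\<Sum>i<n. f i))"
  have fm: "shape m f"
    using f by (rule shape_mono) (simp add: m_def)
  have lt: "(\<Sum>i<m. f i) < m"
    using sum_shape(1)[OF f, of m] by (simp add: m_def)
  let ?J = "{i. i < m \<and> decr m (f(i := Suc (f i)))}"
  have sJ: "shape m (f(i := Suc (f i)))" if i: "i \<in> ?J" for i
  proof -
    have z: "(f(i := Suc (f i))) l = 0" if "m \<le> l" for l
      using that i fm by (auto simp: shape_def)
    have "(f(i := Suc (f i))) (Suc l) \<le> (f(i := Suc (f i))) l" for l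
      using i z[of "Suc l"] by (cases "Suc l < m") (auto simp: decr_def simp del: fun_upd_apply)
    with z show ?thesis
      unfolding shape_def by blast
  qed
  have "I \<subseteq> ?J"
  proof
    fix i assume i: "i \<in> I"
    have "i < n"
      using I(2)[OF i] unfolding shape_def by (metis Zero_not_Suc fun_upd_same not_le)
    then show "i \<in> ?J"
      using I(2)[OF i] by (simp add: m_def shape_def decr_def del: fun_upd_apply)
  qed
  then have "(\<Sum>i\<in>I. \<phi> (sch (f(i := Suc (f i))))) \<le> (\<Sum>i\<in>?J. \<phi> (sch (f(i := Suc (f i)))))"
    using sch_hom_nonneg[OF sJ] by (intro sum_mono2) auto
  also have "\<dots> = \<phi> (sch f * sch (row_shape 1))"
    unfolding sch_mult_box[OF fm lt]
    by (rule hom_sum[symmetric]) (rule sch_in_Lambda_Sch[OF sJ])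
  also have "\<dots> = c * \<phi> (sch f)"
    using sch_in_Lambda_Sch[OF f] sch_in_Lambda_Sch[OF shape_row(1), of 1]
    by (simp add: hom_simps c_def)
  finally show ?thesis .
qed

text \<open>From \<open>f\<close> to \<open>g\<close> one box is added at a time; by
  \<open>box_le\<close> a zero value stays zero.\<close>

lemma sch_zero_mono:
  assumes "shape n f" "shape n g" "\<And>i. f i \<le> g i" "\<phi> (sch f) = 0"
  shows "\<phi> (sch g) = 0"
  using assms
proof (induction "\<Sum>i<n. g i - f i" arbitrary: f rule: less_induct)
  case less
  show ?case
  proof (cases "f = g")
    case False
    \<comment> \<open>In the first differing row a box can be added: the row above already has its
      length in \<open>g\<close>, which is at least \<open>g i\<close>.\<close>
    define i where "i = (LEAST i. f i \<noteq> g i)"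
    have "\<exists>i. f i \<noteq> g i"
      using False by auto
    then have i: "f i \<noteq> g i"
      unfolding i_def by (rule LeastI_ex)
    have low: "f l = g l" if "l < i" for l
      using not_less_Least[of l "\<lambda>i. f i \<noteq> g i"] that unfolding i_def by blast
    have lt: "f i < g i"
      using less.prems(3)[of i] i by simp
    then have iN: "i < n"
      using less.prems(2) unfolding shape_def by (metis not_le not_less_zero)
    let ?f = "f(i := Suc (f i))"
    have sh: "shape n ?f"
      unfolding shape_def
    proof (intro conjI allI impI)
      fix l
      show "?f (Suc l) \<le> ?f l"
      proof (cases "Suc l = i")
        case True
        then have "f l = g l" using low[of l] by simp
        moreover have "g (Suc l) \<le> g l"
          using less.prems(2) by (simp add: shape_def)
        ultimately show ?thesis
          using lt True by auto
      next
        case False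
        then show ?thesis
          using less.prems(1) by (auto simp: shape_def intro: le_SucI)
      qed
    qed (use less.prems(1) iN in \<open>auto simp: shape_def\<close>)
    have "\<phi> (sch ?f) \<le> c * \<phi> (sch f)"
      using box_le[OF less.prems(1), of "{i}"] sh by simp
    then have z: "\<phi> (sch ?f) = 0"
      using sch_hom_nonneg[OF sh] less.prems(4) by simp
    have "(\<Sum>l<n. g l - ?f l) < (\<Sum>l<n. g l - f l)"
      by (rule sum_strict_mono_ex1) (use iN lt in auto)
    then show ?thesis
      using less.prems(2,3) lt z sh by (intro less.hyps[of ?f]) auto
  qed (use less in simp)
qed

text \<open>Neighbouring rows of a staircase differ by one, so adding one box to each row of any
  subset \<open>X\<close> of the rows \<open>0\<close> to \<open>d\<close> gives a shape. The next
  staircase is therefore reached in all \<open>(d + 1)!\<close> orders.\<close>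

lemma stair_growth: "fact (Suc d) * \<phi> (sch (stair (Suc d))) \<le> c ^ Suc d * \<phi> (sch (stair d))"
proof -
  define L where "L X i = stair d i + (if i \<in> X then 1 else 0)" for X i
  have sh: "shape (Suc d) (L X)" if "X \<subseteq> {..d}" for X
    using that by (auto simp: shape_def L_def stair_def)
  have main: "fact k * \<phi> (sch (stair (Suc d))) \<le> c ^ k * \<phi> (sch (L X))"
    if "X \<subseteq> {..d}" "card ({..d} - X) = k" for k X
    using that
  proof (induction k arbitrary: X)
    case 0
    then have "X = {..d}" by auto
    then have "L X = stair (Suc d)"
      by (auto simp: L_def stair_def fun_eq_iff Suc_diff_le)
    then show ?case by simp
  next
    case (Suc k)
    let ?I = "{..d} - X"
    have upd: "(L X)(i := Suc (L X i)) = L (insert i X)" if "i \<in> ?I" for i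
      using that by (auto simp: L_def)
    have sub: "insert i X \<subseteq> {..d}" if "i \<in> ?I" for i
      using that Suc.prems by auto
    have "fact (Suc k) * \<phi> (sch (stair (Suc d))) = (\<Sum>i\<in>?I. fact k * \<phi> (sch (stair (Suc d))))"
      using Suc.prems(2) by (simp add: algebra_simps)
    also have "\<dots> \<le> (\<Sum>i\<in>?I. c ^ k * \<phi> (sch (L (insert i X))))"
    proof (rule sum_mono, rule Suc.IH[OF sub])
      fix i assume i: "i \<in> ?I"
      then have "{..d} - insert i X = ?I - {i}" by auto
      then show "card ({..d} - insert i X) = k"
        using i Suc.prems(2) by simp
    qed
    also have "\<dots> = c ^ k * (\<Sum>i\<in>?I. \<phi> (sch ((L X)(i := Suc (L X i)))))"
      unfolding sum_distrib_left by (rule sum.cong) (auto simp only: upd)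
    also have "\<dots> \<le> c ^ k * (c * \<phi> (sch (L X)))"
      using c_nonneg sh[OF sub] by (intro mult_left_mono box_le[OF sh[OF Suc.prems(1)]]) (auto simp only: upd finite_Diff finite_atMost zero_le_power)
    finally show ?case by (simp add: algebra_simps)
  qed
  have "L {} = stair d"
    by (simp add: L_def fun_eq_iff)
  then show ?thesis
    using main[of "{}" "Suc d"] by simp
qed

lemma ex_stair_zero:
  assumes gap: "\<And>a. a \<in> A \<Longrightarrow> a = 0 \<or> 1 \<le> a"
  shows "\<exists>d. \<phi> (sch (stair d)) = 0"
proof (rule eventually_hits_0)
  show "\<phi> (sch (stair n)) = 0 \<or> 1 \<le> \<phi> (sch (stair n))" for n
    using gap hom_in sch_in_Lambda_Sch shape_stair by blast
  have "(\<lambda>n. inverse (fact n) * c ^ n) \<longlonglongrightarrow> 0"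
    by (rule summable_LIMSEQ_zero[OF summable_exp])
  then show "(\<lambda>n. inverse (fact (Suc n)) * c ^ Suc n) \<longlonglongrightarrow> 0"
    by (rule LIMSEQ_Suc)
  show "\<phi> (sch (stair (Suc n))) \<le> inverse (fact (Suc n)) * c ^ Suc n * \<phi> (sch (stair n))" for n
    using stair_growth[of n] by (simp add: field_simps del: fact_Suc power_Suc)
qed

lemma comp_sym_diffs: "comp_sym m \<in> diffs \<and> diff_ext (comp_sym m) = \<phi> (comp_sym m)"
  unfolding comp_sym_def using diff_ext_in sch_in_Lambda_Sch shape_row(1) by blast

lemma hom_jacobi_trudi:
  assumes f: "shape k f"
  shows "\<phi> (sch f) = mdet (jt_mat k f (\<lambda>m. \<phi> (comp_sym m)))"
proof -
  have z: "0 \<in> diffs" "diff_ext 0 = 0"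
    using diff_ext_in[OF S_closed(1)] hom_simps(1) by auto
  have "\<phi> (sch f) = diff_ext (mdet (jt_mat k f comp_sym))"
    using diff_ext_in[OF sch_in_Lambda_Sch[OF f]] by (simp add: jacobi_trudi[OF f])
  also have "\<dots> = mdet (map_mat diff_ext (jt_mat k f comp_sym))"
    by (rule diff_ext_det[OF jt_mat_carrier]) (auto simp: jt_mat_def z comp_sym_diffs)
  also have "map_mat diff_ext (jt_mat k f comp_sym) = jt_mat k f (\<lambda>m. \<phi> (comp_sym m))"
    by (rule eq_matI) (auto simp: jt_mat_def z comp_sym_diffs)
  finally show ?thesis .
qed

text \<open>\<open>Suc k\<close> is the least number of rows of a vanishing rectangle; it is
  positive since the empty shape has value 1. Minimality keeps all rectangles with \<open>k\<close>
  rows nonzero, and these are the pivots of the recursion.\<close>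

lemma ex_rect_zero:
  assumes gap: "\<And>a. a \<in> A \<Longrightarrow> a = 0 \<or> 1 \<le> a"
  shows "\<exists>k m0. (\<forall>m\<ge>m0. \<phi> (sch (rect (Suc k) m)) = 0) \<and> (\<forall>m. \<phi> (sch (rect k m)) \<noteq> 0)"
proof -
  obtain d where d: "\<phi> (sch (stair d)) = 0"
    using ex_stair_zero[OF gap] by blast
  have "\<phi> (sch (rect d d)) = 0"
    by (rule sch_zero_mono[OF shape_stair shape_rect _ d]) (simp add: stair_def rect_def)
  then have ex: "\<exists>k m. \<phi> (sch (rect k m)) = 0" by blast
  define k where "k = (LEAST k. \<exists>m. \<phi> (sch (rect k m)) = 0)"
  obtain m0 where m0: "\<phi> (sch (rect k m0)) = 0"
    using LeastI_ex[OF ex] unfolding k_def by blast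
  have min: "\<phi> (sch (rect l m)) \<noteq> 0" if "l < k" for l m
    using that not_less_Least[of l "\<lambda>k. \<exists>m. \<phi> (sch (rect k m)) = 0"] unfolding k_def by blast
  have "rect 0 m0 = (\<lambda>_. 0)"
    by (simp add: rect_def fun_eq_iff)
  then have "k \<noteq> 0"
    using m0 sch_0 hom_simps(2) by (cases k) auto
  then obtain l where l: "k = Suc l"
    using not0_implies_Suc by blast
  have "\<phi> (sch (rect k m)) = 0" if "m0 \<le> m" for m
    by (rule sch_zero_mono[OF shape_rect shape_rect _ m0]) (simp add: rect_def that)
  then show ?thesis
    using min l by blast
qed

end

text \<open>Expanding the Jacobi--Trudi determinant of the rectangle with \<open>Suc k\<close> rows of length
  \<open>m\<close> along its first row, the entry \<open>h\<^sub>m\<^sub>+\<^sub>k\<close> has the determinant of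
  the smaller rectangle as its cofactor and all other entries have smaller index.\<close>

lemma det_rect_determines:
  fixes h g :: "nat \<Rightarrow> real"
  assumes m: "0 < m" and eq: "\<And>i. i < m + k \<Longrightarrow> h i = g i"
    and z: "mdet (jt_mat (Suc k) (rect (Suc k) m) h) = 0" "mdet (jt_mat (Suc k) (rect (Suc k) m) g) = 0"
    and nz: "mdet (jt_mat k (rect k (m - 1)) h) \<noteq> 0"
  shows "h (m + k) = g (m + k)"
proof -
  let ?M = "\<lambda>h. jt_mat (Suc k) (rect (Suc k) m) h"
  have ent: "?M h $$ (i, j) = (if i \<le> m + j then h (m + j - i) else 0)"
    if "i < Suc k" "j < Suc k" for i j and h :: "nat \<Rightarrow> real"
    using that by (simp add: jt_mat_def rect_def)
  \<comment> \<open>Below the first row all indices are smaller than \<open>m + k\<close>, where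
    \<open>h\<close> and \<open>g\<close> agree.\<close>
  have del: "mat_delete (?M h) 0 j = mat_delete (?M g) 0 j" for j
    by (rule eq_matI) (auto simp: mat_delete_def jt_mat_def rect_def intro!: eq)
  then have cof: "cofactor (?M h) 0 j = cofactor (?M g) 0 j" for j
    by (simp add: cofactor_def)
  \<comment> \<open>Deleting the first row lowers every index by one, hence the row length
    \<open>m - 1\<close>.\<close>
  have "mat_delete (?M h) 0 k = jt_mat k (rect k (m - 1)) h"
    using m by (intro eq_matI) (auto simp: mat_delete_def jt_mat_def rect_def intro!: arg_cong[of _ _ h])
  then have cnz: "cofactor (?M h) 0 k \<noteq> 0"
    using nz by (simp add: cofactor_def)
  have "(\<Sum>j<Suc k. ?M h $$ (0, j) * cofactor (?M h) 0 j) = (\<Sum>j<Suc k. ?M g $$ (0, j) * cofactor (?M g) 0 j)"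
    using laplace_expansion_row[OF jt_mat_carrier, of 0 "Suc k" "rect (Suc k) m" h]
      laplace_expansion_row[OF jt_mat_carrier, of 0 "Suc k" "rect (Suc k) m" g] z by simp
  moreover have "(\<Sum>j<k. ?M h $$ (0, j) * cofactor (?M h) 0 j) = (\<Sum>j<k. ?M g $$ (0, j) * cofactor (?M g) 0 j)"
    by (intro sum.cong) (auto simp: ent cof eq)
  ultimately have "?M h $$ (0, k) * cofactor (?M h) 0 k = ?M g $$ (0, k) * cofactor (?M h) 0 k"
    by (simp add: cof)
  then show ?thesis
    using cnz by (simp add: ent)
qed

lemma countable_Witt_Sch:
  fixes A :: "real set"
  assumes sA: "is_subsemiring A" "A \<subseteq> {0..}" "countable A" and nd: "closure A \<noteq> {0..}"
  shows "countable (Witt_Sch A)"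
proof -
  define W where "W = (\<lambda>(k, m0). {\<phi> \<in> Witt_Sch A.
    (\<forall>m\<ge>m0. \<phi> (sch (rect (Suc k) m)) = 0) \<and> (\<forall>m. \<phi> (sch (rect k m)) \<noteq> 0)})"
  have char: "schur_char A \<phi>" if "\<phi> \<in> Witt_Sch A" for \<phi>
    using that sA is_subsemiring_Lambda_Sch by unfold_locales (auto simp: Witt_Sch_def)
  have "\<exists>p. \<phi> \<in> W p" if "\<phi> \<in> Witt_Sch A" for \<phi>
    using schur_char.ex_rect_zero[OF char[OF that] not_dense_gap[OF sA(1,2) nd]] that
    by (auto simp: W_def)
  then have "Witt_Sch A = (\<Union>p. W p)"
    by (auto simp: W_def)
  also have "countable \<dots>"
  \<comment> \<open>The extra one makes \<open>m = n - k\<close> positive in the recursion, also for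
    \<open>m0 = 0\<close>.\<close>
  proof (rule countable_if_determined[OF sA(3), of W comp_sym "\<lambda>(k, m0). k + Suc m0"])
    show "\<phi> (comp_sym n) \<in> A" if "\<phi> \<in> W p" for \<phi> n p
    proof -
      interpret schur_char A \<phi> using that by (intro char) (auto simp: W_def)
      show ?thesis
        unfolding comp_sym_def using hom_in sch_in_Lambda_Sch shape_row(1) by blast
    qed
    show "\<phi> = \<psi>" if w: "\<phi> \<in> W p" "\<psi> \<in> W p"
      and eq: "\<And>n. n < (case p of (k, m0) \<Rightarrow> k + Suc m0) \<Longrightarrow> \<phi> (comp_sym n) = \<psi> (comp_sym n)" for \<phi> \<psi> p
    proof -
      obtain k m0 where p: "p = (k, m0)" by (cases p)
      interpret \<phi>: schur_char A \<phi> using w by (intro char) (auto simp: W_def)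
      interpret \<psi>: schur_char A \<psi> using w by (intro char) (auto simp: W_def)
      have all: "\<phi> (comp_sym n) = \<psi> (comp_sym n)" for n
      proof (induction n rule: less_induct)
        case (less n)
        show ?case
        proof (cases "n < k + Suc m0")
          case True
          then show ?thesis using eq[of n] by (simp add: p)
        next
          case False
          define m where "m = n - k"
          have m: "0 < m" "m0 \<le> m" "n = m + k"
            using False by (auto simp: m_def)
          show ?thesis
            unfolding m(3)
          proof (rule det_rect_determines[OF m(1)])
            show "\<phi> (comp_sym i) = \<psi> (comp_sym i)" if "i < m + k" for i
              using less.IH that m(3) by simp
            show "mdet (jt_mat (Suc k) (rect (Suc k) m) (\<lambda>m. \<phi> (comp_sym m))) = 0"
              using w(1) m(2) by (simp add: \<phi>.hom_jacobi_trudi[OF shape_rect, symmetric] W_def p)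
            show "mdet (jt_mat (Suc k) (rect (Suc k) m) (\<lambda>m. \<psi> (comp_sym m))) = 0"
              using w(2) m(2) by (simp add: \<psi>.hom_jacobi_trudi[OF shape_rect, symmetric] W_def p)
            show "mdet (jt_mat k (rect k (m - 1)) (\<lambda>m. \<phi> (comp_sym m))) \<noteq> 0"
              using w(1) by (simp add: \<phi>.hom_jacobi_trudi[OF shape_rect, symmetric] W_def p)
          qed
        qed
      qed
      show ?thesis
      proof (rule real_char_eqI)
        show "real_char Lambda_Sch A \<phi>" "real_char Lambda_Sch A \<psi>"
          by unfold_locales
        show "range comp_sym \<subseteq> Lambda_Sch"
          using sch_in_Lambda_Sch[OF shape_row(1)] by (auto simp: comp_sym_def)
        show "Lambda_Sch \<subseteq> ring_gen (range comp_sym)"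
          by (rule Lambda_Sch_subset_ring_gen)
      qed (use all in auto)
    qed
  qed
  finally show ?thesis .
qed

section \<open>Perturbation of real-rooted polynomials\<close>

text \<open>The roots form a set, so they are simple; simplicity provides the sign changes that
  survive a perturbation.\<close>

definition real_rooted :: "real poly \<Rightarrow> real set \<Rightarrow> bool" where
  "real_rooted q R \<longleftrightarrow> finite R \<and> q = (\<Prod>r\<in>R. [:- r, 1:])"

lemma real_rooted_degree:
  assumes "real_rooted q R"
  shows "degree q = card R" "lead_coeff q = 1"
proof -
  show "degree q = card R"
    using assms unfolding real_rooted_def by (simp add: degree_prod_sum_eq)
  show "lead_coeff q = 1"
    using assms unfolding real_rooted_def by (simp add: lead_coeff_prod)
qed

text \<open>Otherwise the difference of two monic polynomials of equal degree would be nonzero, of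
  smaller degree, and vanish on all of \<open>R\<close>.\<close>

lemma real_rootedI:
  assumes R: "finite R" "card R = degree q" "\<And>r. r \<in> R \<Longrightarrow> poly q r = 0" and q: "lead_coeff q = 1"
  shows "real_rooted q R"
proof -
  let ?g = "\<Prod>r\<in>R. [:- r, 1:]"
  have g: "degree ?g = degree q" "lead_coeff ?g = 1"
    using real_rooted_degree[of ?g R] R by (auto simp: real_rooted_def)
  have "q - ?g = 0"
  proof (rule ccontr)
    assume nz: "q - ?g \<noteq> 0"
    have "degree (q - ?g) \<le> degree q"
      using g(1) by (intro degree_diff_le) auto
    moreover have "coeff (q - ?g) (degree q) = 0"
      using q g by simp
    ultimately have "degree (q - ?g) < degree q"
      using nz eq_zero_or_degree_less by blast
    moreover have "R \<subseteq> {x. poly (q - ?g) x = 0}"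
      using R by (auto simp: poly_prod)
    then have "card R \<le> card {x. poly (q - ?g) x = 0}"
      by (rule card_mono[OF poly_roots_finite[OF nz]])
    then have "card R \<le> degree (q - ?g)"
      using card_poly_roots_bound[OF nz] by simp
    ultimately show False
      using R(2) by simp
  qed
  then show ?thesis
    using R by (simp add: real_rooted_def)
qed

text \<open>Around each simple root the polynomial changes sign on an interval disjoint from the
  others. A constant smaller than all values at the endpoints preserves these signs, so each
  interval still contains a root.\<close>

lemma real_rooted_perturb:
  assumes f: "real_rooted f R" and ne: "R \<noteq> {}"
  shows "\<exists>\<epsilon>>0. \<forall>c. \<bar>c\<bar> < \<epsilon> \<longrightarrow> (\<exists>R'. real_rooted (f + [:c:]) R')"
proof -
  have fin: "finite R" and pf: "poly f x = (\<Prod>r\<in>R. x - r)" for x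
    using f by (auto simp: real_rooted_def poly_prod)
  \<comment> \<open>The element 1 keeps \<open>D\<close> nonempty when there is only one
    root.\<close>
  define D where "D = insert 1 ((\<lambda>(r, s). \<bar>r - s\<bar>) ` {(r, s). r \<in> R \<and> s \<in> R \<and> r \<noteq> s})"
  have "finite {(r, s). r \<in> R \<and> s \<in> R \<and> r \<noteq> s}"
    by (rule finite_subset[of _ "R \<times> R"]) (use fin in auto)
  then have D: "finite D" "D \<noteq> {}" "\<And>x. x \<in> D \<Longrightarrow> 0 < x"
    by (auto simp: D_def)
  define \<delta> where "\<delta> = Min D / 3"
  have \<delta>0: "0 < \<delta>"
    using D Min_in[of D] by (simp add: \<delta>_def)
  have sep: "3 * \<delta> \<le> \<bar>r - s\<bar>" if "r \<in> R" "s \<in> R" "r \<noteq> s" for r s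
    using that D(1) by (auto simp: \<delta>_def D_def intro!: Min_le)
  have opp: "poly f (r - \<delta>) * poly f (r + \<delta>) < 0" if r: "r \<in> R" for r
  proof -
    \<comment> \<open>The two factors for each root \<open>s\<close> combine to a difference of
      squares, negative only for \<open>s = r\<close>.\<close>
    have "poly f (r - \<delta>) * poly f (r + \<delta>) = (\<Prod>s\<in>R. (r - s)\<^sup>2 - \<delta>\<^sup>2)"
      unfolding pf prod.distrib[symmetric] by (intro prod.cong) (auto simp: power2_eq_square algebra_simps)
    also have "\<dots> = - \<delta>\<^sup>2 * (\<Prod>s\<in>R - {r}. (r - s)\<^sup>2 - \<delta>\<^sup>2)"
      using r fin by (subst prod.remove[of _ r]) auto
    also have "\<dots> < 0"
    proof -
      have "0 < (r - s)\<^sup>2 - \<delta>\<^sup>2" if "s \<in> R - {r}" for s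
      proof -
        have "\<delta> < \<bar>r - s\<bar>"
          using sep[of r s] r that \<delta>0 by auto
        then have "\<delta>\<^sup>2 < \<bar>r - s\<bar>\<^sup>2"
          using \<delta>0 by (intro power_strict_mono) auto
        then show ?thesis by simp
      qed
      then have "0 < (\<Prod>s\<in>R - {r}. (r - s)\<^sup>2 - \<delta>\<^sup>2)"
        by (intro prod_pos) auto
      then show ?thesis
        using \<delta>0 by (simp add: mult_neg_pos)
    qed
    finally show ?thesis .
  qed
  define \<epsilon> where "\<epsilon> = Min ((\<lambda>r. min \<bar>poly f (r - \<delta>)\<bar> \<bar>poly f (r + \<delta>)\<bar>) ` R)"
  have "0 < min \<bar>poly f (r - \<delta>)\<bar> \<bar>poly f (r + \<delta>)\<bar>" if "r \<in> R" for r
    using opp[OF that] by auto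
  then have \<epsilon>0: "0 < \<epsilon>"
    unfolding \<epsilon>_def using fin ne by (subst Min_gr_iff) auto
  have \<epsilon>: "\<epsilon> \<le> \<bar>poly f (r - \<delta>)\<bar>" "\<epsilon> \<le> \<bar>poly f (r + \<delta>)\<bar>" if "r \<in> R" for r
  proof -
    have "\<epsilon> \<le> min \<bar>poly f (r - \<delta>)\<bar> \<bar>poly f (r + \<delta>)\<bar>"
      unfolding \<epsilon>_def using fin that by (intro Min_le) auto
    then show "\<epsilon> \<le> \<bar>poly f (r - \<delta>)\<bar>" "\<epsilon> \<le> \<bar>poly f (r + \<delta>)\<bar>" by auto
  qed
  have "\<exists>R'. real_rooted (f + [:c:]) R'" if c: "\<bar>c\<bar> < \<epsilon>" for c
  proof -
    have sgn: "(u + c) * (v + c) < 0" if "u * v < 0" "\<bar>c\<bar> < \<bar>u\<bar>" "\<bar>c\<bar> < \<bar>v\<bar>" for u v :: real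
    proof -
      from that(1) consider "u < 0" "0 < v" | "0 < u" "v < 0"
        by (auto simp: mult_less_0_iff)
      then show ?thesis
        using that(2,3) by cases (auto simp: mult_less_0_iff)
    qed
    have "\<exists>x>r - \<delta>. x < r + \<delta> \<and> poly (f + [:c:]) x = 0" if r: "r \<in> R" for r
    proof (rule poly_IVT)
      show "poly (f + [:c:]) (r - \<delta>) * poly (f + [:c:]) (r + \<delta>) < 0"
        using sgn[OF opp[OF r]] \<epsilon>[OF r] c by simp
    qed (use \<delta>0 in simp)
    then obtain x where x: "\<And>r. r \<in> R \<Longrightarrow> r - \<delta> < x r \<and> x r < r + \<delta> \<and> poly (f + [:c:]) (x r) = 0"
      by metis
    have inj: "inj_on x R"
    proof (rule inj_onI, rule ccontr)
      fix r s assume *: "r \<in> R" "s \<in> R" "x r = x s" "r \<noteq> s"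
      then show False
        using sep[OF *(1,2,4)] x[OF *(1)] x[OF *(2)] by (auto simp: abs_if split: if_splits)
    qed
    have deg: "degree [:c:] < degree f"
      using real_rooted_degree(1)[OF f] fin ne by (simp add: card_gt_0_iff)
    then have deg': "degree (f + [:c:]) = degree f"
      by (rule degree_add_eq_left)
    have "lead_coeff (f + [:c:]) = 1"
      unfolding deg' using real_rooted_degree(2)[OF f] coeff_eq_0[OF deg] by simp
    with deg' have "real_rooted (f + [:c:]) (x ` R)"
      using x fin real_rooted_degree(1)[OF f] inj by (intro real_rootedI) (auto simp: card_image)
    then show ?thesis ..
  qed
  with \<epsilon>0 show ?thesis by blast
qed

definition neg_rooted :: "real poly \<Rightarrow> bool" where
  "neg_rooted q \<longleftrightarrow> (\<exists>R. real_rooted q R \<and> (\<forall>r\<in>R. r < 0))"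

text \<open>\<open>pCons 0 q\<close> has the new simple root 0 beside the negative ones, so
  perturbation applies. For positive \<open>c\<close> the new polynomial is positive on
  \<open>{0..}\<close>, so all roots are again negative.\<close>

lemma neg_rooted_pCons:
  assumes "neg_rooted q"
  shows "\<exists>\<epsilon>>0. \<forall>c. 0 < c \<and> c < \<epsilon> \<longrightarrow> neg_rooted (pCons c q)"
proof -
  obtain R where R: "real_rooted q R" and neg: "\<forall>r\<in>R. r < 0"
    using assms by (auto simp: neg_rooted_def)
  have fin: "finite R" using R by (simp add: real_rooted_def)
  have "real_rooted (pCons 0 q) (insert 0 R)"
    using R neg by (auto simp: real_rooted_def)
  then obtain \<epsilon> where \<epsilon>: "\<epsilon> > 0" "\<And>c. \<bar>c\<bar> < \<epsilon> \<Longrightarrow> \<exists>R'. real_rooted (pCons 0 q + [:c:]) R'"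
    using real_rooted_perturb by blast
  have "neg_rooted (pCons c q)" if c: "0 < c" "c < \<epsilon>" for c
  proof -
    obtain R' where R': "real_rooted (pCons c q) R'"
      using \<epsilon>(2)[of c] c by auto
    have "r < 0" if r: "r \<in> R'" for r
    proof (rule ccontr)
      assume "\<not> r < 0"
      then have "0 < (\<Prod>s\<in>R. r - s)"
        using neg by (intro prod_pos) force
      then have "0 < poly q r"
        using R by (simp add: real_rooted_def poly_prod)
      then have "0 < poly (pCons c q) r"
        using c \<open>\<not> r < 0\<close> by (simp add: add_pos_nonneg)
      moreover have "poly (pCons c q) r = 0"
        using R' r by (auto simp: real_rooted_def poly_prod)
      ultimately show False by simp
    qed
    with R' show ?thesis
      unfolding neg_rooted_def by blast
  qed
  with \<epsilon>(1) show ?thesis by blast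
qed

section \<open>Evaluation of symmetric functions\<close>

text \<open>The variables from \<open>n\<close> on are set to 0. The index set is finite for
  elements of \<open>Lambda_Z\<close>; over an infinite one the sum would be the default 0.\<close>

definition ev :: "nat \<Rightarrow> (nat \<Rightarrow> real) \<Rightarrow> mpser \<Rightarrow> real" where
  "ev n x f = (\<Sum>\<alpha> | mpcoeff (trunc n f) \<alpha> \<noteq> 0.
    of_int (mpcoeff (trunc n f) \<alpha>) * (\<Prod>i<n. x i ^ lookup \<alpha> i))"

lemma fin_supp_trunc:
  assumes "f \<in> Lambda_Z"
  shows "fin_supp (trunc n f)"
proof -
  obtain d where d: "\<And>\<alpha>. mpcoeff f \<alpha> \<noteq> 0 \<Longrightarrow> mdegree \<alpha> \<le> d"
    using assms unfolding Lambda_Z_iff by blast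
  have "{\<alpha>. mpcoeff (trunc n f) \<alpha> \<noteq> 0} \<subseteq> expv n ` ({..<n} \<rightarrow>\<^sub>E {..d})"
  proof
    fix \<alpha> assume "\<alpha> \<in> {\<alpha>. mpcoeff (trunc n f) \<alpha> \<noteq> 0}"
    then have k: "keys \<alpha> \<subseteq> {..<n}" and m: "mdegree \<alpha> \<le> d"
      using d by (auto split: if_splits)
    have "lookup \<alpha> i \<le> d" if "i < n" for i
      using member_le_sum[of i "{..<n}" "lookup \<alpha>"] that m by (simp add: mdegree_eq_sum[OF k])
    then have "restrict (lookup \<alpha>) {..<n} \<in> {..<n} \<rightarrow>\<^sub>E {..d}"
      by auto
    moreover have "\<alpha> = expv n (restrict (lookup \<alpha>) {..<n})"
      using k by (intro poly_mapping_eqI) (auto simp: in_keys_iff subset_iff)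
    ultimately show "\<alpha> \<in> expv n ` ({..<n} \<rightarrow>\<^sub>E {..d})"
      by blast
  qed
  moreover have "finite (expv n ` ({..<n} \<rightarrow>\<^sub>E {..d}))"
    by (intro finite_imageI finite_PiE) auto
  ultimately show ?thesis
    unfolding fin_supp_def by (rule finite_subset)
qed

lemma ev_superset:
  assumes "finite F" "{\<alpha>. mpcoeff (trunc n f) \<alpha> \<noteq> 0} \<subseteq> F"
  shows "ev n x f = (\<Sum>\<alpha>\<in>F. of_int (mpcoeff (trunc n f) \<alpha>) * (\<Prod>i<n. x i ^ lookup \<alpha> i))"
  unfolding ev_def using assms by (intro sum.mono_neutral_left) auto

lemma ev_add:
  assumes "f \<in> Lambda_Z" "g \<in> Lambda_Z"
  shows "ev n x (f + g) = ev n x f + ev n x g"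
proof -
  let ?F = "{\<alpha>. mpcoeff (trunc n f) \<alpha> \<noteq> 0} \<union> {\<alpha>. mpcoeff (trunc n g) \<alpha> \<noteq> 0}"
  have fin: "finite ?F"
    using fin_supp_trunc[OF assms(1)] fin_supp_trunc[OF assms(2)] by (auto simp: fin_supp_def)
  have sub: "{\<alpha>. mpcoeff (trunc n (f + g)) \<alpha> \<noteq> 0} \<subseteq> ?F"
    by (auto simp del: mpcoeff_trunc)
  show ?thesis
    unfolding ev_superset[OF fin sub] ev_superset[OF fin Un_upper1] ev_superset[OF fin Un_upper2]
    by (simp add: sum.distrib[symmetric] distrib_right del: mpcoeff_trunc)
qed

lemma ev_uminus: "ev n x (- f) = - ev n x f"
proof -
  have "trunc n (- f) = - trunc n f"
    using trunc_diff[of n 0 f] by simp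
  then show ?thesis
    by (simp add: ev_def sum_negf del: mpcoeff_trunc)
qed

lemma ev_mult:
  assumes "f \<in> Lambda_Z" "g \<in> Lambda_Z"
  shows "ev n x (f * g) = ev n x f * ev n x g"
proof -
  define a b where "a = trunc n f" and "b = trunc n g"
  define m where "m \<alpha> = (\<Prod>i<n. x i ^ lookup \<alpha> i)" for \<alpha>
  have m: "m (\<alpha> + \<beta>) = m \<alpha> * m \<beta>" for \<alpha> \<beta>
    by (simp add: m_def lookup_add power_add prod.distrib)
  let ?F = "{\<alpha>. mpcoeff a \<alpha> \<noteq> 0}" and ?G = "{\<alpha>. mpcoeff b \<alpha> \<noteq> 0}"
  have fin: "finite ?F" "finite ?G"
    using fin_supp_trunc[OF assms(1)] fin_supp_trunc[OF assms(2)] by (auto simp: fin_supp_def a_def b_def)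
  let ?P = "?F \<times> ?G" and ?s = "\<lambda>(\<beta>, \<gamma>). \<beta> + \<gamma>"
  have cf: "mpcoeff (a * b) \<alpha> = (\<Sum>p | p \<in> ?P \<and> ?s p = \<alpha>. mpcoeff a (fst p) * mpcoeff b (snd p))" for \<alpha>
    unfolding mpcoeff_mult
    by (rule sum.mono_neutral_cong_right) (auto simp: finite_add_decomp)
  have sub: "{\<alpha>. mpcoeff (a * b) \<alpha> \<noteq> 0} \<subseteq> ?s ` ?P"
  proof
    fix \<alpha> assume \<alpha>: "\<alpha> \<in> {\<alpha>. mpcoeff (a * b) \<alpha> \<noteq> 0}"
    show "\<alpha> \<in> ?s ` ?P"
    proof (rule ccontr)
      assume "\<alpha> \<notin> ?s ` ?P"
      then have "{p. p \<in> ?P \<and> ?s p = \<alpha>} = {}" by blast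
      with \<alpha> show False
        by (simp only: cf sum.empty mem_Collect_eq)
    qed
  qed
  have "ev n x (f * g) = (\<Sum>\<alpha>\<in>?s ` ?P. of_int (mpcoeff (a * b) \<alpha>) * m \<alpha>)"
    using ev_superset[of "?s ` ?P" n "f * g" x] fin sub unfolding trunc_mult a_def b_def m_def by auto
  also have "\<dots> = (\<Sum>\<alpha>\<in>?s ` ?P. \<Sum>p | p \<in> ?P \<and> ?s p = \<alpha>.
      (of_int (mpcoeff a (fst p)) * m (fst p)) * (of_int (mpcoeff b (snd p)) * m (snd p)))"
    unfolding cf of_int_sum sum_distrib_right
    by (intro sum.cong refl) (auto simp: m)
  also have "\<dots> = (\<Sum>p\<in>?P. (of_int (mpcoeff a (fst p)) * m (fst p)) * (of_int (mpcoeff b (snd p)) * m (snd p)))"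
    using fin by (intro sum.group) auto
  also have "\<dots> = ev n x f * ev n x g"
    unfolding ev_def a_def[symmetric] b_def[symmetric] m_def[symmetric] sum_product
    by (simp add: sum.cartesian_product case_prod_unfold)
  finally show ?thesis .
qed

lemma ev_1: "ev n x 1 = 1"
proof -
  have "ev n x 1 = (\<Sum>\<alpha>\<in>{0}. of_int (mpcoeff (trunc n 1) \<alpha>) * (\<Prod>i<n. x i ^ lookup \<alpha> i))"
    by (rule ev_superset) (auto split: if_splits)
  then show ?thesis by simp
qed

lemma ev_nonneg:
  assumes "\<And>\<alpha>. 0 \<le> mpcoeff f \<alpha>" "\<And>i. i < n \<Longrightarrow> 0 \<le> x i"
  shows "0 \<le> ev n x f"
  unfolding ev_def using assms by (intro sum_nonneg mult_nonneg_nonneg prod_nonneg) auto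

lemma ev_elem_sym: "ev n x (elem_sym k) = (\<Sum>K | K \<subseteq> {..<n} \<and> card K = k. \<Prod>i\<in>K. x i)"
proof -
  let ?K = "{K. K \<subseteq> {..<n} \<and> card K = k}"
  have fin: "finite ?K"
    by (rule finite_subset[of _ "Pow {..<n}"]) auto
  have finK: "finite K" if "K \<in> ?K" for K
    using that finite_subset by auto
  have "{\<alpha>. mpcoeff (trunc n (elem_sym k)) \<alpha> \<noteq> 0} \<subseteq> indv ` ?K"
    by (auto simp: mpcoeff_elem_sym split: if_splits)
  then have "ev n x (elem_sym k) = (\<Sum>\<alpha>\<in>indv ` ?K. of_int (mpcoeff (trunc n (elem_sym k)) \<alpha>) * (\<Prod>i<n. x i ^ lookup \<alpha> i))"
    using fin by (intro ev_superset) auto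
  also have "\<dots> = (\<Sum>K\<in>?K. of_int (mpcoeff (trunc n (elem_sym k)) (indv K)) * (\<Prod>i<n. x i ^ lookup (indv K) i))"
  proof (subst sum.reindex)
    show "inj_on indv ?K"
      by (rule inj_onI) (metis finK keys_indv)
  qed simp
  also have "\<dots> = (\<Sum>K\<in>?K. \<Prod>i\<in>K. x i)"
  proof (rule sum.cong[OF refl])
    fix K assume K: "K \<in> ?K"
    have "(\<Prod>i<n. x i ^ lookup (indv K) i) = (\<Prod>i<n. if i \<in> K then x i else 1)"
      using finK[OF K] by (intro prod.cong) auto
    also have "\<dots> = (\<Prod>i\<in>K. x i)"
      using K by (simp add: prod.If_cases Int_absorb1)
    finally show "of_int (mpcoeff (trunc n (elem_sym k)) (indv K)) * (\<Prod>i<n. x i ^ lookup (indv K) i) = (\<Prod>i\<in>K. x i)"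
      using K finK[OF K] by (simp add: mpcoeff_elem_sym)
  qed
  finally show ?thesis .
qed

lemma coeff_linear_prod:
  assumes "k \<le> n"
  shows "coeff (\<Prod>i<n. [:x i, 1:]) (n - k) = (\<Sum>K | K \<subseteq> {..<n} \<and> card K = k. \<Prod>i\<in>K. x i :: real)"
proof -
  have "(\<Prod>i<n. [:x i, 1:]) = (\<Prod>i<n. [:x i:] + [:0, 1:])"
    by simp
  also have "\<dots> = (\<Sum>K\<in>Pow {..<n}. (\<Prod>i\<in>K. [:x i:]) * (\<Prod>i\<in>{..<n} - K. [:0, 1:]))"
    by (rule prod_add) simp
  also have "\<dots> = (\<Sum>K\<in>Pow {..<n}. Polynomial.monom (\<Prod>i\<in>K. x i) (n - card K))"
  proof (rule sum.cong[OF refl])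
    fix K assume "K \<in> Pow {..<n}"
    then have K: "finite K" "K \<subseteq> {..<n}"
      using finite_subset by auto
    have "(\<Prod>i\<in>K. [:x i:]) = [:\<Prod>i\<in>K. x i:]"
      using K(1) by (induction K) (auto simp: one_pCons)
    then show "(\<Prod>i\<in>K. [:x i:]) * (\<Prod>i\<in>{..<n} - K. [:0, 1:]) = Polynomial.monom (\<Prod>i\<in>K. x i) (n - card K)"
      using K by (simp add: card_Diff_subset monom_altdef)
  qed
  finally have "coeff (\<Prod>i<n. [:x i, 1:]) (n - k) =
      (\<Sum>K\<in>Pow {..<n}. if n - card K = n - k then \<Prod>i\<in>K. x i else 0)"
    by (simp add: coeff_sum)
  also have "\<dots> = (\<Sum>K | K \<subseteq> {..<n} \<and> card K = k. \<Prod>i\<in>K. x i)"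
  proof (rule sum.mono_neutral_cong_right)
    have le: "card K \<le> n" if "K \<subseteq> {..<n}" for K
      using card_mono[OF finite_lessThan that] by simp
    show "\<forall>K\<in>Pow {..<n} - {K. K \<subseteq> {..<n} \<and> card K = k}.
        (if n - card K = n - k then \<Prod>i\<in>K. x i else 0) = 0"
    proof
      fix K assume "K \<in> Pow {..<n} - {K. K \<subseteq> {..<n} \<and> card K = k}"
      then have "card K \<le> n" "card K \<noteq> k"
        using le by auto
      then show "(if n - card K = n - k then \<Prod>i\<in>K. x i else 0) = 0"
        using assms by simp
    qed
  qed auto
  finally show ?thesis .
qed

section \<open>Uncountably many Witt vectors\<close>

lemma uncountable_bool_seqs: "uncountable (UNIV :: (nat \<Rightarrow> bool) set)"
proof
  assume "countable (UNIV :: (nat \<Rightarrow> bool) set)"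
  then obtain f :: "nat \<Rightarrow> nat \<Rightarrow> bool" where f: "range f = UNIV"
    using uncountable_def[of "UNIV :: (nat \<Rightarrow> bool) set"] by blast
  then obtain n where "f n = (\<lambda>i. \<not> f i i)"
    by (metis UNIV_I rangeE)
  then show False
    by metis
qed

lemma ex_two_small:
  fixes A :: "real set"
  assumes cl: "closure A = {0..}" and "0 < \<epsilon>"
  obtains a b where "a \<in> A" "b \<in> A" "0 < a" "a < b" "b < \<epsilon>"
proof -
  have ex: "\<exists>a\<in>A. 0 < a \<and> a < e" if e: "0 < e" for e :: real
  proof -
    have "e / 2 \<in> closure A"
      using e by (simp add: cl)
    then obtain a where a: "a \<in> A" "dist a (e / 2) < e / 2"
      using e unfolding closure_approachable by (meson half_gt_zero)
    then have "0 < a \<and> a < e"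
      unfolding dist_real_def abs_diff_less_iff by simp
    with a(1) show ?thesis ..
  qed
  obtain b where "b \<in> A" "0 < b" "b < \<epsilon>"
    using ex[OF assms(2)] by blast
  moreover obtain a where "a \<in> A" "0 < a" "a < b"
    using ex[OF \<open>0 < b\<close>] by blast
  ultimately show thesis
    using that by blast
qed

text \<open>The evaluations at the negated roots of the polynomials \<open>q n\<close> stabilise, since the
  coefficients of \<open>q n\<close> are elementary symmetric in the roots.\<close>

lemma hom_of_neg_rooted:
  fixes q :: "nat \<Rightarrow> real poly" and B :: "real set"
  assumes B: "is_subring B"
    and q: "\<And>n. neg_rooted (q n)" "\<And>n. degree (q n) = n"
    and e: "\<And>n k. k \<le> n \<Longrightarrow> coeff (q n) (n - k) = e k" "\<And>k. e k \<in> B"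
    and S: "is_subsemiring S" "S \<subseteq> Lambda_N"
  shows "\<exists>\<phi>\<in>Defs.semiring_hom S (B \<inter> {0..}). \<forall>k. elem_sym k \<in> S \<longrightarrow> \<phi> (elem_sym k) = e k"
proof -
  have "\<exists>x. (\<forall>i<n. 0 < x i) \<and> q n = (\<Prod>i<n. [:x i, 1:])" for n
  proof -
    obtain R where R: "real_rooted (q n) R" "\<forall>r\<in>R. r < 0"
      using q(1) unfolding neg_rooted_def by blast
    have fin: "finite R"
      using R(1) by (simp add: real_rooted_def)
    have card: "card R = n"
      using real_rooted_degree(1)[OF R(1)] q(2)[of n] by simp
    obtain h where h: "bij_betw h {0..<n} R"
      using ex_bij_betw_nat_finite[OF fin] unfolding card by blast
    have "q n = (\<Prod>i\<in>{0..<n}. [:- h i, 1:])"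
      using R(1) prod.reindex_bij_betw[OF h, of "\<lambda>r. [:- r, 1:]"] by (simp add: real_rooted_def)
    moreover have "0 < - h i" if "i < n" for i
      using R(2) bij_betwE[OF h] that by auto
    ultimately show ?thesis
      by (intro exI[of _ "\<lambda>i. - h i"]) (auto simp: atLeast0LessThan)
  qed
  then obtain x where x: "\<And>n i. i < n \<Longrightarrow> 0 < x n i" "\<And>n. q n = (\<Prod>i<n. [:x n i, 1:])"
    by metis
  have Bc: "1 \<in> B" "\<And>a b. a \<in> B \<Longrightarrow> b \<in> B \<Longrightarrow> a + b \<in> B" "\<And>a b. a \<in> B \<Longrightarrow> b \<in> B \<Longrightarrow> a * b \<in> B"
    "\<And>a. a \<in> B \<Longrightarrow> - a \<in> B"
    using B by (auto simp: is_subring_def is_subsemiring_def)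
  define stab where "stab f c \<longleftrightarrow> (\<exists>N. \<forall>n\<ge>N. ev n (x n) f = c)" for f c
  have unique: "c = d" if "stab f c" "stab f d" for f c d
    using that unfolding stab_def by (metis nle_le)
  have elem: "stab (elem_sym k) (e k)" for k
    unfolding stab_def
  proof (intro exI allI impI)
    fix n assume "k \<le> n"
    then show "ev n (x n) (elem_sym k) = e k"
      using coeff_linear_prod[of k n "x n"] e(1)[of k n] by (simp add: ev_elem_sym x(2))
  qed
  have lift2: "stab h (F c d)"
    if "stab f c" "stab g d" "\<And>n. ev n (x n) h = F (ev n (x n) f) (ev n (x n) g)" for F f g h c d
  proof -
    obtain N M where "\<forall>n\<ge>N. ev n (x n) f = c" "\<forall>n\<ge>M. ev n (x n) g = d"
      using \<open>stab f c\<close> \<open>stab g d\<close> unfolding stab_def by blast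
    then show ?thesis
      unfolding stab_def using that(3) by (intro exI[of _ "max N M"]) simp
  qed
  \<comment> \<open>Every symmetric function is an integer polynomial in the
    \<open>elem_sym k\<close>, so its evaluations become constant as well. Negation occurs here, so
    the limit is only known to lie in the ring \<open>B\<close>.\<close>
  have ex: "f \<in> Lambda_Z \<and> (\<exists>c\<in>B. stab f c)" if "f \<in> ring_gen (range elem_sym)" for f
    using that
  proof induction
    case (base f)
    then show ?case
      using elem e(2) elem_sym_in_Lambda_N Lambda_N_iff by blast
  next
    case one
    have "stab 1 1"
      by (simp add: stab_def ev_1)
    then show ?case
      using Bc(1) by auto
  next
    case (add f g)
    then obtain c d where "c \<in> B" "d \<in> B" "stab f c" "stab g d" by blast
    moreover from this have "stab (f + g) (c + d)"
      using add by (intro lift2[where F = "(+)"]) (auto simp: ev_add)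
    ultimately show ?case
      using add Bc(2) by blast
  next
    case (mult f g)
    then obtain c d where "c \<in> B" "d \<in> B" "stab f c" "stab g d" by blast
    moreover from this have "stab (f * g) (c * d)"
      using mult by (intro lift2[where F = "(*)"]) (auto simp: ev_mult)
    ultimately show ?case
      using mult Bc(3) by blast
  next
    case (neg f)
    then obtain c where "c \<in> B" "stab f c" by blast
    moreover from this have "stab (- f) (- c)"
      by (auto simp: stab_def ev_uminus)
    ultimately show ?case
      using neg Bc(4) by blast
  qed
  define \<phi> where "\<phi> = restrict (\<lambda>f. THE c. stab f c) S"
  have val: "\<phi> f = c" if "f \<in> S" "stab f c" for f c
    using that unique by (auto simp: \<phi>_def)
  have SZ: "f \<in> Lambda_Z" "\<And>\<alpha>. 0 \<le> mpcoeff f \<alpha>" if "f \<in> S" for f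
    using that S(2) Lambda_N_iff by blast+
  have phi: "stab f (\<phi> f) \<and> \<phi> f \<in> B" if "f \<in> S" for f
    using ex[OF subsetD[OF Lambda_Z_subset_ring_gen SZ(1)[OF that]]] val[OF that] by auto
  \<comment> \<open>The eventual value is an actual evaluation of a monomial-positive function at
    positive numbers.\<close>
  have nonneg: "0 \<le> \<phi> f" if f: "f \<in> S" for f
  proof -
    obtain N where "ev N (x N) f = \<phi> f"
      using phi[OF f] unfolding stab_def by blast
    moreover have "0 \<le> ev N (x N) f"
      using x(1) by (intro ev_nonneg SZ(2)[OF f]) (simp add: less_imp_le)
    ultimately show ?thesis by simp
  qed
  have Sc: "0 \<in> S" "1 \<in> S" "\<And>f g. f \<in> S \<Longrightarrow> g \<in> S \<Longrightarrow> f + g \<in> S" "\<And>f g. f \<in> S \<Longrightarrow> g \<in> S \<Longrightarrow> f * g \<in> S"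
    using S(1) by (auto simp: is_subsemiring_def)
  have "\<phi> \<in> Defs.semiring_hom S (B \<inter> {0..})"
    unfolding Defs.semiring_hom_def
  proof (intro CollectI conjI ballI)
    show "\<phi> \<in> S \<rightarrow>\<^sub>E B \<inter> {0..}"
      using phi nonneg by (auto simp: \<phi>_def)
    show "\<phi> 1 = 1"
      by (rule val[OF Sc(2)]) (simp add: stab_def ev_1)
    show add: "\<phi> (f + g) = \<phi> f + \<phi> g" if "f \<in> S" "g \<in> S" for f g
      using that phi SZ(1) by (intro val Sc(3) lift2[where F = "(+)"]) (auto simp: ev_add)
    show "\<phi> 0 = 0"
      using add[OF Sc(1) Sc(1)] by simp
    show "\<phi> (f * g) = \<phi> f * \<phi> g" if "f \<in> S" "g \<in> S" for f g
      using that phi SZ(1) by (intro val Sc(4) lift2[where F = "(*)"]) (auto simp: ev_mult)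
  qed
  moreover have "\<forall>k. elem_sym k \<in> S \<longrightarrow> \<phi> (elem_sym k) = e k"
    using val elem by blast
  ultimately show ?thesis by blast
qed

text \<open>Stated for a general \<open>S\<close> inside \<open>Lambda_N\<close>, so that one
  construction serves both kinds of Witt vectors.\<close>

lemma uncountable_semiring_hom:
  fixes B :: "real set"
  assumes B: "is_subring B" and cl: "closure (B \<inter> {0..}) = {0..}"
    and S: "is_subsemiring S" "S \<subseteq> Lambda_N" "\<And>n. 0 < n \<Longrightarrow> elem_sym n \<in> S"
  shows "uncountable (Defs.semiring_hom S (B \<inter> {0..}))"
proof -
  \<comment> \<open>The implication makes this true for every \<open>q\<close>, so that a single
    choice function can be extracted.\<close>
  have "\<exists>h :: bool \<Rightarrow> real. neg_rooted q \<longrightarrow>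
      h True \<noteq> h False \<and> (\<forall>b. h b \<in> B \<and> neg_rooted (pCons (h b) q))" for q
  proof (cases "neg_rooted q")
    case True
    then obtain \<epsilon> where \<epsilon>: "\<epsilon> > 0" "\<And>c. 0 < c \<Longrightarrow> c < \<epsilon> \<Longrightarrow> neg_rooted (pCons c q)"
      using neg_rooted_pCons by blast
    obtain a b where "a \<in> B \<inter> {0..}" "b \<in> B \<inter> {0..}" "0 < a" "a < b" "b < \<epsilon>"
      using ex_two_small[OF cl \<epsilon>(1)] .
    then show ?thesis
      using \<epsilon>(2) by (intro exI[of _ "\<lambda>c. if c then a else b"]) auto
  qed simp
  then obtain ch :: "real poly \<Rightarrow> bool \<Rightarrow> real" where ch: "\<And>q. neg_rooted q \<Longrightarrow> ch q True \<noteq> ch q False"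
    "\<And>q b. neg_rooted q \<Longrightarrow> ch q b \<in> B \<and> neg_rooted (pCons (ch q b) q)"
    by metis
  \<comment> \<open>\<open>pCons c q\<close> is \<open>z q + c\<close>: earlier coefficients move up
    by one degree but keep their values. Hence the coefficient at \<open>n - k\<close> is settled at
    stage \<open>k\<close>.\<close>
  define Q :: "(nat \<Rightarrow> bool) \<Rightarrow> nat \<Rightarrow> real poly"
    where "Q b = rec_nat 1 (\<lambda>n q. pCons (ch q (b n)) q)" for b
  have Q0: "Q b 0 = 1" and QSuc: "Q b (Suc n) = pCons (ch (Q b n) (b n)) (Q b n)" for b n
    by (simp_all add: Q_def)
  have Q: "neg_rooted (Q b n)" for b n
  proof (induction n)
    case 0
    show ?case
      unfolding neg_rooted_def real_rooted_def Q0 by (intro exI[of _ "{}"]) simp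
  next
    case (Suc n)
    then show ?case by (simp add: QSuc ch(2))
  qed
  have ne: "Q b n \<noteq> 0" for b n
    using Q[of b n] unfolding neg_rooted_def real_rooted_def by auto
  have deg: "degree (Q b n) = n" for b n
    by (induction n) (simp_all add: Q0 QSuc ne)
  define e where "e b k = coeff (Q b k) 0" for b k
  have coeffs: "coeff (Q b n) (n - k) = e b k" if "k \<le> n" for b n k
    using that
  proof (induction n)
    case (Suc n)
    show ?case
    proof (cases "k = Suc n")
      case False
      with Suc show ?thesis
        by (simp add: QSuc Suc_diff_le)
    qed (simp add: e_def)
  qed (simp add: e_def)
  have eB: "e b k \<in> B" for b k
  proof (cases k)
    case 0
    then show ?thesis
      using B by (simp add: e_def Q0 is_subring_def is_subsemiring_def)
  next
    case (Suc n)
    then show ?thesis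
      using ch(2)[OF Q] by (simp add: e_def QSuc)
  qed
  have "\<exists>\<phi>\<in>Defs.semiring_hom S (B \<inter> {0..}). \<forall>k. elem_sym k \<in> S \<longrightarrow> \<phi> (elem_sym k) = e b k" for b
    using Q deg coeffs eB by (rule hom_of_neg_rooted[OF B _ _ _ _ S(1,2)])
  then obtain F where F: "\<And>b. F b \<in> Defs.semiring_hom S (B \<inter> {0..})"
    "\<And>b k. elem_sym k \<in> S \<Longrightarrow> F b (elem_sym k) = e b k"
    by metis
  have "inj F"
  proof (rule injI)
    fix b b' assume eq: "F b = F b'"
    \<comment> \<open>The value at \<open>elem_sym (Suc n)\<close> is the constant added at stage
      \<open>n\<close>; once the polynomials agree, it reveals the bit \<open>b n\<close>.\<close>
    have ee: "e b (Suc n) = e b' (Suc n)" for n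
      using F(2)[of "Suc n" b] F(2)[of "Suc n" b'] S(3)[of "Suc n"] eq by simp
    have QQ: "Q b n = Q b' n" for n
    proof (induction n)
      case (Suc n)
      have "ch (Q b n) (b n) = ch (Q b' n) (b' n)"
        using ee[of n] by (simp add: e_def QSuc)
      with Suc show ?case
        by (simp add: QSuc)
    qed (simp add: Q0)
    show "b = b'"
    proof
      fix n
      have "ch (Q b n) (b n) = ch (Q b n) (b' n)"
        using ee[of n] QQ[of n] by (simp add: e_def QSuc)
      then show "b n = b' n"
        using ch(1)[OF Q, of b n] by (cases "b n"; cases "b' n") auto
    qed
  qed
  then have "uncountable (range F)"
    using uncountable_bool_seqs countable_image_inj_on by blast
  moreover have "range F \<subseteq> Defs.semiring_hom S (B \<inter> {0..})"
    using F(1) by auto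
  ultimately show ?thesis
    using countable_subset by blast
qed

theorem theorem9p1:
  fixes A :: "real set"
  assumes "is_subsemiring A" and "A \<subseteq> {0..}" and "countable A"
  shows "(closure A \<noteq> {0..} \<longrightarrow> countable (Witt A) \<and> countable (Witt_Sch A)) \<and>
    (closure A = {0..} \<and> (\<exists>B :: real set. is_subring B \<and> A = B \<inter> {0..}) \<longrightarrow>
      uncountable (Witt A) \<and> uncountable (Witt_Sch A))"
proof (intro conjI impI)
  assume "closure A \<noteq> {0..}"
  then show "countable (Witt A)" "countable (Witt_Sch A)"
    using countable_Witt countable_Witt_Sch assms by blast+
next
  assume *: "closure A = {0..} \<and> (\<exists>B :: real set. is_subring B \<and> A = B \<inter> {0..})"
  then obtain B where B: "is_subring B" "A = B \<inter> {0..}" "closure (B \<inter> {0..}) = {0..}"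
    by auto
  show "uncountable (Witt A)"
    unfolding Witt_def B(2)
    using is_subsemiring_Lambda_N elem_sym_in_Lambda_N by (intro uncountable_semiring_hom B(1,3)) auto
  show "uncountable (Witt_Sch A)"
    unfolding Witt_Sch_def B(2)
  proof (intro uncountable_semiring_hom B(1,3) is_subsemiring_Lambda_Sch Lambda_Sch_subset_Lambda_N)
    show "elem_sym n \<in> Lambda_Sch" if "0 < n" for n
      using elem_sym_eq_sch[OF that] sch_in_Lambda_Sch[OF shape_col] by simp
  qed
qed

end
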